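(* Let $A$ be the preprojective algebra of type $\mathrm{A}_n$ ($n\geq3$) over a field $\mathbb{F}$, and let $m=\lfloor\frac{n-1}{2}\rfloor$. If $\mathrm{char}(\mathbb{F})=2$, then $\mathrm{HK}^\bullet_{hi}(A)=\mathrm{HK}^\bullet(A)$. If $\mathrm{char}(\mathbb{F})\neq2$ and $n$ is even, then $\mathrm{HK}^2_{hi}(A)=\mathrm{HK}^2(A)$ and $\mathrm{HK}^p_{hi}(A)=0$ if $p\neq2$. If $\mathrm{char}(\mathbb{F})\neq2$ and $n$ is odd, then $\mathrm{HK}^0_{hi}(A)=\mathrm{HK}^0(A)_{2m}$ has dimension $1$ and is spanned by $z_m$, $\mathrm{HK}^2_{hi}(A)=\mathrm{HK}^2(A)$, and $\mathrm{HK}^p_{hi}(A)=0$ if $p\neq0$ and $p\neq2$.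
   Context: The algebra. $\overline{Q}$ is the quiver with vertices $0,1,\ldots,n-1$ and arrows $a_i:i\to i+1$, $a_i^*:i+1\to i$ for $0\leq i\leq n-2$; paths are written from right to left. $k=\bigoplus_i\mathbb{F}e_i$, $V=\mathbb{F}\overline{Q}_1$, $k^e=k\otimes_{\mathbb{F}}k$, and $A=\mathbb{F}\overline{Q}/(R)$ where $R\subseteq V\otimes_kV$ is spanned by $\sigma_0=-a_0^*a_0$, $\sigma_i=a_{i-1}a_{i-1}^*-a_i^*a_i$ ($1\leq i\leq n-2$), $\sigma_{n-1}=a_{n-2}a_{n-2}^*$. $A$ is graded by path length. Koszul cohomology. $W_0=k$, $W_1=V$, $W_p=\bigcap_{i+2+j=p}V^{\otimes_k i}\otimes_kR\otimes_kV^{\otimes_k j}$ for $p\geq2$; elements of $W_p$ are written $x_1\ldots x_p$ (a sum is understood). $\mathrm{HK}^\bullet(A)=H^\bullet(\mathrm{Hom}_{k^e}(W_\bullet,A),b_K)$ with $b_K(f)(x_1\ldots x_{p+1})=f(x_1\ldots x_p)x_{p+1}-(-1)^px_1f(x_2\ldots x_{p+1})$ for $f:W_p\to A$; $\mathrm{HK}^p(A)_r$ is the part represented by cocycles $W_p\to A_r$. The Koszul cup product is induced by $(f\smile g)(x_1\ldots x_{p+q})=(-1)^{pq}f(x_1\ldots x_p)g(x_{p+1}\ldots x_{p+q})$. $\mathrm{HK}^0(A)$ is identified with the centre of $A$; $z_\ell=\sum_{i=1}^{n-2}(a_i^*a_i)^\ell$ for $1\leq\ell\leq m$. Higher Koszul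 cohomology. Let $\overline{\mathfrak{e}}_A\in\mathrm{HK}^1(A)$ be the class of the cocycle $\mathfrak{e}_A:V\to A$, $x\mapsto x$; it satisfies $\mathfrak{e}_A\smile\mathfrak{e}_A=0$. $\mathrm{HK}^\bullet_{hi}(A)$ is the cohomology of the complex $(\mathrm{HK}^\bullet(A),\overline{\mathfrak{e}}_A\smile-)$. The equality $\mathrm{HK}^2_{hi}(A)=\mathrm{HK}^2(A)$ means that the canonical map to the cohomology is the identity (and similarly for the other equalities). *)

theory Defs
  imports "Jordan_Normal_Form.VS_Connect" "HOL-Algebra.QuotRing" "HOL-Library.FuncSet"
begin

section \<open>Quotients and cohomology of modules\<close>

text \<open>Scalars are taken in a type of class \<^class>\<open>field\<close>, seen as the ring record
  \<^term>\<open>class_ring\<close> when it is an argument of a module notion.\<close>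

definition quot_module :: "('a, 'b) module \<Rightarrow> 'b set \<Rightarrow> ('a, 'b set) module" where
  "quot_module M N = ring.extend (M Quot N)
     (module.fields (\<lambda>c X. \<Union>x\<in>X. N +>\<^bsub>M\<^esub> (c \<odot>\<^bsub>M\<^esub> x)))"

definition cocycles ::
  "(nat \<Rightarrow> ('a, 'b) module) \<Rightarrow> (nat \<Rightarrow> 'b \<Rightarrow> 'b) \<Rightarrow> nat \<Rightarrow> 'b set" where
  "cocycles C d p = {x \<in> carrier (C p). d p x = \<zero>\<^bsub>C (Suc p)\<^esub>}"

definition coboundaries ::
  "(nat \<Rightarrow> ('a, 'b) module) \<Rightarrow> (nat \<Rightarrow> 'b \<Rightarrow> 'b) \<Rightarrow> nat \<Rightarrow> 'b set" where
  "coboundaries C d p =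
     (case p of 0 \<Rightarrow> {\<zero>\<^bsub>C 0\<^esub>} | Suc r \<Rightarrow> d r ` carrier (C r))"

definition cohomology ::
  "(nat \<Rightarrow> ('a, 'b) module) \<Rightarrow> (nat \<Rightarrow> 'b \<Rightarrow> 'b) \<Rightarrow> nat \<Rightarrow> ('a, 'b set) module" where
  "cohomology C d p =
     quot_module (C p\<lparr>carrier := cocycles C d p\<rparr>) (coboundaries C d p)"

definition coh_class ::
  "(nat \<Rightarrow> ('a, 'b) module) \<Rightarrow> (nat \<Rightarrow> 'b \<Rightarrow> 'b) \<Rightarrow> nat \<Rightarrow> 'b \<Rightarrow> 'b set" where
  "coh_class C d p x = coboundaries C d p +>\<^bsub>C p\<^esub> x"


section \<open>The path algebra of the double quiver of type A\<close>

text \<open>\<open>Arr i\<close> is the arrow \<open>a\<^sub>i\<close> from \<open>i\<close> to \<open>i + 1\<close>; \<open>Star i\<close> is \<open>a\<^sub>i\<^sup>*\<close>, in the opposite direction.\<close>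

datatype arrow = Arr nat | Star nat

fun source :: "arrow \<Rightarrow> nat" where
  "source (Arr i) = i"
| "source (Star i) = i + 1"

fun target :: "arrow \<Rightarrow> nat" where
  "target (Arr i) = i + 1"
| "target (Star i) = i"

definition arrows :: "nat \<Rightarrow> arrow set" where
  "arrows n = Arr ` {i. i + 2 \<le> n} \<union> Star ` {i. i + 2 \<le> n}"

text \<open>A path is written from right to left: \<open>(v, [x\<^sub>1, \<dots>, x\<^sub>r])\<close> is the path \<open>x\<^sub>1 \<dots> x\<^sub>r\<close> whose
  first arrow is \<open>x\<^sub>r\<close> and whose target is \<open>v\<close>. In particular \<open>(v, [])\<close> is the idempotent \<open>e\<^sub>v\<close>.\<close>

type_synonym path = "nat \<times> arrow list"

definition path_source :: "path \<Rightarrow> nat" where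
  "path_source p = (if snd p = [] then fst p else source (last (snd p)))"

fun is_path :: "nat \<Rightarrow> path \<Rightarrow> bool" where
  "is_path n (v, []) \<longleftrightarrow> v < n"
| "is_path n (v, x # xs) \<longleftrightarrow> x \<in> arrows n \<and> target x = v \<and> is_path n (source x, xs)"

text \<open>An element of the path algebra is the function giving the coefficient of each path.\<close>

type_synonym 'a path_fun = "path \<Rightarrow> 'a"

definition path_alg :: "nat \<Rightarrow> ('a::field, 'a path_fun) module" where
  "path_alg n = \<lparr>
     carrier = {f. finite {p. f p \<noteq> 0} \<and> (\<forall>p. f p \<noteq> 0 \<longrightarrow> is_path n p)},
     mult = (\<lambda>f g (v, xs). \<Sum>k\<le>length xs.
       f (v, take k xs) * g (path_source (v, take k xs), drop k xs)),
     one = (\<lambda>(v, xs). if v < n \<and> xs = [] then 1 else 0),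
     zero = (\<lambda>_. 0),
     add = (\<lambda>f g p. f p + g p),
     smult = (\<lambda>c f p. c * f p)\<rparr>"

definition arrow_elt :: "arrow \<Rightarrow> 'a::field path_fun" where
  "arrow_elt x = (\<lambda>p. if p = (target x, [x]) then 1 else 0)"

text \<open>\<open>path_grade n r\<close> is the span of the paths of length \<open>r\<close>. Grades 0 and 1 are \<open>k\<close> and \<open>V\<close>, and
  concatenation of paths identifies grade \<open>r\<close> with the \<open>r\<close>-fold tensor power of \<open>V\<close> over \<open>k\<close>.\<close>

definition path_grade :: "nat \<Rightarrow> nat \<Rightarrow> 'a::field path_fun set" where
  "path_grade n r = {f \<in> carrier (path_alg n). \<forall>p. f p \<noteq> 0 \<longrightarrow> length (snd p) = r}"


section \<open>The preprojective algebra of type A\<close>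

definition relator :: "nat \<Rightarrow> nat \<Rightarrow> 'a::field path_fun" where
  "relator n i =
     (if i = 0 then \<ominus>\<^bsub>path_alg n\<^esub> (arrow_elt (Star 0) \<otimes>\<^bsub>path_alg n\<^esub> arrow_elt (Arr 0))
      else if i = n - 1 then
        arrow_elt (Arr (n - 2)) \<otimes>\<^bsub>path_alg n\<^esub> arrow_elt (Star (n - 2))
      else arrow_elt (Arr (i - 1)) \<otimes>\<^bsub>path_alg n\<^esub> arrow_elt (Star (i - 1))
        \<ominus>\<^bsub>path_alg n\<^esub> arrow_elt (Star i) \<otimes>\<^bsub>path_alg n\<^esub> arrow_elt (Arr i))"

definition relators :: "nat \<Rightarrow> 'a::field path_fun set" where
  "relators n =
     LinearCombinations.module.span class_ring (path_alg n) (relator n ` {..<n})"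

definition relation_ideal :: "nat \<Rightarrow> 'a::field path_fun set" where
  "relation_ideal n = Idl\<^bsub>path_alg n\<^esub> (relators n)"

definition preproj :: "nat \<Rightarrow> ('a::field, 'a path_fun set) module" where
  "preproj n = quot_module (path_alg n) (relation_ideal n)"

definition preproj_class :: "nat \<Rightarrow> 'a::field path_fun \<Rightarrow> 'a path_fun set" where
  "preproj_class n x = relation_ideal n +>\<^bsub>path_alg n\<^esub> x"

definition preproj_grade :: "nat \<Rightarrow> nat \<Rightarrow> 'a::field path_fun set set" where
  "preproj_grade n r = preproj_class n ` path_grade n r"


section \<open>Koszul cohomology\<close>

text \<open>Tensor products over \<open>k\<close> of \<open>k\<close>-subbimodules of tensor powers of \<open>V\<close> are subspaces of tensor
  powers of \<open>V\<close>, because \<open>k\<close> is semisimple; under the identification above they are spanned by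
  products in the path algebra.\<close>

definition tensor_prod ::
  "nat \<Rightarrow> 'a::field path_fun set \<Rightarrow> 'a path_fun set \<Rightarrow> 'a path_fun set" where
  "tensor_prod n X Y =
     {w. \<exists>(N::nat) x y. (\<forall>i<N. x i \<in> X \<and> y i \<in> Y) \<and>
        w = (\<Oplus>\<^bsub>path_alg n\<^esub>i\<in>{..<N}. x i \<otimes>\<^bsub>path_alg n\<^esub> y i)}"

definition koszul_W :: "nat \<Rightarrow> nat \<Rightarrow> 'a::field path_fun set" where
  "koszul_W n p =
     (if p \<le> 1 then path_grade n p
      else {w. \<forall>i j. i + 2 + j = p \<longrightarrow>
        w \<in> tensor_prod n (tensor_prod n (path_grade n i) (relators n)) (path_grade n j)})"

type_synonym 'a cochain = "'a path_fun \<Rightarrow> 'a path_fun set"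

text \<open>The space of \<open>k\<^sup>e\<close>-linear maps from \<open>W\<^sub>p\<close> to \<open>A\<close>. The multiplicative fields of the record are
  irrelevant.\<close>

definition koszul_cochains :: "nat \<Rightarrow> nat \<Rightarrow> ('a::field, 'a cochain) module" where
  "koszul_cochains n p = \<lparr>
     carrier = {f \<in> koszul_W n p \<rightarrow>\<^sub>E carrier (preproj n).
       (\<forall>x\<in>koszul_W n p. \<forall>y\<in>koszul_W n p.
          f (x \<oplus>\<^bsub>path_alg n\<^esub> y) = f x \<oplus>\<^bsub>preproj n\<^esub> f y) \<and>
       (\<forall>u\<in>path_grade n 0. \<forall>v\<in>path_grade n 0. \<forall>x\<in>koszul_W n p.
          f (u \<otimes>\<^bsub>path_alg n\<^esub> (x \<otimes>\<^bsub>path_alg n\<^esub> v)) =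
          preproj_class n u \<otimes>\<^bsub>preproj n\<^esub> (f x \<otimes>\<^bsub>preproj n\<^esub> preproj_class n v))},
     mult = (\<lambda>f g. \<lambda>x\<in>koszul_W n p. \<zero>\<^bsub>preproj n\<^esub>),
     one = (\<lambda>x\<in>koszul_W n p. \<zero>\<^bsub>preproj n\<^esub>),
     zero = (\<lambda>x\<in>koszul_W n p. \<zero>\<^bsub>preproj n\<^esub>),
     add = (\<lambda>f g. \<lambda>x\<in>koszul_W n p. f x \<oplus>\<^bsub>preproj n\<^esub> g x),
     smult = (\<lambda>c f. \<lambda>x\<in>koszul_W n p. c \<odot>\<^bsub>preproj n\<^esub> f x)\<rparr>"

text \<open>\<open>split_apply n p q f g w\<close> is \<open>f(x\<^sub>1 \<dots> x\<^sub>p) g(x\<^sub>p\<^sub>+\<^sub>1 \<dots> x\<^sub>p\<^sub>+\<^sub>q)\<close> for \<open>w = x\<^sub>1 \<dots> x\<^sub>p\<^sub>+\<^sub>q\<close>, sum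
  understood: decompose \<open>w\<close> as a sum of products of elements of \<open>W\<^sub>p\<close> and of \<open>W\<^sub>q\<close>. For \<open>k\<^sup>e\<close>-linear
  \<open>f\<close> and \<open>g\<close> the value does not depend on the decomposition.\<close>

definition split_apply ::
  "nat \<Rightarrow> nat \<Rightarrow> nat \<Rightarrow> 'a::field cochain \<Rightarrow> 'a cochain \<Rightarrow> 'a cochain" where
  "split_apply n p q f g w =
     (THE a. \<exists>(N::nat) x y. (\<forall>i<N. x i \<in> koszul_W n p \<and> y i \<in> koszul_W n q) \<and>
        w = (\<Oplus>\<^bsub>path_alg n\<^esub>i\<in>{..<N}. x i \<otimes>\<^bsub>path_alg n\<^esub> y i) \<and>
        a = (\<Oplus>\<^bsub>preproj n\<^esub>i\<in>{..<N}. f (x i) \<otimes>\<^bsub>preproj n\<^esub> g (y i)))"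

definition koszul_d :: "nat \<Rightarrow> nat \<Rightarrow> 'a::field cochain \<Rightarrow> 'a cochain" where
  "koszul_d n p f = (\<lambda>w\<in>koszul_W n (Suc p).
     split_apply n p 1 f (preproj_class n) w \<ominus>\<^bsub>preproj n\<^esub>
     ((-1) ^ p) \<odot>\<^bsub>preproj n\<^esub> split_apply n 1 p (preproj_class n) f w)"

definition koszul_cup ::
  "nat \<Rightarrow> nat \<Rightarrow> nat \<Rightarrow> 'a::field cochain \<Rightarrow> 'a cochain \<Rightarrow> 'a cochain" where
  "koszul_cup n p q f g = (\<lambda>w\<in>koszul_W n (p + q).
     ((-1) ^ (p * q)) \<odot>\<^bsub>preproj n\<^esub> split_apply n p q f g w)"

definition HK :: "nat \<Rightarrow> nat \<Rightarrow> ('a::field, 'a cochain set) module" where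
  "HK n = cohomology (koszul_cochains n) (koszul_d n)"

definition HK_class :: "nat \<Rightarrow> nat \<Rightarrow> 'a::field cochain \<Rightarrow> 'a cochain set" where
  "HK_class n = coh_class (koszul_cochains n) (koszul_d n)"

definition HK_grade :: "nat \<Rightarrow> nat \<Rightarrow> nat \<Rightarrow> 'a::field cochain set set" where
  "HK_grade n p r = {HK_class n p f | f.
     f \<in> cocycles (koszul_cochains n) (koszul_d n) p \<and> f ` koszul_W n p \<subseteq> preproj_grade n r}"

definition HK_cup ::
  "nat \<Rightarrow> nat \<Rightarrow> nat \<Rightarrow> 'a::field cochain set \<Rightarrow> 'a cochain set \<Rightarrow> 'a cochain set" where
  "HK_cup n p q X Y = (\<Union>f\<in>X. \<Union>g\<in>Y. HK_class n (p + q) (koszul_cup n p q f g))"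

text \<open>The class in \<open>HK\<^sup>0\<close> of a central element \<open>z\<close> is that of the cochain \<open>k \<rightarrow> A\<close> sending 1 to \<open>z\<close>.\<close>

definition centre_class :: "nat \<Rightarrow> 'a::field path_fun set \<Rightarrow> 'a cochain set" where
  "centre_class n z =
     HK_class n 0 (\<lambda>x\<in>koszul_W n 0. preproj_class n x \<otimes>\<^bsub>preproj n\<^esub> z)"

definition z_elt :: "nat \<Rightarrow> nat \<Rightarrow> 'a::field path_fun set" where
  "z_elt n l = (\<Oplus>\<^bsub>preproj n\<^esub>i\<in>{1..n - 2}.
     (preproj_class n (arrow_elt (Star i)) \<otimes>\<^bsub>preproj n\<^esub> preproj_class n (arrow_elt (Arr i)))
       [^]\<^bsub>preproj n\<^esub> l)"


section \<open>Higher Koszul cohomology\<close>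

definition fundamental_class :: "nat \<Rightarrow> 'a::field cochain set" where
  "fundamental_class n = HK_class n 1 (\<lambda>x\<in>koszul_W n 1. preproj_class n x)"

definition fundamental_cup :: "nat \<Rightarrow> nat \<Rightarrow> 'a::field cochain set \<Rightarrow> 'a cochain set" where
  "fundamental_cup n p X = HK_cup n 1 p (fundamental_class n) X"

definition HKhi :: "nat \<Rightarrow> nat \<Rightarrow> ('a::field, 'a cochain set set) module" where
  "HKhi n = cohomology (HK n) (fundamental_cup n)"

definition HKhi_class :: "nat \<Rightarrow> nat \<Rightarrow> 'a::field cochain set \<Rightarrow> 'a cochain set set" where
  "HKhi_class n = coh_class (HK n) (fundamental_cup n)"

text \<open>Equality of the higher cohomology in degree \<open>p\<close> with a subspace \<open>S\<close> of \<open>HK\<^sup>p\<close>: the cocycles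
  for the cup product with the fundamental class are exactly \<open>S\<close>, and the canonical map from them to
  their classes is a bijection, i.e. the coboundaries vanish.\<close>

definition HKhi_equals :: "nat \<Rightarrow> nat \<Rightarrow> 'a::field cochain set set \<Rightarrow> bool" where
  "HKhi_equals n p S \<longleftrightarrow>
     cocycles (HK n) (fundamental_cup n) p = S \<and>
     bij_betw (HKhi_class n p) S (carrier (HKhi n p))"

end

theory Submission
  imports Defs
begin

text \<open>In the preprojective algebra \<open>A\<close> all paths with the same source \<open>i\<close>, target \<open>j\<close> and length \<open>r\<close>
  are equal: the relations turn every peak of a path into a valley and conversely. They vanish
  exactly when the lowest point of the valley would lie below the vertex 0 or the highest point of
  the peak above the vertex \<open>n - 1\<close>. So an element of \<open>A\<close> is given by one coordinate for each
  admissible triple \<open>(j, i, r)\<close>, namely the sum of the coefficients of all paths of this type.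
  Since \<open>W\<^sub>p = 0\<close> for \<open>p \<ge> 3\<close>, the Koszul complex becomes an explicit complex of coordinate functions
  with three terms. In it, \<open>HK\<^sup>0\<close> is the space of functions that are constant along the vertices,
  \<open>HK\<^sup>2\<close> is concentrated in degree 0, and a class in \<open>HK\<^sup>1\<close> is determined by the sums of the coordinates
  at \<open>a\<^sub>i\<close> and \<open>a\<^sub>i\<^sup>*\<close>, which do not depend on \<open>i\<close>. The cup product with the fundamental class raises
  the degree, so it vanishes on \<open>HK\<^sup>1\<close>; on \<open>HK\<^sup>0\<close> it is multiplication by 2 after deletion of the
  coordinate in the degree \<open>n - 1\<close>, which only exists if \<open>n\<close> is odd.\<close>

section \<open>Quotient modules\<close>

text \<open>Rewriting shows that two paths of one type agree in A, but not that they are nonzero.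
  Nonvanishing comes from a functional: the sum of the coefficients over all paths of an admissible
  type vanishes on the relation ideal. This rests on \<open>adm_split\<close>: when a path of
  admissible type is cut, both pieces have admissible type. The same fact makes multiplication in A
  a plain convolution of coordinates. The definitions demand two independence proofs.
  \<open>split_apply\<close> is a definite description over all decompositions of a tensor, so
  \<open>split_value\<close> computes it from the coefficients of the tensor alone.
  \<open>HK_cup\<close> is a union over all representatives, so products are computed for an
  arbitrary cochain in the fundamental class, which is known only through its pair sums. These are 2
  in degree 1 and 0 otherwise, since \<open>Arr i\<close> and \<open>Star i\<close> contribute 1
  each; this is the origin of the factor 2. In every case the image of the product with the
  fundamental class is 0 or everything, and for odd \<open>n\<close> its kernel on HK^0 consists of
  the multiples of one class, so the submodules in the quotients are explicit.\<close>

lemma quot_module_sel: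
  "carrier (quot_module M N) = a_rcosets\<^bsub>M\<^esub> N"
  "mult (quot_module M N) = rcoset_mult M N"
  "one (quot_module M N) = N +>\<^bsub>M\<^esub> \<one>\<^bsub>M\<^esub>"
  "zero (quot_module M N) = N"
  "add (quot_module M N) = set_add M"
  "smult (quot_module M N) = (\<lambda>c X. \<Union>x\<in>X. N +>\<^bsub>M\<^esub> (c \<odot>\<^bsub>M\<^esub> x))"
  by (simp_all add: quot_module_def FactRing_def ring.extend_def module.fields_def)

lemma quot_module_carrier: "carrier (quot_module M N) = (\<lambda>x. N +>\<^bsub>M\<^esub> x) ` carrier M"
  by (auto simp: quot_module_sel A_RCOSETS_def')

lemma (in submodule) abelian_subgroup: "abelian_subgroup N M"
proof -
  interpret M: Module.module R M by (rule module)
  show ?thesis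
  proof (rule abelian_subgroupI3[OF additive_subgroupI])
    show "subgroup N (add_monoid M)"
    proof (rule M.add.subgroupI)
      fix a assume "a \<in> N"
      then show "\<ominus> a \<in> N"
        using M.smult_minus_1 subset smult_closed[OF M.R.a_inv_closed[OF M.R.one_closed]]
        by (metis subsetD)
    qed (use subset zero_closed in \<open>auto simp del: zero_closed\<close>)
  qed (rule M.abelian_group_axioms)
qed

lemma (in submodule) coset_eq_iff:
  assumes "x \<in> carrier M" "y \<in> carrier M"
  shows "N +> x = N +> y \<longleftrightarrow> (\<exists>a\<in>N. y = a \<oplus> x)"
proof -
  interpret abelian_subgroup N M by (rule abelian_subgroup)
  have "N +> x = N +> y \<longleftrightarrow> y \<in> N +> x"
    using a_repr_independence'[of y x] a_repr_independenceD[of y x] assms by auto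
  then show ?thesis by (auto simp: a_r_coset_def')
qed

lemma (in submodule) coset_eq_self_iff:
  assumes "x \<in> carrier M"
  shows "N +> x = N \<longleftrightarrow> x \<in> N"
proof -
  interpret abelian_subgroup N M by (rule abelian_subgroup)
  show ?thesis
    using a_coset_join2[OF assms a_subgroup] a_rcos_self[OF assms] by auto
qed

locale quotient_module = submodule R N M for R N and M :: "('a, 'b) module" (structure)

lemma (in quotient_module) quot_add:
  assumes "x \<in> carrier M" "y \<in> carrier M"
  shows "(N +> x) \<oplus>\<^bsub>quot_module M N\<^esub> (N +> y) = N +> (x \<oplus> y)"
proof -
  interpret abelian_subgroup N M by (rule abelian_subgroup)
  show ?thesis using a_rcos_sum[OF assms] by (simp add: quot_module_sel)
qed

text \<open>Scalar multiplication on the quotient is a union over all representatives. It is a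
  single coset because \<open>c\<close> times an element of \<open>N\<close> stays in
  \<open>N\<close>.\<close>

lemma (in quotient_module) quot_smult:
  assumes "c \<in> carrier R" "x \<in> carrier M"
  shows "c \<odot>\<^bsub>quot_module M N\<^esub> (N +> x) = N +> (c \<odot> x)"
proof -
  interpret M: Module.module R M by (rule module)
  interpret abelian_subgroup N M by (rule abelian_subgroup)
  have "N +> (c \<odot> y) = N +> (c \<odot> x)" if y: "y \<in> N +> x" for y
  proof -
    from y obtain a where a: "a \<in> N" "y = a \<oplus> x" by (auto simp: a_r_coset_def')
    have "a \<in> carrier M" using a subset by auto
    then have "c \<odot> y = (c \<odot> a) \<oplus> (c \<odot> x)"
      using a assms by (simp add: M.smult_r_distr)
    moreover have "c \<odot> a \<in> N" using a assms by simp
    moreover have "c \<odot> y \<in> carrier M" using a assms \<open>a \<in> carrier M\<close> by simp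
    ultimately show ?thesis using coset_eq_iff[of "c \<odot> x" "c \<odot> y"] assms by auto
  qed
  moreover have "N +> x \<noteq> {}" using a_rcos_self[OF assms(2)] by blast
  ultimately show ?thesis unfolding quot_module_sel by (intro SUP_eq_const)
qed

lemma (in quotient_module) quot_module_is_module: "module R (quot_module M N)"
proof -
  interpret M: Module.module R M by (rule module)
  interpret abelian_subgroup N M by (rule abelian_subgroup)
  let ?Q = "quot_module M N"
  have car: "carrier ?Q = (\<lambda>x. N +> x) ` carrier M" by (rule quot_module_carrier)
  have z: "\<zero>\<^bsub>?Q\<^esub> = N +> \<zero>"
    using coset_eq_self_iff[of "\<zero>"] by (simp add: quot_module_sel)
  show ?thesis
  proof (rule module_criteria)
    show "cring R" ..
    show "\<zero>\<^bsub>?Q\<^esub> \<in> carrier ?Q" using z car by auto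
    show "\<forall>v\<in>carrier ?Q. \<exists>w\<in>carrier ?Q. v \<oplus>\<^bsub>?Q\<^esub> w = \<zero>\<^bsub>?Q\<^esub>"
      unfolding car z
    proof safe
      fix x assume "x \<in> carrier M"
      then show "\<exists>w\<in>(+>) N ` carrier M. (N +> x) \<oplus>\<^bsub>?Q\<^esub> w = N +> \<zero>"
        by (intro bexI[of _ "N +> (\<ominus> x)"]) (auto simp: quot_add M.r_neg)
    qed
    show "\<forall>v w. v \<in> carrier ?Q \<and> w \<in> carrier ?Q \<longrightarrow> v \<oplus>\<^bsub>?Q\<^esub> w = w \<oplus>\<^bsub>?Q\<^esub> v"
      unfolding car using M.a_comm by (auto simp: quot_add)
    show "\<forall>v w x. v \<in> carrier ?Q \<and> w \<in> carrier ?Q \<and> x \<in> carrier ?Q \<longrightarrow>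
        v \<oplus>\<^bsub>?Q\<^esub> w \<oplus>\<^bsub>?Q\<^esub> x = v \<oplus>\<^bsub>?Q\<^esub> (w \<oplus>\<^bsub>?Q\<^esub> x)"
      unfolding car by (auto simp: quot_add M.a_assoc)
  qed (unfold car z, auto simp: quot_add quot_smult M.smult_l_distr M.smult_r_distr M.smult_assoc1)
qed

text \<open>\<open>cohomology\<close> restricts the carrier to the cocycles before it divides by the
  coboundaries; a coset depends on the addition only, so it does not see the restriction.\<close>

lemma coset_restrict: "N +>\<^bsub>M\<lparr>carrier := K\<rparr>\<^esub> x = N +>\<^bsub>M\<^esub> x"
  by (simp add: a_r_coset_def')

lemma submodule_restrict:
  assumes "submodule R K M" "submodule R N M" "N \<subseteq> K"
  shows "submodule R N (M\<lparr>carrier := K\<rparr>)"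
proof -
  interpret K: submodule R K M by fact
  interpret N: submodule R N M by fact
  interpret Module.module R M by (rule K.module)
  show ?thesis
    by (rule submodule.intro) (use assms in \<open>auto intro: submodule_is_module\<close>)
qed

text \<open>\<open>quot_module\<close> adjoins a scalar multiplication to the factor ring; the ring
  axioms mention ring fields only and therefore survive.\<close>

lemma ring_extend:
  assumes "ring S"
  shows "ring (ring.extend S m)"
proof -
  interpret ring S by fact
  have 1: "abelian_group (ring.extend S m)"
  proof (rule abelian_groupI)
    fix x assume "x \<in> carrier (ring.extend S m)"
    then show "\<exists>y\<in>carrier (ring.extend S m). y \<oplus>\<^bsub>ring.extend S m\<^esub> x = \<zero>\<^bsub>ring.extend S m\<^esub>"
      using l_neg by (auto simp: ring.extend_def intro!: bexI[of _ "\<ominus>\<^bsub>S\<^esub> x"])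
  qed (auto simp: ring.extend_def a_assoc intro: a_comm)
  have 2: "Group.monoid (ring.extend S m)"
    by (rule monoidI) (auto simp: ring.extend_def m_assoc)
  show ?thesis
    by (rule ringI[OF 1 2]) (auto simp: ring.extend_def l_distr r_distr)
qed

lemma cohomology_sel:
  "carrier (cohomology C d p) = coh_class C d p ` cocycles C d p"
  "\<zero>\<^bsub>cohomology C d p\<^esub> = coboundaries C d p"
  by (auto simp: cohomology_def quot_module_carrier quot_module_sel coset_restrict coh_class_def)

section \<open>The path algebra\<close>

definition path_elt :: "path \<Rightarrow> 'a::field path_fun" where
  "path_elt q = (\<lambda>p. if p = q then 1 else 0)"

lemma arrow_elt_eq: "arrow_elt x = path_elt (target x, [x])"
  by (simp add: arrow_elt_def path_elt_def)

lemma path_alg_sel: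
  "carrier (path_alg n) = {f. finite {p. f p \<noteq> 0} \<and> (\<forall>p. f p \<noteq> 0 \<longrightarrow> is_path n p)}"
  "mult (path_alg n) f g (v, xs) = (\<Sum>k\<le>length xs.
       f (v, take k xs) * g (path_source (v, take k xs), drop k xs))"
  "one (path_alg n) (v, xs) = (if v < n \<and> xs = [] then 1 else 0)"
  "zero (path_alg n) = (\<lambda>_. 0)"
  "add (path_alg n) f g = (\<lambda>p. f p + g p)"
  "smult (path_alg n) c f = (\<lambda>p. c * f p)"
  by (simp_all add: path_alg_def)

lemma path_source_simps [simp]:
  "path_source (v, []) = v"
  "path_source (v, x # xs) = path_source (source x, xs)"
  by (simp_all add: path_source_def)

lemma path_source_append [simp]:
  "path_source (v, xs @ ys) = path_source (path_source (v, xs), ys)"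
  by (induction xs arbitrary: v) auto

lemma arrows_bounds:
  assumes "x \<in> arrows n"
  shows "source x < n" "target x < n"
  using assms by (auto simp: arrows_def)

lemma finite_arrows [simp]: "finite (arrows n)"
  by (rule finite_subset[of _ "Arr ` {..n} \<union> Star ` {..n}"]) (auto simp: arrows_def)

lemma is_path_target: "is_path n (v, xs) \<Longrightarrow> v < n"
  by (cases xs) (auto dest: arrows_bounds)

lemma is_path_source: "is_path n (v, xs) \<Longrightarrow> path_source (v, xs) < n"
  by (induction xs arbitrary: v) auto

lemma is_path_arrows: "is_path n (v, xs) \<Longrightarrow> set xs \<subseteq> arrows n"
  by (induction xs arbitrary: v) auto

lemma is_path_append [simp]:
  "is_path n (v, xs @ ys) \<longleftrightarrow> is_path n (v, xs) \<and> is_path n (path_source (v, xs), ys)"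
proof (induction xs arbitrary: v)
  case Nil
  then show ?case using is_path_target by auto
qed auto

lemma carrierD: "f \<in> carrier (path_alg n) \<Longrightarrow> f p \<noteq> 0 \<Longrightarrow> is_path n p"
  by (cases p) (auto simp: path_alg_sel)

lemma path_carrierI:
  assumes "{p. f p \<noteq> 0} \<subseteq> S" "finite S" "\<And>p. f p \<noteq> 0 \<Longrightarrow> is_path n p"
  shows "f \<in> carrier (path_alg n)"
  using assms(3) finite_subset[OF assms(1,2)] by (simp add: path_alg_sel(1))

lemma path_elt_closed [simp]: "is_path n p \<Longrightarrow> path_elt p \<in> carrier (path_alg n)"
  by (auto simp: path_alg_sel path_elt_def)

text \<open>The support of a product consists of concatenations of paths from the two supports,
  hence it is finite.\<close>

lemma path_mult_closed:
  assumes "f \<in> carrier (path_alg n)" "g \<in> carrier (path_alg n)"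
  shows "f \<otimes>\<^bsub>path_alg n\<^esub> g \<in> carrier (path_alg n)"
proof -
  have *: "\<exists>k\<le>length xs. f (v, take k xs) \<noteq> 0 \<and> g (path_source (v, take k xs), drop k xs) \<noteq> 0"
    if nz: "(f \<otimes>\<^bsub>path_alg n\<^esub> g) (v, xs) \<noteq> 0" for v xs
  proof -
    obtain k where "k \<in> {..length xs}" "f (v, take k xs) * g (path_source (v, take k xs), drop k xs) \<noteq> 0"
      using nz unfolding path_alg_sel(2) by (rule sum.not_neutral_contains_not_neutral)
    then show ?thesis by (intro exI[of _ k]) auto
  qed
  have "{p. (f \<otimes>\<^bsub>path_alg n\<^esub> g) p \<noteq> 0} \<subseteq>
      (\<lambda>(p, q). (fst p, snd p @ snd q)) ` ({p. f p \<noteq> 0} \<times> {p. g p \<noteq> 0})"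
  proof
    fix p assume "p \<in> {p. (f \<otimes>\<^bsub>path_alg n\<^esub> g) p \<noteq> 0}"
    moreover obtain v xs where p: "p = (v, xs)" by (cases p)
    ultimately obtain k where "f (v, take k xs) \<noteq> 0" "g (path_source (v, take k xs), drop k xs) \<noteq> 0"
      using *[of v xs] by auto
    then show "p \<in> (\<lambda>(p, q). (fst p, snd p @ snd q)) ` ({p. f p \<noteq> 0} \<times> {p. g p \<noteq> 0})"
      unfolding p
      by (intro image_eqI[of _ _ "((v, take k xs), (path_source (v, take k xs), drop k xs))"]) auto
  qed
  moreover have "is_path n p" if nz: "(f \<otimes>\<^bsub>path_alg n\<^esub> g) p \<noteq> 0" for p
  proof -
    obtain v xs where p: "p = (v, xs)" by (cases p)
    obtain k where "f (v, take k xs) \<noteq> 0" "g (path_source (v, take k xs), drop k xs) \<noteq> 0"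
      using *[of v xs] nz p by auto
    then have "is_path n (v, take k xs @ drop k xs)"
      unfolding is_path_append using carrierD[OF assms(1)] carrierD[OF assms(2)] by auto
    then show ?thesis using p by simp
  qed
  moreover have "finite ((\<lambda>(p, q). (fst p, snd p @ snd q)) ` ({p. f p \<noteq> 0} \<times> {p. g p \<noteq> 0}))"
    using assms by (auto simp: path_alg_sel(1))
  ultimately show ?thesis by (intro path_carrierI)
qed

text \<open>Both sides are sums over two cuts of the path. \<open>T j k\<close> is the term with
  cuts after \<open>j\<close> and after \<open>k\<close> letters; the two sides differ in whether
  the second cut is measured from the start or from the first cut.\<close>

lemma path_mult_assoc:
  "(f \<otimes>\<^bsub>path_alg n\<^esub> g) \<otimes>\<^bsub>path_alg n\<^esub> h = f \<otimes>\<^bsub>path_alg n\<^esub> (g \<otimes>\<^bsub>path_alg n\<^esub> h)"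
proof (rule ext, clarify)
  fix v and xs :: "arrow list"
  let ?r = "length xs"
  let ?s = "\<lambda>k. path_source (v, take k xs)"
  define T where "T j k = f (v, take j xs) * g (?s j, take (k - j) (drop j xs)) * h (?s k, drop k xs)" for j k
  have src: "path_source (?s j, take (k - j) (drop j xs)) = ?s k" if "j \<le> k" for j k
  proof -
    have "take k xs = take j xs @ take (k - j) (drop j xs)"
      using that take_add[of j "k - j" xs] by simp
    then show ?thesis by (metis path_source_append)
  qed
  have "((f \<otimes>\<^bsub>path_alg n\<^esub> g) \<otimes>\<^bsub>path_alg n\<^esub> h) (v, xs) = (\<Sum>k\<le>?r. \<Sum>j\<le>k. T j k)"
    unfolding path_alg_sel T_def sum_distrib_right
    by (intro sum.cong) (simp_all add: min_absorb1 min_absorb2 drop_take)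
  also have "\<dots> = (\<Sum>(k, j)\<in>Sigma {..?r} atMost. T j k)"
    by (rule sum.Sigma) auto
  also have "\<dots> = (\<Sum>(j, k)\<in>Sigma {..?r} (\<lambda>j. {..?r - j}). T j (j + k))"
    by (rule sum.reindex_bij_witness[of _ "\<lambda>(j, k). (j + k, j)" "\<lambda>(k, j). (j, k - j)"]) auto
  also have "\<dots> = (\<Sum>j\<le>?r. \<Sum>k\<le>?r - j. T j (j + k))"
    by (rule sum.Sigma[symmetric]) auto
  also have "\<dots> = (f \<otimes>\<^bsub>path_alg n\<^esub> (g \<otimes>\<^bsub>path_alg n\<^esub> h)) (v, xs)"
    unfolding path_alg_sel T_def sum_distrib_left length_drop
  proof (intro sum.cong refl)
    fix j k assume "j \<in> {..?r}" "k \<in> {..?r - j}"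
    have "drop (j + k) xs = drop k (drop j xs)" by (simp add: add.commute)
    then show "f (v, take j xs) * g (?s j, take (j + k - j) (drop j xs)) * h (?s (j + k), drop (j + k) xs) =
        f (v, take j xs) * (g (?s j, take k (drop j xs)) *
          h (path_source (?s j, take k (drop j xs)), drop k (drop j xs)))"
      using src[of j "j + k"] by (simp add: mult.assoc)
  qed
  finally show "((f \<otimes>\<^bsub>path_alg n\<^esub> g) \<otimes>\<^bsub>path_alg n\<^esub> h) (v, xs) =
    (f \<otimes>\<^bsub>path_alg n\<^esub> (g \<otimes>\<^bsub>path_alg n\<^esub> h)) (v, xs)" .
qed

lemma path_one_closed: "\<one>\<^bsub>path_alg n\<^esub> \<in> carrier (path_alg n)"
proof -
  have "{p. \<one>\<^bsub>path_alg n\<^esub> p \<noteq> (0::'a::field)} \<subseteq> (\<lambda>v. (v, [])) ` {..<n}"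
    by (auto simp: path_alg_sel split: if_splits)
  then show ?thesis
    by (rule path_carrierI) (auto simp: path_alg_sel split: if_splits)
qed

lemma path_add_closed:
  assumes "f \<in> carrier (path_alg n)" "g \<in> carrier (path_alg n)"
  shows "f \<oplus>\<^bsub>path_alg n\<^esub> g \<in> carrier (path_alg n)"
proof -
  have "{p. (f \<oplus>\<^bsub>path_alg n\<^esub> g) p \<noteq> 0} \<subseteq> {p. f p \<noteq> 0} \<union> {p. g p \<noteq> 0}"
    by (auto simp: path_alg_sel)
  moreover have "is_path n p" if "(f \<oplus>\<^bsub>path_alg n\<^esub> g) p \<noteq> 0" for p
    using that assms[THEN carrierD, of p] by (cases "f p = 0") (auto simp: path_alg_sel(5))
  moreover have "finite ({p. f p \<noteq> 0} \<union> {p. g p \<noteq> 0})"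
    using assms by (auto simp: path_alg_sel(1))
  ultimately show ?thesis by (intro path_carrierI)
qed

lemma path_smult_closed:
  assumes "f \<in> carrier (path_alg n)"
  shows "c \<odot>\<^bsub>path_alg n\<^esub> f \<in> carrier (path_alg n)"
proof -
  have "{p. (c \<odot>\<^bsub>path_alg n\<^esub> f) p \<noteq> 0} \<subseteq> {p. f p \<noteq> 0}"
    by (auto simp: path_alg_sel)
  then show ?thesis
    by (rule path_carrierI) (use assms in \<open>auto simp: path_alg_sel\<close>)
qed

lemma path_module: "Module.module class_ring (path_alg n :: ('a::field, 'a path_fun) module)"
proof (rule module_criteria)
  let ?A = "path_alg n :: ('a, 'a path_fun) module"
  show "cring (class_ring :: 'a ring)" by (rule class_cring.cring_axioms)
  show "\<forall>v\<in>carrier ?A. \<exists>w\<in>carrier ?A. v \<oplus>\<^bsub>?A\<^esub> w = \<zero>\<^bsub>?A\<^esub>"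
  proof
    fix v :: "'a path_fun" assume "v \<in> carrier ?A"
    then show "\<exists>w\<in>carrier ?A. v \<oplus>\<^bsub>?A\<^esub> w = \<zero>\<^bsub>?A\<^esub>"
      by (intro bexI[of _ "(-1) \<odot>\<^bsub>?A\<^esub> v"] path_smult_closed) (auto simp: path_alg_sel)
  qed
qed (auto intro!: path_add_closed path_smult_closed, auto simp: path_alg_sel algebra_simps)

lemma path_ring: "ring (path_alg n :: ('a::field, 'a path_fun) module)"
proof (rule ringI)
  let ?A = "path_alg n :: ('a, 'a path_fun) module"
  interpret Module.module class_ring ?A by (rule path_module)
  show "abelian_group ?A" ..
  show "Group.monoid ?A"
  proof (rule monoidI)
    fix f :: "'a path_fun" assume f: "f \<in> carrier ?A"
    show "\<one>\<^bsub>?A\<^esub> \<otimes>\<^bsub>?A\<^esub> f = f"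
    proof (rule ext, clarify)
      fix v xs
      have "(\<one>\<^bsub>?A\<^esub> \<otimes>\<^bsub>?A\<^esub> f) (v, xs) = (\<Sum>k\<le>length xs. if k = 0 then (if v < n then f (v, xs) else 0) else 0)"
        unfolding path_alg_sel by (rule sum.cong) (auto split: if_splits)
      then show "(\<one>\<^bsub>?A\<^esub> \<otimes>\<^bsub>?A\<^esub> f) (v, xs) = f (v, xs)"
        using carrierD[OF f, of "(v, xs)"] is_path_target by auto
    qed
    show "f \<otimes>\<^bsub>?A\<^esub> \<one>\<^bsub>?A\<^esub> = f"
    proof (rule ext, clarify)
      fix v xs
      have "(f \<otimes>\<^bsub>?A\<^esub> \<one>\<^bsub>?A\<^esub>) (v, xs) =
          (\<Sum>k\<le>length xs. if k = length xs then (if path_source (v, xs) < n then f (v, xs) else 0) else 0)"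
        unfolding path_alg_sel by (rule sum.cong) (auto split: if_splits)
      then show "(f \<otimes>\<^bsub>?A\<^esub> \<one>\<^bsub>?A\<^esub>) (v, xs) = f (v, xs)"
        using carrierD[OF f, of "(v, xs)"] is_path_source by auto
    qed
  qed (simp_all add: path_mult_closed path_one_closed path_mult_assoc)
  fix f g h :: "'a path_fun"
  show "(f \<oplus>\<^bsub>?A\<^esub> g) \<otimes>\<^bsub>?A\<^esub> h = f \<otimes>\<^bsub>?A\<^esub> h \<oplus>\<^bsub>?A\<^esub> g \<otimes>\<^bsub>?A\<^esub> h"
    by (rule ext, clarify) (simp add: path_alg_sel algebra_simps sum.distrib)
  show "h \<otimes>\<^bsub>?A\<^esub> (f \<oplus>\<^bsub>?A\<^esub> g) = h \<otimes>\<^bsub>?A\<^esub> f \<oplus>\<^bsub>?A\<^esub> h \<otimes>\<^bsub>?A\<^esub> g"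
    by (rule ext, clarify) (simp add: path_alg_sel algebra_simps sum.distrib)
qed

lemma path_smult_mult:
  "(c \<odot>\<^bsub>path_alg n\<^esub> f) \<otimes>\<^bsub>path_alg n\<^esub> g = c \<odot>\<^bsub>path_alg n\<^esub> (f \<otimes>\<^bsub>path_alg n\<^esub> g)"
  "f \<otimes>\<^bsub>path_alg n\<^esub> (c \<odot>\<^bsub>path_alg n\<^esub> g) = c \<odot>\<^bsub>path_alg n\<^esub> (f \<otimes>\<^bsub>path_alg n\<^esub> g)"
  by (rule ext, clarify, simp add: path_alg_sel sum_distrib_left ac_simps)+

lemma path_finsum:
  fixes F :: "'i \<Rightarrow> 'a::field path_fun"
  assumes "\<And>i. i \<in> I \<Longrightarrow> F i \<in> carrier (path_alg n)"
  shows "(\<Oplus>\<^bsub>path_alg n\<^esub>i\<in>I. F i) p = (\<Sum>i\<in>I. F i p)"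
proof -
  interpret ring "path_alg n :: ('a, 'a path_fun) module" by (rule path_ring)
  show ?thesis using assms
  proof (induction I rule: infinite_finite_induct)
    case (insert x I)
    then have *: "(\<Oplus>\<^bsub>path_alg n\<^esub>i\<in>insert x I. F i) = F x \<oplus>\<^bsub>path_alg n\<^esub> (\<Oplus>\<^bsub>path_alg n\<^esub>i\<in>I. F i)"
      by (intro finsum_insert) auto
    show ?case unfolding * using insert by (simp add: path_alg_sel(5))
  qed (auto simp: path_alg_sel finsum_infinite)
qed

lemma path_a_inv:
  fixes f :: "'a::field path_fun"
  assumes "f \<in> carrier (path_alg n)"
  shows "\<ominus>\<^bsub>path_alg n\<^esub> f = (\<lambda>p. - f p)"
proof -
  interpret Module.module class_ring "path_alg n :: ('a, 'a path_fun) module" by (rule path_module)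
  have "\<ominus>\<^bsub>path_alg n\<^esub> f = (-1) \<odot>\<^bsub>path_alg n\<^esub> f"
    using smult_minus_1[OF assms] by (simp add: class_ring_simps)
  then show ?thesis by (simp add: path_alg_sel)
qed

lemma path_a_minus:
  assumes "f \<in> carrier (path_alg n)" "g \<in> carrier (path_alg n)"
  shows "f \<ominus>\<^bsub>path_alg n\<^esub> g = (\<lambda>p. f p - g p)"
  unfolding a_minus_def path_a_inv[OF assms(2)] by (simp add: path_alg_sel)

section \<open>Homogeneous elements and the basis of paths\<close>

lemma path_grade_carrier: "f \<in> path_grade n r \<Longrightarrow> f \<in> carrier (path_alg n)"
  by (simp add: path_grade_def)

lemma path_grade_zero: "f \<in> path_grade n r \<Longrightarrow> length xs \<noteq> r \<Longrightarrow> f (v, xs) = 0"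
  by (auto simp: path_grade_def)

lemma path_elt_grade: "is_path n p \<Longrightarrow> path_elt p \<in> path_grade n (length (snd p))"
  by (auto simp: path_grade_def path_elt_def path_alg_sel)

text \<open>A homogeneous factor leaves one term of the convolution, the cut at its own
  degree.\<close>

lemma grade_mult_left:
  assumes "f \<in> path_grade n r"
  shows "(f \<otimes>\<^bsub>path_alg n\<^esub> g) (v, xs) =
    (if r \<le> length xs then f (v, take r xs) * g (path_source (v, take r xs), drop r xs) else 0)"
proof -
  have "(f \<otimes>\<^bsub>path_alg n\<^esub> g) (v, xs) =
      (\<Sum>k\<le>length xs. if k = r then f (v, take r xs) * g (path_source (v, take r xs), drop r xs) else 0)"
    unfolding path_alg_sel by (rule sum.cong) (auto simp: path_grade_zero[OF assms])
  then show ?thesis by simp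
qed

lemma grade_mult_right:
  assumes "g \<in> path_grade n r"
  shows "(f \<otimes>\<^bsub>path_alg n\<^esub> g) (v, xs) =
    (if r \<le> length xs then f (v, take (length xs - r) xs) *
       g (path_source (v, take (length xs - r) xs), drop (length xs - r) xs) else 0)"
proof -
  have "(f \<otimes>\<^bsub>path_alg n\<^esub> g) (v, xs) =
      (\<Sum>k\<le>length xs. if k = length xs - r then (if r \<le> length xs then f (v, take k xs) * g (path_source (v, take k xs), drop k xs) else 0) else 0)"
    unfolding path_alg_sel by (rule sum.cong) (auto simp: path_grade_zero[OF assms])
  then show ?thesis by simp
qed

lemma grade_mult:
  assumes "f \<in> path_grade n r" "g \<in> path_grade n s"
  shows "f \<otimes>\<^bsub>path_alg n\<^esub> g \<in> path_grade n (r + s)"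
proof -
  have "length xs = r + s" if "(f \<otimes>\<^bsub>path_alg n\<^esub> g) (v, xs) \<noteq> 0" for v xs
    using that path_grade_zero[OF assms(2), of "drop r xs" "path_source (v, take r xs)"]
    by (cases "length xs = r + s") (auto simp: grade_mult_left[OF assms(1)] split: if_splits)
  then show ?thesis
    using assms path_mult_closed by (auto simp: path_grade_def)
qed

lemma path_elt_mult:
  assumes "is_path n (v, xs)" "is_path n (w, ys)"
  shows "path_elt (v, xs) \<otimes>\<^bsub>path_alg n\<^esub> path_elt (w, ys) =
    (if w = path_source (v, xs) then path_elt (v, xs @ ys) else \<zero>\<^bsub>path_alg n\<^esub>)"
proof (rule ext, clarify)
  fix u zs
  have *: "path_elt (v, xs) \<in> path_grade n (length xs)" using path_elt_grade[OF assms(1)] by simp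
  show "(path_elt (v, xs) \<otimes>\<^bsub>path_alg n\<^esub> path_elt (w, ys)) (u, zs) =
    (if w = path_source (v, xs) then path_elt (v, xs @ ys) else \<zero>\<^bsub>path_alg n\<^esub>) (u, zs)"
    unfolding grade_mult_left[OF *]
    by (auto simp: path_elt_def path_alg_sel(4) append_eq_conv_conj) (metis append_take_drop_id)
qed

lemma path_elt_sum:
  assumes "f \<in> carrier (path_alg n)" "finite S" "{p. f p \<noteq> 0} \<subseteq> S" "\<And>p. p \<in> S \<Longrightarrow> is_path n p"
  shows "f = (\<Oplus>\<^bsub>path_alg n\<^esub>p\<in>S. f p \<odot>\<^bsub>path_alg n\<^esub> path_elt p)"
proof
  fix q
  have "(\<Oplus>\<^bsub>path_alg n\<^esub>p\<in>S. f p \<odot>\<^bsub>path_alg n\<^esub> path_elt p) q = (\<Sum>p\<in>S. f p * path_elt p q)"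
    by (subst path_finsum) (rule path_smult_closed path_elt_closed assms(4) | simp add: path_alg_sel(6))+
  also have "\<dots> = f q"
    using assms(2,3) by (auto simp: path_elt_def if_distrib cong: if_cong)
  finally show "f q = (\<Oplus>\<^bsub>path_alg n\<^esub>p\<in>S. f p \<odot>\<^bsub>path_alg n\<^esub> path_elt p) q" ..
qed

section \<open>A basis of the preprojective algebra\<close>

definition paths :: "nat \<Rightarrow> nat \<Rightarrow> nat \<Rightarrow> nat \<Rightarrow> arrow list set" where
  "paths n j i r = {xs. is_path n (j, xs) \<and> path_source (j, xs) = i \<and> length xs = r}"

text \<open>In an admissible type this functional vanishes on the relation ideal
  (\<open>I_path_sum\<close>) and becomes a coordinate of A.\<close>

definition path_sum :: "nat \<Rightarrow> 'a::field path_fun \<Rightarrow> nat \<Rightarrow> nat \<Rightarrow> nat \<Rightarrow> 'a" where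
  "path_sum n f j i r = (\<Sum>xs\<in>paths n j i r. f (j, xs))"

text \<open>\<open>e\<^sub>j A e\<^sub>i\<close> has dimension one in the degrees \<open>r\<close> given by the following (Clebsch-Gordan)
  condition and vanishes in all other degrees.\<close>

definition adm :: "nat \<Rightarrow> nat \<Rightarrow> nat \<Rightarrow> nat \<Rightarrow> bool" where
  "adm n j i r \<longleftrightarrow> even (i + j + r) \<and> i \<le> j + r \<and> j \<le> i + r \<and> r \<le> i + j \<and> i + j + r \<le> 2 * (n - 1)"

text \<open>Words are read from right to left, so this path descends from \<open>i\<close> to its
  lowest vertex \<open>b\<close> and then climbs to \<open>j\<close>. Dually, \<open>peak\<close>
  climbs to its highest vertex \<open>c\<close> first.\<close>

definition valley :: "nat \<Rightarrow> nat \<Rightarrow> nat \<Rightarrow> arrow list" where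
  "valley b j i = map Arr (rev [b..<j]) @ map Star [b..<i]"

definition peak :: "nat \<Rightarrow> nat \<Rightarrow> nat \<Rightarrow> arrow list" where
  "peak c j i = map Star [j..<c] @ map Arr (rev [i..<c])"

lemma finite_paths [simp]: "finite (paths n j i r)"
proof (rule finite_subset)
  show "paths n j i r \<subseteq> {xs. set xs \<subseteq> arrows n \<and> length xs = r}"
    using is_path_arrows by (auto simp: paths_def)
  show "finite {xs. set xs \<subseteq> arrows n \<and> length xs = r}"
    by (rule finite_lists_length_eq) simp
qed

lemma path_triangle:
  "is_path n (j, xs) \<Longrightarrow>
    even (path_source (j, xs) + j + length xs) \<and> path_source (j, xs) \<le> j + length xs \<and>
    j \<le> path_source (j, xs) + length xs"
proof (induction xs arbitrary: j)
  case (Cons x xs)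
  then show ?case by (cases x) fastforce+
qed simp

lemma paths_triangle:
  assumes "xs \<in> paths n j i r"
  shows "even (i + j + r)" "i \<le> j + r" "j \<le> i + r" "i < n" "j < n"
  using assms path_triangle[of n j xs] is_path_source[of n j xs] is_path_target[of n j xs]
  by (auto simp: paths_def)

text \<open>The bound \<open>r \<le> i + j\<close> and the triangle inequality
  \<open>i \<le> h + (r - s)\<close> give \<open>s \<le> h + j\<close>; the other bounds follow in
  the same way. Thus a product of admissible degree only involves factors of admissible
  degree.\<close>

lemma adm_split:
  assumes "adm n j i r" "s \<le> r" "xs \<in> paths n j h s" "ys \<in> paths n h i (r - s)"
  shows "adm n j h s" "adm n h i (r - s)"
  using assms(1,2) paths_triangle(1-3)[OF assms(3)] paths_triangle(1-3)[OF assms(4)]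
  unfolding adm_def by linarith+

lemma adm_bounds: "adm n j i r \<Longrightarrow> n \<ge> 1 \<Longrightarrow> j < n \<and> i < n \<and> r \<le> 2 * n"
  unfolding adm_def by linarith

lemma valley_path:
  assumes "b \<le> j" "b \<le> i" "i < n" "j < n"
  shows "valley b j i \<in> paths n j i (i + j - 2 * b)"
proof -
  have 1: "is_path n (b, map Star [b..<i]) \<and> path_source (b, map Star [b..<i]) = i"
    using assms(2,3)
  proof (induction "i - b" arbitrary: b)
    case (Suc d)
    then show ?case by (simp add: upt_conv_Cons arrows_def)
  qed simp
  have 2: "is_path n (j, map Arr (rev [b..<j])) \<and> path_source (j, map Arr (rev [b..<j])) = b"
    using assms(1,4)
  proof (induction j)
    case (Suc j)
    then show ?case by (cases "b = Suc j") (auto simp: arrows_def)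
  qed simp
  show ?thesis using 1 2 assms by (simp add: valley_def paths_def)
qed

text \<open>A valley from \<open>i\<close> to \<open>j\<close> with lowest vertex \<open>b\<close>
  has length \<open>i + j - 2 * b\<close>, which dictates the choice of \<open>b\<close>.\<close>

lemma adm_path:
  assumes "adm n j i r" "n \<ge> 1"
  shows "valley ((i + j - r) div 2) j i \<in> paths n j i r"
proof -
  have "r = i + j - 2 * ((i + j - r) div 2)" 
  proof -
    have "even (s + r) \<Longrightarrow> r \<le> s \<Longrightarrow> r = s - 2 * ((s - r) div 2)" for s :: nat by presburger
    from this[of "i + j"] show ?thesis using assms(1) by (simp add: adm_def)
  qed
  moreover have "(i + j - r) div 2 \<le> j" "(i + j - r) div 2 \<le> i" using assms(1) by (auto simp: adm_def)
  ultimately show ?thesis using valley_path[of _ j i n] adm_bounds[OF assms] by metis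
qed

text \<open>One chosen path for each type; by \<open>pc_adm\<close> its class in A does not depend
  on the choice.\<close>

definition canon :: "nat \<Rightarrow> nat \<Rightarrow> nat \<Rightarrow> nat \<Rightarrow> arrow list" where
  "canon n j i r = (SOME xs. xs \<in> paths n j i r)"

lemma canon_paths: "xs \<in> paths n j i r \<Longrightarrow> canon n j i r \<in> paths n j i r"
  unfolding canon_def by (rule someI)

lemma path_sum_path_elt:
  assumes "is_path n (v, xs)"
  shows "path_sum n (path_elt (v, xs)) j i r =
    (if j = v \<and> i = path_source (v, xs) \<and> r = length xs then 1 else 0)"
proof -
  have "path_sum n (path_elt (v, xs)) j i r = (\<Sum>ys\<in>paths n j i r. if ys = xs then (if j = v then 1 else 0) else 0)"
    unfolding path_sum_def by (rule sum.cong) (auto simp: path_elt_def)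
  also have "\<dots> = (if j = v \<and> xs \<in> paths n j i r then 1 else 0)" by simp
  also have "\<dots> = (if j = v \<and> i = path_source (v, xs) \<and> r = length xs then 1 else 0)"
    using assms by (auto simp: paths_def)
  finally show ?thesis .
qed

lemma path_sum_add: "path_sum n (f \<oplus>\<^bsub>path_alg n\<^esub> g) j i r = path_sum n f j i r + path_sum n g j i r"
  by (simp add: path_sum_def path_alg_sel sum.distrib)

lemma path_sum_smult: "path_sum n (c \<odot>\<^bsub>path_alg n\<^esub> f) j i r = c * path_sum n f j i r"
  by (simp add: path_sum_def path_alg_sel sum_distrib_left)

lemma path_sum_zero: "path_sum n (\<zero>\<^bsub>path_alg n\<^esub>) j i r = 0"
  by (simp add: path_sum_def path_alg_sel)

text \<open>Cutting off the \<open>s\<close> leftmost arrows is a bijection from the paths of length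
  \<open>r\<close> to the pairs of paths of lengths \<open>s\<close> and \<open>r - s\<close> that
  meet at some vertex \<open>h\<close>.\<close>

lemma path_sum_mult:
  "path_sum n (f \<otimes>\<^bsub>path_alg n\<^esub> g) j i r = (\<Sum>h<n. \<Sum>s\<le>r. path_sum n f j h s * path_sum n g h i (r - s))"
proof -
  let ?T = "\<lambda>s xs. f (j, take s xs) * g (path_source (j, take s xs), drop s xs)"
  have "path_sum n (f \<otimes>\<^bsub>path_alg n\<^esub> g) j i r = (\<Sum>xs\<in>paths n j i r. \<Sum>s\<le>r. ?T s xs)"
    unfolding path_sum_def path_alg_sel by (rule sum.cong) (auto simp: paths_def)
  also have "\<dots> = (\<Sum>s\<le>r. \<Sum>xs\<in>paths n j i r. ?T s xs)" by (rule sum.swap)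
  also have "\<dots> = (\<Sum>s\<le>r. \<Sum>h<n. path_sum n f j h s * path_sum n g h i (r - s))"
  proof (rule sum.cong[OF refl])
    fix s assume s: "s \<in> {..r}"
    have "(\<Sum>xs\<in>paths n j i r. ?T s xs) =
        (\<Sum>(h, ys, zs)\<in>Sigma {..<n} (\<lambda>h. paths n j h s \<times> paths n h i (r - s)). f (j, ys) * g (h, zs))"
    proof (rule sum.reindex_bij_witness[of _ "\<lambda>(h, ys, zs). ys @ zs"
          "\<lambda>xs. (path_source (j, take s xs), take s xs, drop s xs)"])
      fix xs assume xs: "xs \<in> paths n j i r"
      have "is_path n (j, take s xs @ drop s xs)" "path_source (j, take s xs @ drop s xs) = i"
        using xs by (simp_all add: paths_def)
      then show "(path_source (j, take s xs), take s xs, drop s xs) \<in>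
          Sigma {..<n} (\<lambda>h. paths n j h s \<times> paths n h i (r - s))"
        using xs s unfolding is_path_append path_source_append
        by (auto simp: paths_def intro: is_path_source)
    qed (use s in \<open>auto simp: paths_def\<close>)
    also have "\<dots> = (\<Sum>h<n. \<Sum>(ys, zs)\<in>paths n j h s \<times> paths n h i (r - s). f (j, ys) * g (h, zs))"
      by (subst sum.Sigma) (auto simp: case_prod_unfold)
    also have "\<dots> = (\<Sum>h<n. path_sum n f j h s * path_sum n g h i (r - s))"
      unfolding path_sum_def sum_product by (simp add: sum.cartesian_product)
    finally show "(\<Sum>xs\<in>paths n j i r. ?T s xs) = (\<Sum>h<n. path_sum n f j h s * path_sum n g h i (r - s))" .
  qed
  also have "\<dots> = (\<Sum>h<n. \<Sum>s\<le>r. path_sum n f j h s * path_sum n g h i (r - s))" by (rule sum.swap)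
  finally show ?thesis .
qed

text \<open>A nonzero term needs paths of both types, and then \<open>adm_split\<close> makes both
  types admissible. So the admissible sums of a product depend only on the admissible sums of its
  factors.\<close>

lemma path_sum_mult_adm:
  assumes "adm n j i r"
  shows "path_sum n (f \<otimes>\<^bsub>path_alg n\<^esub> g) j i r =
    (\<Sum>h<n. \<Sum>s\<le>r. (if adm n j h s then path_sum n f j h s else 0) *
       (if adm n h i (r - s) then path_sum n g h i (r - s) else 0))"
  unfolding path_sum_mult
proof (intro sum.cong refl)
  fix h s assume "s \<in> {..r}"
  show "path_sum n f j h s * path_sum n g h i (r - s) = (if adm n j h s then path_sum n f j h s else 0) *
       (if adm n h i (r - s) then path_sum n g h i (r - s) else 0)"
  proof (cases "paths n j h s = {} \<or> paths n h i (r - s) = {}")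
    case True
    then show ?thesis by (auto simp: path_sum_def)
  next
    case False
    then show ?thesis using adm_split[OF assms] \<open>s \<in> {..r}\<close> by auto
  qed
qed

text \<open>One formula for three cases: the vertex 0 has no 2-cycle through a lower vertex and
  \<open>n - 1\<close> has none through a higher one.\<close>

lemma relator_eq:
  assumes "3 \<le> n" "v < n"
  shows "relator n v = (\<lambda>p.
    (if 0 < v \<and> p = (v, [Arr (v - 1), Star (v - 1)]) then 1 else 0) -
    (if v < n - 1 \<and> p = (v, [Star v, Arr v]) then 1 else (0::'a::field)))"
proof -
  have 1: "arrow_elt (Arr (v - 1)) \<otimes>\<^bsub>path_alg n\<^esub> arrow_elt (Star (v - 1)) =
      (path_elt (v, [Arr (v - 1), Star (v - 1)]) :: 'a path_fun)" if "0 < v"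
    using that assms by (simp add: arrow_elt_eq path_elt_mult arrows_def)
  have 2: "arrow_elt (Star v) \<otimes>\<^bsub>path_alg n\<^esub> arrow_elt (Arr v) =
      (path_elt (v, [Star v, Arr v]) :: 'a path_fun)" if "v < n - 1"
    using that assms by (simp add: arrow_elt_eq path_elt_mult arrows_def)
  have c2: "path_elt (v, [Star v, Arr v]) \<in> carrier (path_alg n :: ('a, 'a path_fun) module)" if "v < n - 1"
    using that assms by (simp add: arrows_def)
  have c1: "path_elt (v, [Arr (v - 1), Star (v - 1)]) \<in> carrier (path_alg n :: ('a, 'a path_fun) module)" if "0 < v"
    using that assms by (simp add: arrows_def)
  consider "v = 0" | "v = n - 1" "0 < v" | "0 < v" "v < n - 1" using assms by linarith
  then show ?thesis
  proof cases
    case 1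
    then show ?thesis using 2 c2 assms unfolding relator_def
      by (simp add: path_a_inv) (auto simp: path_elt_def)
  next
    case 2
    then show ?thesis using 1 assms unfolding relator_def
      by (auto simp: path_elt_def numeral_2_eq_2)
  next
    case 3
    then have "v \<noteq> 0" "v \<noteq> n - 1" by auto
    then show ?thesis unfolding relator_def 1[OF 3(1)] 2[OF 3(2)] path_a_minus[OF c1[OF 3(1)] c2[OF 3(2)]]
      using 3 by (auto simp: path_elt_def)
  qed
qed

lemma relator_grade:
  assumes "3 \<le> n" "v < n"
  shows "relator n v \<in> path_grade n 2"
proof -
  have *: "\<exists>x\<in>{[Arr (v - 1), Star (v - 1)], [Star v, Arr v]}. p = (v, x) \<and> is_path n (v, x)"
    if "relator n v p \<noteq> (0::'a)" for p
    using that assms by (auto simp: relator_eq arrows_def split: if_splits)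
  have "relator n v \<in> carrier (path_alg n :: ('a, 'a path_fun) module)"
    by (rule path_carrierI[of _ "{(v, [Arr (v - 1), Star (v - 1)]), (v, [Star v, Arr v])}"])
      (use * in fastforce)+
  then show ?thesis using * by (fastforce simp: path_grade_def)
qed

section \<open>The quotient map onto the preprojective algebra\<close>

locale typeA =
  fixes n :: nat and field :: "'a::field itself"
  assumes n_ge: "3 \<le> n"
begin

abbreviation "PA \<equiv> path_alg n :: ('a, 'a path_fun) module"
abbreviation "A \<equiv> preproj n :: ('a, 'a path_fun set) module"
abbreviation "I \<equiv> relation_ideal n :: 'a path_fun set"
abbreviation "cl \<equiv> preproj_class n :: 'a path_fun \<Rightarrow> 'a path_fun set"
abbreviation "pc v xs \<equiv> cl (path_elt (v, xs))"

sublocale P: ring PA by (rule path_ring)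

lemma relator_carrier: "v < n \<Longrightarrow> (relator n v :: 'a path_fun) \<in> carrier PA"
  using relator_grade[OF n_ge] by (auto intro: path_grade_carrier)

lemma relators_carrier: "(relators n :: 'a path_fun set) \<subseteq> carrier PA"
  unfolding relators_def by (rule LinearCombinations.module.span_is_subset2[OF path_module]) (auto intro: relator_carrier)

lemma relator_in_relators: "v < n \<Longrightarrow> (relator n v :: 'a path_fun) \<in> relators n"
  unfolding relators_def using LinearCombinations.module.in_own_span[OF path_module, of "relator n ` {..<n}"] relator_carrier by auto

lemma I_ideal: "ideal I PA"
  unfolding relation_ideal_def by (rule P.genideal_ideal) (rule relators_carrier)

lemma relators_I: "(relators n :: 'a path_fun set) \<subseteq> I"
  unfolding relation_ideal_def by (rule P.genideal_self) (rule relators_carrier)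

lemma I_carrier: "f \<in> I \<Longrightarrow> f \<in> carrier PA"
  using additive_subgroup.a_Hcarr[OF ideal.axioms(1)[OF I_ideal]] .

text \<open>Scalars act through multiples of the unit, so an ideal is automatically a
  subspace.\<close>

lemma I_submodule: "submodule class_ring I PA"
proof (rule submodule.intro)
  fix c and f :: "'a path_fun" assume "f \<in> I"
  then have f: "f \<in> carrier PA" by (rule I_carrier)
  have "c \<odot>\<^bsub>PA\<^esub> f = (c \<odot>\<^bsub>PA\<^esub> \<one>\<^bsub>PA\<^esub>) \<otimes>\<^bsub>PA\<^esub> f"
    using f by (simp add: path_smult_mult)
  also have "\<dots> \<in> I"
    by (rule ideal.I_l_closed[OF I_ideal \<open>f \<in> I\<close>]) (rule path_smult_closed, simp)
  finally show "c \<odot>\<^bsub>PA\<^esub> f \<in> I" .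
next
  show "I \<subseteq> carrier PA" using I_carrier by blast
  show "\<zero>\<^bsub>PA\<^esub> \<in> I"
    using additive_subgroup.zero_closed[OF ideal.axioms(1)[OF I_ideal]] .
  fix f g :: "'a path_fun" assume "f \<in> I" "g \<in> I"
  then show "f \<oplus>\<^bsub>PA\<^esub> g \<in> I"
    using additive_subgroup.a_closed[OF ideal.axioms(1)[OF I_ideal]] by simp
qed (rule path_module)

lemma I_quotient: "quotient_module class_ring I PA"
  by (rule quotient_module.intro) (rule I_submodule)

lemma A_module: "Module.module class_ring A"
  unfolding preproj_def by (rule quotient_module.quot_module_is_module[OF I_quotient])

sublocale A: ring A
  unfolding preproj_def quot_module_def
  by (rule ring_extend) (rule ideal.quotient_is_ring[OF I_ideal])

lemma A_carrier: "carrier A = cl ` carrier PA"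
  by (auto simp: preproj_def quot_module_carrier preproj_class_def)

lemma cl_closed [simp]: "f \<in> carrier PA \<Longrightarrow> cl f \<in> carrier A"
  unfolding A_carrier by (rule imageI)

lemma cl_add: "f \<in> carrier PA \<Longrightarrow> g \<in> carrier PA \<Longrightarrow> cl f \<oplus>\<^bsub>A\<^esub> cl g = cl (f \<oplus>\<^bsub>PA\<^esub> g)"
  using quotient_module.quot_add[OF I_quotient] by (simp add: preproj_def preproj_class_def)

lemma cl_smult: "f \<in> carrier PA \<Longrightarrow> c \<odot>\<^bsub>A\<^esub> cl f = cl (c \<odot>\<^bsub>PA\<^esub> f)"
  using quotient_module.quot_smult[OF I_quotient] by (simp add: preproj_def preproj_class_def)

lemma cl_mult: "f \<in> carrier PA \<Longrightarrow> g \<in> carrier PA \<Longrightarrow> cl f \<otimes>\<^bsub>A\<^esub> cl g = cl (f \<otimes>\<^bsub>PA\<^esub> g)"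
  using ideal.rcoset_mult_add[OF I_ideal] by (simp add: preproj_def preproj_class_def quot_module_sel)

lemma cl_one: "\<one>\<^bsub>A\<^esub> = cl \<one>\<^bsub>PA\<^esub>"
  by (simp add: preproj_def preproj_class_def quot_module_sel)

lemma cl_eq_zero_iff: "f \<in> carrier PA \<Longrightarrow> cl f = \<zero>\<^bsub>A\<^esub> \<longleftrightarrow> f \<in> I"
  using submodule.coset_eq_self_iff[OF I_submodule] by (simp add: preproj_def preproj_class_def quot_module_sel)

lemma cl_zero: "cl \<zero>\<^bsub>PA\<^esub> = \<zero>\<^bsub>A\<^esub>"
  using submodule.zero_closed[OF I_submodule] by (simp add: cl_eq_zero_iff)

lemma cl_finsum:
  assumes "\<And>i. i \<in> S \<Longrightarrow> f i \<in> carrier PA"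
  shows "cl (\<Oplus>\<^bsub>PA\<^esub>i\<in>S. f i) = (\<Oplus>\<^bsub>A\<^esub>i\<in>S. cl (f i))"
  using assms
proof (induction S rule: infinite_finite_induct)
  case (insert x S)
  then have "(\<Oplus>\<^bsub>PA\<^esub>i\<in>insert x S. f i) = f x \<oplus>\<^bsub>PA\<^esub> (\<Oplus>\<^bsub>PA\<^esub>i\<in>S. f i)"
    and "(\<Oplus>\<^bsub>A\<^esub>i\<in>insert x S. cl (f i)) = cl (f x) \<oplus>\<^bsub>A\<^esub> (\<Oplus>\<^bsub>A\<^esub>i\<in>S. cl (f i))"
    by (auto intro!: P.finsum_insert A.finsum_insert)
  then show ?case using insert by (simp add: cl_add[symmetric])
qed (simp_all add: cl_zero)

lemma cl_eq_iff:
  assumes "f \<in> carrier PA" "g \<in> carrier PA"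
  shows "cl f = cl g \<longleftrightarrow> f \<ominus>\<^bsub>PA\<^esub> g \<in> I"
proof -
  have "cl f = cl g \<longleftrightarrow> (\<exists>a\<in>I. f = a \<oplus>\<^bsub>PA\<^esub> g)"
    using submodule.coset_eq_iff[OF I_submodule assms(2,1)] by (auto simp: preproj_class_def)
  also have "\<dots> \<longleftrightarrow> f \<ominus>\<^bsub>PA\<^esub> g \<in> I"
  proof
    assume "\<exists>a\<in>I. f = a \<oplus>\<^bsub>PA\<^esub> g"
    then obtain a where a: "a \<in> I" "f = a \<oplus>\<^bsub>PA\<^esub> g" by auto
    have "f \<ominus>\<^bsub>PA\<^esub> g = a" unfolding path_a_minus[OF assms] by (simp add: a(2) path_alg_sel(5))
    then show "f \<ominus>\<^bsub>PA\<^esub> g \<in> I" using a(1) by simp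
  next
    assume "f \<ominus>\<^bsub>PA\<^esub> g \<in> I"
    moreover have "f = (f \<ominus>\<^bsub>PA\<^esub> g) \<oplus>\<^bsub>PA\<^esub> g"
      unfolding path_a_minus[OF assms] by (simp add: path_alg_sel(5))
    ultimately show "\<exists>a\<in>I. f = a \<oplus>\<^bsub>PA\<^esub> g" by blast
  qed
  finally show ?thesis .
qed

section \<open>Rewriting paths into valleys and peaks\<close>

lemma pc_mult:
  assumes "is_path n (v, xs @ ys)"
  shows "pc v (xs @ ys) = pc v xs \<otimes>\<^bsub>A\<^esub> pc (path_source (v, xs)) ys"
  using assms by (simp add: cl_mult path_elt_mult)

lemma pc_Cons:
  assumes "is_path n (v, x # ys)"
  shows "pc v (x # ys) = pc v [x] \<otimes>\<^bsub>A\<^esub> pc (source x) ys"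
  using pc_mult[of v "[x]" ys] assms by simp

lemma pc_zero_bottom:
  assumes "is_path n (0, Star 0 # Arr 0 # ys)"
  shows "pc 0 (Star 0 # Arr 0 # ys) = \<zero>\<^bsub>A\<^esub>"
proof -
  have "\<ominus>\<^bsub>PA\<^esub> (relator n 0) \<in> I"
    using relator_in_relators[of 0] relators_I n_ge
    by (intro additive_subgroup.a_inv_closed ideal.axioms(1)[OF I_ideal]) auto
  moreover have "\<ominus>\<^bsub>PA\<^esub> (relator n 0) = path_elt (0, [Star 0, Arr 0])"
    using n_ge relator_carrier[of 0] by (auto simp: path_a_inv relator_eq path_elt_def)
  ultimately have "pc 0 [Star 0, Arr 0] = \<zero>\<^bsub>A\<^esub>"
    using assms n_ge by (subst cl_eq_zero_iff) auto
  then show ?thesis using pc_mult[of 0 "[Star 0, Arr 0]" ys] assms by simp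
qed

lemma pc_zero_top:
  assumes "is_path n (Suc k, Arr k # Star k # ys)" "n = k + 2"
  shows "pc (Suc k) (Arr k # Star k # ys) = \<zero>\<^bsub>A\<^esub>"
proof -
  have "relator n (Suc k) = (path_elt (Suc k, [Arr k, Star k]) :: 'a path_fun)"
    using relator_eq[OF n_ge, of "Suc k"] assms(2) by (auto simp: path_elt_def)
  moreover have "(relator n (Suc k) :: 'a path_fun) \<in> I"
    using relator_in_relators[of "Suc k"] relators_I assms(2) by auto
  moreover have "is_path n (Suc k, [Arr k, Star k])" "is_path n (Suc k, ys)"
    using assms by (simp_all add: is_path_target)
  ultimately have "pc (Suc k) [Arr k, Star k] = \<zero>\<^bsub>A\<^esub>"
    by (subst cl_eq_zero_iff) auto
  then show ?thesis
    using pc_mult[of "Suc k" "[Arr k, Star k]" ys] assms(1) \<open>is_path n (Suc k, ys)\<close> by simp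
qed

text \<open>The relation at an interior vertex identifies the excursion to \<open>v + 1\<close> with
  the excursion to \<open>v - 1\<close>. Together with the zero relations at the two ends this is
  all the rewriting that is used.\<close>

lemma pc_swap:
  assumes "0 < v" "v < n - 1" "is_path n (v, ys)"
  shows "pc v (Star v # Arr v # ys) = pc v (Arr (v - 1) # Star (v - 1) # ys)"
proof -
  have p: "is_path n (v, Star v # Arr v # ys)" "is_path n (v, Arr (v - 1) # Star (v - 1) # ys)"
    using assms by (auto simp: arrows_def)
  have c: "path_elt (v, [Arr (v - 1), Star (v - 1)]) \<in> carrier PA" "path_elt (v, [Star v, Arr v]) \<in> carrier PA"
    using p is_path_target assms(3) by auto
  have "path_elt (v, [Arr (v - 1), Star (v - 1)]) \<ominus>\<^bsub>PA\<^esub> path_elt (v, [Star v, Arr v]) = relator n v"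
    unfolding path_a_minus[OF c] using assms n_ge by (auto simp: relator_eq path_elt_def)
  then have "pc v [Arr (v - 1), Star (v - 1)] = pc v [Star v, Arr v]"
    using c relator_in_relators[of v] relators_I assms by (subst cl_eq_iff) auto
  then show ?thesis
    using pc_mult[of v "[Star v, Arr v]" ys] pc_mult[of v "[Arr (v - 1), Star (v - 1)]" ys] p assms by simp
qed

text \<open>The new descending arrow creates a peak at \<open>k + 1\<close>. The relations push it
  down the ascending slope, vertex by vertex, until the bottom drops from \<open>b\<close> to
  \<open>b - 1\<close>, or, if \<open>b = 0\<close>, until the zero relation at the vertex 0
  applies.\<close>

lemma pc_Star_valley:
  assumes "b \<le> k + 1" "b \<le> i" "i < n" "k + 1 < n"
  shows "pc k (Star k # valley b (k + 1) i) = (if b = 0 then \<zero>\<^bsub>A\<^esub> else pc k (valley (b - 1) k i))"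
  using assms
proof (induction k)
  case 0
  show ?case
  proof (cases "b = 0")
    case True
    have "is_path n (0, valley 0 0 i)" using valley_path[of 0 0 i n] 0 n_ge by (simp add: paths_def)
    then show ?thesis using True 0 pc_zero_bottom[of "valley 0 0 i"] by (simp add: valley_def arrows_def)
  next
    case False
    then have "b = 1" using 0 by simp
    then show ?thesis using 0 by (simp add: valley_def upt_conv_Cons)
  qed
next
  case (Suc k)
  show ?case
  proof (cases "b = Suc k + 1")
    case True
    then show ?thesis using Suc.prems by (simp add: valley_def upt_conv_Cons)
  next
    case False
    then have b: "b \<le> k + 1" using Suc by simp
    have v: "valley b (Suc k + 1) i = Arr (Suc k) # valley b (Suc k) i"
      using b by (simp add: valley_def)
    have p: "is_path n (Suc k, valley b (Suc k) i)"
      using valley_path[of b "Suc k" i n] b Suc.prems by (simp add: paths_def)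
    have p': "is_path n (Suc k, Arr k # Star k # valley b (Suc k) i)"
      using p Suc.prems by (simp add: arrows_def)
    have "pc (Suc k) (Star (Suc k) # valley b (Suc k + 1) i) =
        pc (Suc k) (Arr k # Star k # valley b (Suc k) i)"
      unfolding v using pc_swap[OF _ _ p] Suc.prems by simp
    also have "\<dots> = pc (Suc k) [Arr k] \<otimes>\<^bsub>A\<^esub> pc k (Star k # valley b (Suc k) i)"
      using pc_Cons[OF p'] by simp
    also have "\<dots> = (if b = 0 then \<zero>\<^bsub>A\<^esub> else pc (Suc k) (valley (b - 1) (Suc k) i))"
    proof (cases "b = 0")
      case True
      then show ?thesis using Suc b p' by simp
    next
      case False
      have "valley (b - 1) (Suc k) i = Arr k # valley (b - 1) k i"
        using b False by (simp add: valley_def)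
      moreover have "is_path n (Suc k, Arr k # valley (b - 1) k i)"
        using valley_path[of "b - 1" k i n] b Suc.prems by (simp add: paths_def arrows_def)
      ultimately show ?thesis using Suc b False pc_Cons[of "Suc k" "Arr k" "valley (b - 1) k i"] by simp
    qed
    finally show ?thesis .
  qed
qed

text \<open>Induction on the leftmost arrow: an \<open>Arr\<close> prolongs the valley, a
  \<open>Star\<close> is absorbed by \<open>pc_Star_valley\<close>. The equation with
  \<open>2 * b\<close> says that the length is preserved, so endpoints and length determine
  \<open>b\<close>.\<close>

lemma pc_valley:
  assumes "is_path n (j, xs)"
  shows "pc j xs = \<zero>\<^bsub>A\<^esub> \<or> (\<exists>b. path_source (j, xs) + j = length xs + 2 * b \<and> b \<le> j \<and>
    b \<le> path_source (j, xs) \<and> pc j xs = pc j (valley b j (path_source (j, xs))))"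
  using assms
proof (induction xs arbitrary: j)
  case Nil
  then show ?case by (intro disjI2 exI[of _ j]) (simp add: valley_def)
next
  case (Cons x xs)
  let ?h = "source x" and ?i = "path_source (j, x # xs)"
  have i: "?i < n" using is_path_source[OF Cons.prems] .
  have x: "pc j (x # xs) = pc j [x] \<otimes>\<^bsub>A\<^esub> pc ?h xs" by (rule pc_Cons[OF Cons.prems])
  have xc: "pc j [x] \<in> carrier A" using Cons.prems by (simp add: arrows_bounds)
  have "is_path n (?h, xs)" using Cons.prems by simp
  from Cons.IH[OF this] consider "pc ?h xs = \<zero>\<^bsub>A\<^esub>"
    | b where "?i + ?h = length xs + 2 * b" "b \<le> ?h" "b \<le> ?i" "pc ?h xs = pc ?h (valley b ?h ?i)"
    by auto
  then show ?case
  proof cases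
    case 1
    then show ?thesis using x xc by simp
  next
    case b: (2 b)
    have "?h < n" "j < n" using Cons.prems by (auto simp: arrows_bounds)
    then have "is_path n (?h, valley b ?h ?i)"
      using valley_path[of b ?h ?i n] b i by (simp add: paths_def)
    then have p: "is_path n (j, x # valley b ?h ?i)" using Cons.prems by simp
    have x': "pc j (x # xs) = pc j (x # valley b ?h ?i)"
      using x b pc_Cons[OF p] by simp
    show ?thesis
    proof (cases x)
      case (Arr h)
      then have h: "?h = h" "j = h + 1" using Cons.prems by auto
      then have "x # valley b ?h ?i = valley b j ?i" using b Arr by (simp add: valley_def)
      then show ?thesis using b h x' by (intro disjI2 exI[of _ b]) auto
    next
      case (Star k)
      then have k: "?h = k + 1" "j = k" using Cons.prems by auto
      then have e: "pc j (x # xs) = (if b = 0 then \<zero>\<^bsub>A\<^esub> else pc j (valley (b - 1) j ?i))"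
        using x' Star pc_Star_valley[of b k ?i] b i \<open>?h < n\<close> by simp
      show ?thesis
      proof (cases "b = 0")
        case False
        then show ?thesis using e b k by (intro disjI2 exI[of _ "b - 1"]) auto
      qed (use e in simp)
    qed
  qed
qed

lemma peak_path:
  assumes "j \<le> c" "i \<le> c" "c < n"
  shows "peak c j i \<in> paths n j i (2 * c - i - j)"
proof -
  have 1: "is_path n (j, map Star [j..<c]) \<and> path_source (j, map Star [j..<c]) = c"
    using assms(1,3)
  proof (induction "c - j" arbitrary: j)
    case (Suc d)
    then show ?case by (simp add: upt_conv_Cons arrows_def)
  qed simp
  have 2: "is_path n (c, map Arr (rev [i..<c])) \<and> path_source (c, map Arr (rev [i..<c])) = i"
    using assms(2,3)
  proof (induction c)
    case (Suc c)
    then show ?case by (cases "i = Suc c") (auto simp: arrows_def)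
  qed simp
  show ?thesis using 1 2 assms by (simp add: peak_def paths_def)
qed

text \<open>Mirror image of \<open>pc_Star_valley\<close>: the valley created at \<open>k\<close> is
  pushed up the slope towards \<open>c\<close>, which is why the induction runs on
  \<open>c - k\<close>, and it dies at the vertex \<open>n - 1\<close>.\<close>

lemma pc_Arr_peak:
  assumes "k \<le> c" "i \<le> c" "c < n" "k + 1 < n"
  shows "pc (k + 1) (Arr k # peak c k i) = (if c = n - 1 then \<zero>\<^bsub>A\<^esub> else pc (k + 1) (peak (c + 1) (k + 1) i))"
  using assms
proof (induction "c - k" arbitrary: k)
  case 0
  then have "c = k" "c \<noteq> n - 1" by auto
  then show ?case using 0 by (simp add: peak_def)
next
  case (Suc d)
  then have k: "k < c" by simp
  have v: "peak c k i = Star k # peak c (k + 1) i"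
    using k by (simp add: peak_def upt_conv_Cons)
  have p: "is_path n (k + 1, peak c (k + 1) i)"
    using peak_path[of "k + 1" c i] k Suc.prems by (simp add: paths_def)
  show ?case
  proof (cases "k + 2 = n")
    case True
    then have "c = n - 1" using k Suc.prems by auto
    then show ?thesis unfolding v using pc_zero_top[OF _ True[symmetric], of "peak c (k + 1) i"] p True
      by (simp add: arrows_def)
  next
    case False
    then have k2: "k + 2 < n" using Suc.prems by simp
    have p': "is_path n (k + 1, Star (k + 1) # Arr (k + 1) # peak c (k + 1) i)"
      using p k2 by (simp add: arrows_def)
    have "pc (k + 1) (Arr k # peak c k i) = pc (k + 1) (Star (k + 1) # Arr (k + 1) # peak c (k + 1) i)"
      unfolding v using pc_swap[OF _ _ p] k2 by simp
    also have "\<dots> = pc (k + 1) [Star (k + 1)] \<otimes>\<^bsub>A\<^esub> pc (k + 2) (Arr (k + 1) # peak c (k + 1) i)"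
      using pc_Cons[OF p'] by simp
    also have "\<dots> = (if c = n - 1 then \<zero>\<^bsub>A\<^esub> else pc (k + 1) (peak (c + 1) (k + 1) i))"
    proof (cases "c = n - 1")
      case True
      then show ?thesis using Suc.hyps(1)[of "k + 1"] Suc.hyps(2) Suc.prems k k2 p' by simp
    next
      case False
      have e: "peak (c + 1) (k + 1) i = Star (k + 1) # peak (c + 1) (k + 2) i"
        using k by (simp add: peak_def upt_conv_Cons)
      have "is_path n (k + 1, Star (k + 1) # peak (c + 1) (k + 2) i)"
        using peak_path[of "k + 2" "c + 1" i] k k2 False Suc.prems by (simp add: paths_def arrows_def)
      from pc_Cons[OF this] e show ?thesis
        using Suc.hyps(1)[of "k + 1"] Suc.hyps(2) Suc.prems k k2 False by simp
    qed
    finally show ?thesis .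
  qed
qed

lemma pc_peak:
  assumes "is_path n (j, xs)"
  shows "pc j xs = \<zero>\<^bsub>A\<^esub> \<or> (\<exists>c<n. path_source (j, xs) + j + length xs = 2 * c \<and> j \<le> c \<and>
    path_source (j, xs) \<le> c \<and> pc j xs = pc j (peak c j (path_source (j, xs))))"
  using assms
proof (induction xs arbitrary: j)
  case Nil
  then show ?case by (intro disjI2 exI[of _ j]) (simp add: peak_def)
next
  case (Cons x xs)
  let ?h = "source x" and ?i = "path_source (j, x # xs)"
  have i: "?i < n" using is_path_source[OF Cons.prems] .
  have x: "pc j (x # xs) = pc j [x] \<otimes>\<^bsub>A\<^esub> pc ?h xs" by (rule pc_Cons[OF Cons.prems])
  have xc: "pc j [x] \<in> carrier A" using Cons.prems by (simp add: arrows_bounds)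
  have "is_path n (?h, xs)" using Cons.prems by simp
  from Cons.IH[OF this] consider "pc ?h xs = \<zero>\<^bsub>A\<^esub>"
    | c where "c < n" "?i + ?h + length xs = 2 * c" "?h \<le> c" "?i \<le> c" "pc ?h xs = pc ?h (peak c ?h ?i)"
    unfolding path_source_simps by blast
  then show ?case
  proof cases
    case 1
    then show ?thesis using x xc by simp
  next
    case c: (2 c)
    have "?h < n" "j < n" using Cons.prems by (auto simp: arrows_bounds)
    then have "is_path n (?h, peak c ?h ?i)"
      using peak_path[of ?h c ?i] c i by (simp add: paths_def)
    then have p: "is_path n (j, x # peak c ?h ?i)" using Cons.prems by simp
    have x': "pc j (x # xs) = pc j (x # peak c ?h ?i)"
      using x c pc_Cons[OF p] by simp
    show ?thesis
    proof (cases x)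
      case (Star k)
      then have h: "?h = k + 1" "j = k" using Cons.prems by auto
      then have "x # peak c ?h ?i = peak c j ?i" using c Star by (simp add: peak_def upt_conv_Cons)
      then have "pc j (x # xs) = pc j (peak c j ?i)" using x' by simp
      moreover have "?i + j + length (x # xs) = 2 * c" "j \<le> c" using c h by auto
      ultimately show ?thesis using c by blast
    next
      case (Arr k)
      then have k: "?h = k" "j = k + 1" using Cons.prems by auto
      then have e: "pc j (x # xs) = (if c = n - 1 then \<zero>\<^bsub>A\<^esub> else pc j (peak (c + 1) j ?i))"
        using x' Arr pc_Arr_peak[of k c ?i] c i \<open>j < n\<close> by simp
      show ?thesis
      proof (cases "c = n - 1")
        case False
        then have "c + 1 < n" "?i + j + length (x # xs) = 2 * (c + 1)" "j \<le> c + 1" "?i \<le> c + 1"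
          using c k by auto
        then show ?thesis using e False by (intro disjI2 exI[of _ "c + 1"]) simp
      qed (use e in simp)
    qed
  qed
qed

text \<open>A nonzero class has both normal forms. The bottom of the valley is at least 0, which
  gives \<open>r \<le> i + j\<close>; the top of the peak is below \<open>n\<close>, which gives the
  upper bound. The remaining conditions in \<open>adm\<close> hold for every path.\<close>

lemma pc_not_adm:
  assumes "is_path n (j, xs)" "\<not> adm n j (path_source (j, xs)) (length xs)"
  shows "pc j xs = \<zero>\<^bsub>A\<^esub>"
proof (rule ccontr)
  assume "pc j xs \<noteq> \<zero>\<^bsub>A\<^esub>"
  then obtain b c where "path_source (j, xs) + j = length xs + 2 * b" "c < n"
    "path_source (j, xs) + j + length xs = 2 * c"
    using pc_valley[OF assms(1)] pc_peak[OF assms(1)] by metis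
  then show False using path_triangle[OF assms(1)] assms(2) by (auto simp: adm_def)
qed

section \<open>The relation ideal as the common kernel of the admissible path sums\<close>

lemma I_path_sum:
  assumes "f \<in> I" "adm n j i r"
  shows "path_sum n f j i r = 0"
proof -
  \<comment> \<open>The common kernel is an ideal by \<open>path_sum_mult_adm\<close>; as it
    contains the relators, it contains the ideal they generate.\<close>
  define K :: "'a path_fun set" where
    "K = {f \<in> carrier PA. \<forall>j i r. adm n j i r \<longrightarrow> path_sum n f j i r = 0}"
  have sub: "submodule class_ring K PA"
    by (rule submodule.intro)
      (auto simp: K_def path_sum_add path_sum_smult path_sum_zero path_module intro: path_smult_closed)
  have "ideal K PA"
  proof (rule idealI)
    show "subgroup K (add_monoid PA)"
      using submodule.abelian_subgroup[OF sub]
      by (intro additive_subgroup.a_subgroup abelian_subgroup.axioms(1))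
    fix f g :: "'a path_fun" assume f: "f \<in> K" and g: "g \<in> carrier PA"
    have "path_sum n (g \<otimes>\<^bsub>PA\<^esub> f) j i r = 0" "path_sum n (f \<otimes>\<^bsub>PA\<^esub> g) j i r = 0" if "adm n j i r" for j i r
      unfolding path_sum_mult_adm[OF that] using f by (auto simp: K_def intro!: sum.neutral)
    then show "g \<otimes>\<^bsub>PA\<^esub> f \<in> K" "f \<otimes>\<^bsub>PA\<^esub> g \<in> K"
      using f g by (simp_all add: K_def)
  qed (rule path_ring)
  moreover have "relators n \<subseteq> K"
    unfolding relators_def
  proof (rule LinearCombinations.module.span_is_subset[OF path_module _ sub])
    show "relator n ` {..<n} \<subseteq> K"
    proof
      fix f :: "'a path_fun" assume "f \<in> relator n ` {..<n}"
      then obtain v where v: "v < n" "f = relator n v" by auto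
      have "path_sum n (relator n v :: 'a path_fun) j i r = 0" if a: "adm n j i r" for j i r
      proof -
        have e: "relator n v (j, xs) =
            (if xs = [Arr (v - 1), Star (v - 1)] then if 0 < v \<and> j = v then 1 else 0 else 0) -
            (if xs = [Star v, Arr v] then if v < n - 1 \<and> j = v then 1 else 0 else (0::'a))" for xs
          using v by (auto simp: relator_eq[OF n_ge])
        have 1: "[Arr (v - 1), Star (v - 1)] \<in> paths n v i r \<longleftrightarrow> i = v \<and> r = 2" if "0 < v"
          using that v by (auto simp: paths_def arrows_def)
        have 2: "[Star v, Arr v] \<in> paths n v i r \<longleftrightarrow> i = v \<and> r = 2" if "v < n - 1"
          using that v by (auto simp: paths_def arrows_def)
        have "path_sum n (relator n v :: 'a path_fun) j i r =
            (if [Arr (v - 1), Star (v - 1)] \<in> paths n j i r then if 0 < v \<and> j = v then 1 else 0 else 0) -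
            (if [Star v, Arr v] \<in> paths n j i r then if v < n - 1 \<and> j = v then 1 else 0 else 0)"
          unfolding path_sum_def e sum_subtractf by simp
        \<comment> \<open>At an interior vertex the two 2-cycles have the same type and cancel. At
          the vertices 0 and \<open>n - 1\<close> a single 2-cycle remains, but there the degree 2
          is not admissible.\<close>
        also have "\<dots> = 0"
          using 1 2 a v by (auto simp: adm_def)
        finally show ?thesis .
      qed
      then show "f \<in> K" unfolding v(2) K_def using relator_carrier[OF v(1)] by simp
    qed
  qed
  ultimately have "I \<subseteq> K" unfolding relation_ideal_def by (rule P.genideal_minimal)
  with assms(1) have "f \<in> K" by (rule subsetD[rotated])
  then show ?thesis using assms(2) by (simp add: K_def)
qed

text \<open>In an admissible type the path sum of a single path is 1, so no path lies in the ideal,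
  and each one equals the valley whose bottom is forced by the type. In any other type all paths are
  zero.\<close>

lemma pc_adm:
  assumes "xs \<in> paths n j i r" "ys \<in> paths n j i r"
  shows "pc j xs = pc j ys"
proof (cases "adm n j i r")
  case True
  have "pc j zs = pc j (valley ((i + j - r) div 2) j i)" if "zs \<in> paths n j i r" for zs
  proof -
    have z: "is_path n (j, zs)" "path_source (j, zs) = i" "length zs = r" using that by (auto simp: paths_def)
    then have "path_sum n (path_elt (j, zs) :: 'a path_fun) j i r \<noteq> 0" by (simp add: path_sum_path_elt)
    then have "path_elt (j, zs) \<notin> I" using I_path_sum[OF _ True] by blast
    then have "pc j zs \<noteq> \<zero>\<^bsub>A\<^esub>" using cl_eq_zero_iff[OF path_elt_closed[OF z(1)]] by simp
    then obtain b where b: "i + j = r + 2 * b" "pc j zs = pc j (valley b j i)"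
      using pc_valley[OF z(1)] unfolding z(2,3) by blast
    from b(1) have "b = (i + j - r) div 2" by simp
    with b(2) show ?thesis by simp
  qed
  from this[OF assms(1)] this[OF assms(2)] show ?thesis by simp
next
  case False
  then have "pc j zs = \<zero>\<^bsub>A\<^esub>" if "zs \<in> paths n j i r" for zs
    using pc_not_adm[of j zs] that by (simp add: paths_def)
  from this[OF assms(1)] this[OF assms(2)] show ?thesis by simp
qed

lemma cl_lincomb:
  assumes "\<And>p. p \<in> S \<Longrightarrow> E p \<in> carrier PA"
  shows "cl (\<Oplus>\<^bsub>PA\<^esub>p\<in>S. c p \<odot>\<^bsub>PA\<^esub> E p) = (\<Oplus>\<^bsub>A\<^esub>p\<in>S. c p \<odot>\<^bsub>A\<^esub> cl (E p))"
proof -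
  have "cl (\<Oplus>\<^bsub>PA\<^esub>p\<in>S. c p \<odot>\<^bsub>PA\<^esub> E p) = (\<Oplus>\<^bsub>A\<^esub>p\<in>S. cl (c p \<odot>\<^bsub>PA\<^esub> E p))"
    by (rule cl_finsum) (rule path_smult_closed, rule assms)
  also have "\<dots> = (\<Oplus>\<^bsub>A\<^esub>p\<in>S. c p \<odot>\<^bsub>A\<^esub> cl (E p))"
    using assms by (intro A.finsum_cong' refl) (simp_all add: cl_smult path_smult_closed)
  finally show ?thesis .
qed

text \<open>Modulo the ideal every path may be replaced by the canonical path of its type, or by 0
  if the type is not admissible (\<open>E\<close>). After that the coefficients are exactly the
  admissible path sums, so nothing is left.\<close>

lemma path_sum_I:
  assumes "f \<in> carrier PA" "\<And>j i r. adm n j i r \<Longrightarrow> path_sum n f j i r = 0"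
  shows "f \<in> I"
proof -
  define S where "S = {p. f p \<noteq> 0}"
  have S: "finite S" "\<And>p. p \<in> S \<Longrightarrow> is_path n p" 
    using assms(1) carrierD by (auto simp: S_def path_alg_sel(1))
  define ad where "ad p = adm n (fst p) (path_source p) (length (snd p))" for p
  define can where "can p = (fst p, canon n (fst p) (path_source p) (length (snd p)))" for p
  define E :: "path \<Rightarrow> 'a path_fun" where "E p = (if ad p then path_elt (can p) else \<zero>\<^bsub>PA\<^esub>)" for p
  have p: "snd p \<in> paths n (fst p) (path_source p) (length (snd p))" if "is_path n p" for p
    using that by (simp add: paths_def)
  have can: "snd (can p) \<in> paths n (fst p) (path_source p) (length (snd p))" if "is_path n p" for p
    unfolding can_def using canon_paths[OF p[OF that]] by simp
  then have canp: "is_path n (can p)" if "is_path n p" for p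
    using that by (simp add: paths_def can_def)
  have E: "E p \<in> carrier PA" if "is_path n p" for p
    using canp[OF that] by (simp add: E_def)
  have clE: "cl (path_elt p) = cl (E p)" if "is_path n p" for p
  proof (cases "ad p")
    case True
    then show ?thesis
      using pc_adm[OF p[OF that] can[OF that]] by (simp add: E_def can_def)
  next
    case False
    then show ?thesis using pc_not_adm[of "fst p" "snd p"] that by (simp add: E_def ad_def cl_zero)
  qed
  have "cl f = cl (\<Oplus>\<^bsub>PA\<^esub>p\<in>S. f p \<odot>\<^bsub>PA\<^esub> path_elt p)"
    using path_elt_sum[OF assms(1) S(1) _ S(2)] by (simp add: S_def)
  also have "\<dots> = (\<Oplus>\<^bsub>A\<^esub>p\<in>S. f p \<odot>\<^bsub>A\<^esub> cl (path_elt p))"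
    by (rule cl_lincomb) (rule path_elt_closed, rule S(2))
  also have "\<dots> = (\<Oplus>\<^bsub>A\<^esub>p\<in>S. f p \<odot>\<^bsub>A\<^esub> cl (E p))"
    using E[OF S(2)] by (intro A.finsum_cong' refl) (simp_all add: clE[OF S(2)] cl_smult path_smult_closed)
  also have "\<dots> = cl (\<Oplus>\<^bsub>PA\<^esub>p\<in>S. f p \<odot>\<^bsub>PA\<^esub> E p)"
    by (rule cl_lincomb[symmetric]) (rule E, rule S(2))
  also have "(\<Oplus>\<^bsub>PA\<^esub>p\<in>S. f p \<odot>\<^bsub>PA\<^esub> E p) = \<zero>\<^bsub>PA\<^esub>"
  proof (rule ext, clarify)
    fix j ys
    define i r where "i = path_source (j, ys)" and "r = length ys"
    have "(\<Oplus>\<^bsub>PA\<^esub>p\<in>S. f p \<odot>\<^bsub>PA\<^esub> E p) (j, ys) = (\<Sum>p\<in>S. (f p \<odot>\<^bsub>PA\<^esub> E p) (j, ys))"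
      using S E by (intro path_finsum path_smult_closed) auto
    also have "\<dots> = (\<Sum>p\<in>S. if ad p \<and> can p = (j, ys) then f p else 0)"
      by (rule sum.cong) (auto simp: E_def path_alg_sel path_elt_def)
    also have "\<dots> = 0"
    \<comment> \<open>Only the canonical path of an admissible type can carry a coefficient; it
      collects those of all paths of that type.\<close>
    proof (cases "adm n j i r \<and> ys = canon n j i r")
      case True
      have "(\<Sum>p\<in>S. if ad p \<and> can p = (j, ys) then f p else 0) = (\<Sum>p\<in>{p \<in> S. ad p \<and> can p = (j, ys)}. f p)"
        using S by (simp add: sum.inter_filter)
      also have "\<dots> = (\<Sum>p\<in>Pair j ` paths n j i r. f p)"
      proof (rule sum.mono_neutral_left)
        show "{p \<in> S. ad p \<and> can p = (j, ys)} \<subseteq> Pair j ` paths n j i r"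
        proof clarify
          fix v xs assume "(v, xs) \<in> S" "can (v, xs) = (j, ys)"
          moreover from this have "ys \<in> paths n v (path_source (v, xs)) (length xs)"
            using can[OF S(2)] by force
          ultimately show "(v, xs) \<in> Pair j ` paths n j i r"
            using S(2)[of "(v, xs)"] by (auto simp: can_def paths_def i_def r_def)
        qed
        show "\<forall>p\<in>Pair j ` paths n j i r - {p \<in> S. ad p \<and> can p = (j, ys)}. f p = 0"
          using True by (auto simp: S_def ad_def can_def paths_def)
      qed simp
      also have "\<dots> = path_sum n f j i r"
        by (simp add: path_sum_def sum.reindex inj_on_def)
      finally show ?thesis using assms(2) True by simp
    next
      case False
      have "\<not> (ad p \<and> can p = (j, ys))" if "p \<in> S" for p
      proof
        assume a: "ad p \<and> can p = (j, ys)"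
        then have "ys \<in> paths n (fst p) (path_source p) (length (snd p))" "fst p = j"
          using can[OF S(2)[OF that]] by (auto simp: can_def)
        then have "path_source p = i" "length (snd p) = r" by (auto simp: paths_def i_def r_def)
        then show False using False a \<open>fst p = j\<close> by (auto simp: ad_def can_def)
      qed
      then show ?thesis by (intro sum.neutral) auto
    qed
    finally show "(\<Oplus>\<^bsub>PA\<^esub>p\<in>S. f p \<odot>\<^bsub>PA\<^esub> E p) (j, ys) = \<zero>\<^bsub>PA\<^esub> (j, ys)" by (simp add: path_alg_sel)
  qed
  finally show ?thesis using cl_zero cl_eq_zero_iff[OF assms(1)] by simp
qed

end

section \<open>Coordinates on the preprojective algebra\<close>

definition coord :: "nat \<Rightarrow> 'a::field path_fun set \<Rightarrow> nat \<Rightarrow> nat \<Rightarrow> nat \<Rightarrow> 'a" where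
  "coord n a j i r = (if adm n j i r then path_sum n (SOME f. f \<in> a) j i r else 0)"

lemma coord_not_adm: "\<not> adm n j i r \<Longrightarrow> coord n a j i r = 0"
  by (simp add: coord_def)

lemma path_grade_add:
  assumes "f \<in> path_grade n r" "g \<in> path_grade n r"
  shows "f \<oplus>\<^bsub>path_alg n\<^esub> g \<in> path_grade n r"
proof -
  have "length xs = r" if "f (v, xs) + g (v, xs) \<noteq> 0" for v xs
    using that path_grade_zero[OF assms(1), of xs v] path_grade_zero[OF assms(2), of xs v] by fastforce
  moreover have "f \<oplus>\<^bsub>path_alg n\<^esub> g \<in> carrier (path_alg n)"
    using assms by (intro path_add_closed path_grade_carrier)
  ultimately show ?thesis by (simp add: path_grade_def path_alg_sel(5))
qed

lemma path_grade_smult: "f \<in> path_grade n r \<Longrightarrow> c \<odot>\<^bsub>path_alg n\<^esub> f \<in> path_grade n r"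
  unfolding path_grade_def using path_smult_closed by (auto simp: path_alg_sel(6))

lemma path_grade_zero_mem: "\<zero>\<^bsub>path_alg n\<^esub> \<in> path_grade n r"
  by (simp add: path_grade_def path_alg_sel)

lemma path_grade_eqI:
  assumes "f \<in> path_grade n r" "g \<in> path_grade n r"
    "\<And>v xs. is_path n (v, xs) \<Longrightarrow> length xs = r \<Longrightarrow> f (v, xs) = g (v, xs)"
  shows "f = g"
proof (rule ext, clarify)
  fix v xs
  show "f (v, xs) = g (v, xs)"
    using assms carrierD[OF path_grade_carrier[OF assms(1)], of "(v, xs)"]
      carrierD[OF path_grade_carrier[OF assms(2)], of "(v, xs)"] path_grade_zero[of _ n r xs v]
    by metis
qed

context typeA
begin

text \<open>The representative picked by \<open>SOME\<close> differs from \<open>f\<close> by an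
  element of the ideal, on which the admissible path sums vanish.\<close>

lemma coord_cl:
  assumes "f \<in> carrier PA"
  shows "coord n (cl f) j i r = (if adm n j i r then path_sum n f j i r else 0)"
proof (cases "adm n j i r")
  case True
  have "f \<in> cl f"
    using abelian_subgroup.a_rcos_self[OF submodule.abelian_subgroup[OF I_submodule] assms]
    by (simp add: preproj_class_def)
  then have "(SOME g. g \<in> cl f) \<in> cl f" by (rule someI[of "\<lambda>g. g \<in> cl f"])
  then obtain a where "a \<in> I" "(SOME g. g \<in> cl f) = a \<oplus>\<^bsub>PA\<^esub> f"
    by (auto simp: preproj_class_def a_r_coset_def')
  then show ?thesis using I_path_sum[OF _ True] True by (simp add: coord_def path_sum_add)
qed (simp add: coord_def)

lemma coord_add:
  assumes "a \<in> carrier A" "b \<in> carrier A"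
  shows "coord n (a \<oplus>\<^bsub>A\<^esub> b) j i r = coord n a j i r + coord n b j i r"
  using assms unfolding A_carrier by (auto simp: cl_add coord_cl path_sum_add path_add_closed)

lemma coord_smult: "a \<in> carrier A \<Longrightarrow> coord n (c \<odot>\<^bsub>A\<^esub> a) j i r = c * coord n a j i r"
  unfolding A_carrier by (auto simp: cl_smult coord_cl path_sum_smult path_smult_closed)

lemma coord_zero: "coord n \<zero>\<^bsub>A\<^esub> j i r = 0"
  unfolding cl_zero[symmetric] by (simp add: coord_cl path_sum_zero)

lemma coord_minus:
  assumes "a \<in> carrier A" "b \<in> carrier A"
  shows "coord n (a \<ominus>\<^bsub>A\<^esub> b) j i r = coord n a j i r - coord n b j i r"
proof -
  have "coord n b j i r + coord n (\<ominus>\<^bsub>A\<^esub> b) j i r = 0"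
    using coord_add[of b "\<ominus>\<^bsub>A\<^esub> b"] assms by (simp add: A.r_neg coord_zero)
  then have "coord n (\<ominus>\<^bsub>A\<^esub> b) j i r = - coord n b j i r" by (simp add: eq_neg_iff_add_eq_0 add.commute)
  then show ?thesis using coord_add[of a "\<ominus>\<^bsub>A\<^esub> b"] assms by (simp add: a_minus_def)
qed

lemma coord_mult:
  assumes "a \<in> carrier A" "b \<in> carrier A"
  shows "coord n (a \<otimes>\<^bsub>A\<^esub> b) j i r =
    (if adm n j i r then \<Sum>h<n. \<Sum>s\<le>r. coord n a j h s * coord n b h i (r - s) else 0)"
  using assms unfolding A_carrier by (auto simp: cl_mult coord_cl path_sum_mult_adm)

lemma coord_finsum:
  assumes "\<And>x. x \<in> S \<Longrightarrow> f x \<in> carrier A"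
  shows "coord n (\<Oplus>\<^bsub>A\<^esub>x\<in>S. f x) j i r = (\<Sum>x\<in>S. coord n (f x) j i r)"
  using assms
proof (induction S rule: infinite_finite_induct)
  case (insert x S)
  have "(\<Oplus>\<^bsub>A\<^esub>y\<in>insert x S. f y) = f x \<oplus>\<^bsub>A\<^esub> (\<Oplus>\<^bsub>A\<^esub>y\<in>S. f y)"
    by (rule A.finsum_insert) (use insert in auto)
  moreover have "(\<Oplus>\<^bsub>A\<^esub>y\<in>S. f y) \<in> carrier A"
    by (rule A.finsum_closed) (use insert in auto)
  ultimately show ?case using insert by (simp add: coord_add)
qed (simp_all add: coord_zero)

text \<open>This is \<open>path_sum_I\<close> for a difference of representatives. Equations in A
  are verified through it from here on.\<close>

lemma coord_inj:
  assumes "a \<in> carrier A" "b \<in> carrier A" "\<And>j i r. adm n j i r \<Longrightarrow> coord n a j i r = coord n b j i r"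
  shows "a = b"
proof -
  obtain f g where f: "f \<in> carrier PA" "a = cl f" and g: "g \<in> carrier PA" "b = cl g"
    using assms(1,2) unfolding A_carrier by auto
  have "path_sum n (f \<ominus>\<^bsub>PA\<^esub> g) j i r = 0" if "adm n j i r" for j i r
    using assms(3)[OF that] that f g unfolding path_a_minus[OF f(1) g(1)]
    by (simp add: coord_cl) (simp add: path_sum_def sum_subtractf)
  then have "f \<ominus>\<^bsub>PA\<^esub> g \<in> I" using f g by (intro path_sum_I P.minus_closed)
  then show ?thesis using cl_eq_iff[OF f(1) g(1)] f g by simp
qed

lemma coord_path_elt:
  assumes "is_path n (v, xs)"
  shows "coord n (pc v xs) j i r =
    (if adm n j i r \<and> j = v \<and> i = path_source (v, xs) \<and> r = length xs then 1 else 0)"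
  using assms by (simp add: coord_cl path_sum_path_elt)

text \<open>The prescribed values are placed on the canonical paths. The second conclusion controls
  the lengths of the paths in the support, which yields a homogeneous representative in
  \<open>preproj_grade_iff\<close>.\<close>

lemma coord_ex:
  fixes G :: "nat \<Rightarrow> nat \<Rightarrow> nat \<Rightarrow> 'a"
  shows "\<exists>f\<in>carrier PA. (\<forall>j i r. coord n (cl f) j i r = (if adm n j i r then G j i r else 0)) \<and>
    (\<forall>v xs. f (v, xs) \<noteq> 0 \<longrightarrow> (\<exists>j i. adm n j i (length xs) \<and> G j i (length xs) \<noteq> 0))"
proof -
  define f where "f = (\<lambda>(j, xs). if adm n j (path_source (j, xs)) (length xs) \<and>
      xs = canon n j (path_source (j, xs)) (length xs) then G j (path_source (j, xs)) (length xs) else 0)"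
  have canon: "canon n j i r \<in> paths n j i r" if "adm n j i r" for j i r
    using adm_path[OF that] n_ge by (intro canon_paths) auto
  have "f \<in> carrier PA"
  proof (rule path_carrierI)
    show "{p. f p \<noteq> 0} \<subseteq> (\<lambda>(j, i, r). (j, canon n j i r)) ` ({..<n} \<times> {..<n} \<times> {..2 * n})"
    proof clarify
      fix j xs assume nz: "f (j, xs) \<noteq> 0"
      let ?i = "path_source (j, xs)" and ?r = "length xs"
      have a: "adm n j ?i ?r" "xs = canon n j ?i ?r" using nz by (auto simp: f_def split: if_splits)
      have "(j, xs) = (\<lambda>(j, i, r). (j, canon n j i r)) (j, ?i, ?r)" using a(2) by simp
      moreover have "(j, ?i, ?r) \<in> {..<n} \<times> {..<n} \<times> {..2 * n}"
        using adm_bounds[OF a(1)] n_ge by auto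
      ultimately show "(j, xs) \<in> (\<lambda>(j, i, r). (j, canon n j i r)) ` ({..<n} \<times> {..<n} \<times> {..2 * n})"
        by (rule image_eqI)
    qed
    show "is_path n p" if "f p \<noteq> 0" for p
    proof -
      obtain j xs where p: "p = (j, xs)" by (cases p)
      then have "adm n j (path_source (j, xs)) (length xs)" "xs = canon n j (path_source (j, xs)) (length xs)"
        using that by (auto simp: f_def split: if_splits)
      then show ?thesis using canon p unfolding paths_def by (metis (mono_tags, lifting) mem_Collect_eq)
    qed
  qed simp
  moreover have "coord n (cl f) j i r = (if adm n j i r then G j i r else 0)" for j i r
  proof (cases "adm n j i r")
    case True
    have "path_sum n f j i r = (\<Sum>xs\<in>paths n j i r. if xs = canon n j i r then G j i r else 0)"
      unfolding path_sum_def using True by (intro sum.cong) (auto simp: f_def paths_def)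
    also have "\<dots> = G j i r" using canon[OF True] by simp
    finally show ?thesis using True \<open>f \<in> carrier PA\<close> by (simp add: coord_cl)
  qed (simp add: coord_def)
  moreover have "\<exists>j i. adm n j i (length xs) \<and> G j i (length xs) \<noteq> 0" if "f (v, xs) \<noteq> 0" for v xs
    using that by (auto simp: f_def split: if_splits)
  ultimately show ?thesis by blast
qed

lemma preproj_grade_iff:
  "a \<in> preproj_grade n d \<longleftrightarrow> a \<in> carrier A \<and> (\<forall>j i r. r \<noteq> d \<longrightarrow> coord n a j i r = 0)"
proof
  assume "a \<in> preproj_grade n d"
  then obtain f where f: "f \<in> path_grade n d" "a = cl f" by (auto simp: preproj_grade_def)
  have "path_sum n f j i r = 0" if "r \<noteq> d" for j i r
    unfolding path_sum_def using path_grade_zero[OF f(1)] that by (intro sum.neutral) (auto simp: paths_def)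
  then show "a \<in> carrier A \<and> (\<forall>j i r. r \<noteq> d \<longrightarrow> coord n a j i r = 0)"
    using f path_grade_carrier[OF f(1)] by (simp add: coord_cl)
next
  assume a: "a \<in> carrier A \<and> (\<forall>j i r. r \<noteq> d \<longrightarrow> coord n a j i r = 0)"
  obtain f where f: "f \<in> carrier PA"
    "\<And>j i r. coord n (cl f) j i r = (if adm n j i r then coord n a j i r else 0)"
    "\<And>v xs. f (v, xs) \<noteq> 0 \<Longrightarrow> \<exists>j i. adm n j i (length xs) \<and> coord n a j i (length xs) \<noteq> 0"
    using coord_ex[of "coord n a"] by blast
  have "length xs = d" if "f (v, xs) \<noteq> 0" for v xs using f(3)[OF that] a by metis
  then have "f \<in> path_grade n d" using f(1) by (auto simp: path_grade_def)
  moreover have "a = cl f" using a f by (intro coord_inj) auto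
  ultimately show "a \<in> preproj_grade n d" by (auto simp: preproj_grade_def)
qed

end

section \<open>The spaces of the Koszul complex\<close>

definition two_cycle :: "arrow \<Rightarrow> arrow \<Rightarrow> bool" where
  "two_cycle x y \<longleftrightarrow> (\<exists>k. x = Arr k \<and> y = Star k \<or> x = Star k \<and> y = Arr k)"

text \<open>Coefficient form of membership in R: for a fixed tail \<open>zs\<close>, the part at
  \<open>v\<close> has to be a multiple of the relator at \<open>v\<close>. An end vertex has only
  one 2-cycle, so no sign condition arises there.\<close>

definition rel_at :: "nat \<Rightarrow> (arrow list \<Rightarrow> 'a::field) \<Rightarrow> nat \<Rightarrow> arrow list \<Rightarrow> bool" where
  "rel_at n g v zs \<longleftrightarrow> (\<forall>x y. g (x # y # zs) \<noteq> 0 \<longrightarrow> two_cycle x y) \<and>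
    (0 < v \<and> v < n - 1 \<longrightarrow> g (Arr (v - 1) # Star (v - 1) # zs) = - g (Star v # Arr v # zs))"

text \<open>Conditions on the two leftmost letters, satisfied by R V^(p-2);
  \<open>rel_space'\<close> imposes them one place further to the right, as holds in V R V^(p-3).
  Membership in both is a necessary condition for W_p in terms of coefficients.\<close>

definition rel_space :: "nat \<Rightarrow> nat \<Rightarrow> 'a::field path_fun set" where
  "rel_space n p = {w \<in> path_grade n p. \<forall>v zs. rel_at n (\<lambda>xs. w (v, xs)) v zs}"

definition rel_space' :: "nat \<Rightarrow> nat \<Rightarrow> 'a::field path_fun set" where
  "rel_space' n p = {w \<in> path_grade n p. \<forall>v x zs. rel_at n (\<lambda>xs. w (v, x # xs)) (source x) zs}"

lemma rel_at_add:
  assumes "rel_at n f v zs" "rel_at n g v zs"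
  shows "rel_at n (\<lambda>xs. f xs + g xs) v zs"
proof -
  have "two_cycle x y" if "f (x # y # zs) + g (x # y # zs) \<noteq> 0" for x y
    using that assms by (cases "f (x # y # zs) = 0") (auto simp: rel_at_def)
  then show ?thesis using assms by (simp add: rel_at_def)
qed

lemma rel_at_smult: "rel_at n f v zs \<Longrightarrow> rel_at n (\<lambda>xs. c * f xs) v zs"
  unfolding rel_at_def by auto

lemma rel_at_zero: "rel_at n (\<lambda>xs. 0) v zs"
  by (simp add: rel_at_def)

lemma rel_spaceI:
  "w \<in> path_grade n p \<Longrightarrow> (\<And>v zs. rel_at n (\<lambda>xs. w (v, xs)) v zs) \<Longrightarrow> w \<in> rel_space n p"
  unfolding rel_space_def by blast

lemma rel_spaceD:
  assumes "w \<in> rel_space n p"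
  shows "w \<in> path_grade n p" "rel_at n (\<lambda>xs. w (v, xs)) v zs" "w \<in> carrier (path_alg n)"
  using assms path_grade_carrier unfolding rel_space_def by blast+

lemma rel_space'I:
  "w \<in> path_grade n p \<Longrightarrow> (\<And>v x zs. rel_at n (\<lambda>xs. w (v, x # xs)) (source x) zs) \<Longrightarrow> w \<in> rel_space' n p"
  unfolding rel_space'_def by blast

lemma rel_space'd_coord:
  assumes "w \<in> rel_space' n p"
  shows "w \<in> path_grade n p" "rel_at n (\<lambda>xs. w (v, x # xs)) (source x) zs" "w \<in> carrier (path_alg n)"
  using assms path_grade_carrier unfolding rel_space'_def by blast+

lemma rel_space_add: "f \<in> rel_space n p \<Longrightarrow> g \<in> rel_space n p \<Longrightarrow> f \<oplus>\<^bsub>path_alg n\<^esub> g \<in> rel_space n p"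
  by (intro rel_spaceI path_grade_add) (auto simp: path_alg_sel(5) intro: rel_at_add dest: rel_spaceD)

lemma rel_space_zero: "\<zero>\<^bsub>path_alg n\<^esub> \<in> rel_space n p"
  by (intro rel_spaceI path_grade_zero_mem) (simp add: path_alg_sel rel_at_zero)

lemma rel_space_smult: "f \<in> rel_space n p \<Longrightarrow> c \<odot>\<^bsub>path_alg n\<^esub> f \<in> rel_space n p"
  by (intro rel_spaceI path_grade_smult) (auto simp: path_alg_sel(6) intro: rel_at_smult dest: rel_spaceD)

lemma rel_space'_add: "f \<in> rel_space' n p \<Longrightarrow> g \<in> rel_space' n p \<Longrightarrow> f \<oplus>\<^bsub>path_alg n\<^esub> g \<in> rel_space' n p"
  by (intro rel_space'I path_grade_add) (auto simp: path_alg_sel(5) intro: rel_at_add dest: rel_space'd_coord)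

lemma rel_space'_zero: "\<zero>\<^bsub>path_alg n\<^esub> \<in> rel_space' n p"
  by (intro rel_space'I path_grade_zero_mem) (simp add: path_alg_sel rel_at_zero)

section \<open>Tensor products inside the path algebra\<close>

lemma tensor_prod_induct:
  assumes "w \<in> tensor_prod n X Y" "X \<subseteq> carrier (path_alg n)" "Y \<subseteq> carrier (path_alg n)"
    "\<zero>\<^bsub>path_alg n\<^esub> \<in> S" "\<And>f g. f \<in> S \<Longrightarrow> g \<in> S \<Longrightarrow> f \<oplus>\<^bsub>path_alg n\<^esub> g \<in> S"
    "\<And>x y. x \<in> X \<Longrightarrow> y \<in> Y \<Longrightarrow> x \<otimes>\<^bsub>path_alg n\<^esub> y \<in> S"
  shows "w \<in> (S :: 'a::field path_fun set)"
proof -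
  interpret P: ring "path_alg n :: ('a, 'a path_fun) module" by (rule path_ring)
  obtain N :: nat and x y where xy: "\<And>i. i < N \<Longrightarrow> x i \<in> X \<and> y i \<in> Y"
    and w: "w = (\<Oplus>\<^bsub>path_alg n\<^esub>i\<in>{..<N}. x i \<otimes>\<^bsub>path_alg n\<^esub> y i)"
    using assms(1) by (auto simp: tensor_prod_def)
  have "(\<Oplus>\<^bsub>path_alg n\<^esub>i\<in>{..<M}. x i \<otimes>\<^bsub>path_alg n\<^esub> y i) \<in> S" if "M \<le> N" for M
    using that
  proof (induction M)
    case (Suc M)
    have c: "x i \<otimes>\<^bsub>path_alg n\<^esub> y i \<in> carrier (path_alg n)" if "i < Suc M" for i
      using xy[of i] Suc.prems that assms(2,3) by (intro P.m_closed) auto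
    have "(\<Oplus>\<^bsub>path_alg n\<^esub>i\<in>{..<Suc M}. x i \<otimes>\<^bsub>path_alg n\<^esub> y i) =
        x M \<otimes>\<^bsub>path_alg n\<^esub> y M \<oplus>\<^bsub>path_alg n\<^esub> (\<Oplus>\<^bsub>path_alg n\<^esub>i\<in>{..<M}. x i \<otimes>\<^bsub>path_alg n\<^esub> y i)"
      unfolding lessThan_Suc using c by (intro P.finsum_insert) auto
    then show ?case using Suc assms(5,6) xy[of M] by simp
  qed (use assms(4) in simp)
  then show ?thesis using w by simp
qed

lemma tensor_prod_zero: "\<zero>\<^bsub>path_alg n\<^esub> \<in> (tensor_prod n X Y :: 'a::field path_fun set)"
proof -
  interpret P: ring "path_alg n :: ('a, 'a path_fun) module" by (rule path_ring)
  show ?thesis unfolding tensor_prod_def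
    by (rule CollectI, rule exI[of _ 0], intro exI[of _ "\<lambda>_. \<zero>\<^bsub>path_alg n\<^esub>"]) simp
qed

lemma tensor_prod_single:
  assumes "x \<in> X" "y \<in> Y" "X \<subseteq> carrier (path_alg n)" "Y \<subseteq> carrier (path_alg n)"
  shows "x \<otimes>\<^bsub>path_alg n\<^esub> y \<in> (tensor_prod n X Y :: 'a::field path_fun set)"
proof -
  interpret P: ring "path_alg n :: ('a, 'a path_fun) module" by (rule path_ring)
  have "x \<otimes>\<^bsub>path_alg n\<^esub> y \<in> carrier (path_alg n)" using assms by (intro P.m_closed) auto
  then have "x \<otimes>\<^bsub>path_alg n\<^esub> y = (\<Oplus>\<^bsub>path_alg n\<^esub>i\<in>{..<1::nat}. x \<otimes>\<^bsub>path_alg n\<^esub> y)"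
    by (simp add: lessThan_Suc)
  then show ?thesis unfolding tensor_prod_def using assms(1,2)
    by (intro CollectI exI[of _ 1] exI[of _ "\<lambda>_. x"] exI[of _ "\<lambda>_. y"]) auto
qed

lemma tensor_prod_carrier:
  assumes "X \<subseteq> carrier (path_alg n)" "Y \<subseteq> carrier (path_alg n)"
  shows "tensor_prod n X Y \<subseteq> carrier (path_alg n)"
proof
  fix w :: "'a path_fun" assume "w \<in> tensor_prod n X Y"
  then show "w \<in> carrier (path_alg n)"
    by (rule tensor_prod_induct[OF _ assms])
      (use assms in \<open>auto intro!: path_add_closed path_mult_closed intro: path_grade_carrier path_grade_zero_mem\<close>)
qed

text \<open>Grade 0 is spanned by the idempotents, so it acts diagonally on paths from both
  sides.\<close>

lemma grade0_sandwich:
  assumes "u \<in> path_grade n 0" "v \<in> path_grade n 0"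
  shows "(u \<otimes>\<^bsub>path_alg n\<^esub> (x \<otimes>\<^bsub>path_alg n\<^esub> v)) (j, xs) = u (j, []) * (x (j, xs) * v (path_source (j, xs), []))"
  by (simp add: grade_mult_left[OF assms(1)] grade_mult_right[OF assms(2)])

context typeA
begin

abbreviation "PG r \<equiv> path_grade n r :: 'a path_fun set"
abbreviation "R \<equiv> relators n :: 'a path_fun set"

lemma PG_carrier: "PG r \<subseteq> carrier PA"
  by (auto simp: path_grade_def)

lemma rel_space_submodule: "submodule class_ring (rel_space n p :: 'a path_fun set) PA"
  by (rule submodule.intro) (auto intro: rel_space_add rel_space_smult rel_space_zero path_module dest: rel_spaceD(3))

lemma relator_rel_space: "v < n \<Longrightarrow> (relator n v :: 'a path_fun) \<in> rel_space n 2"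
  using relator_grade[OF n_ge, of v]
  by (auto simp: rel_space_def rel_at_def two_cycle_def relator_eq[OF n_ge])

lemma R_rel_space: "R \<subseteq> rel_space n 2"
  unfolding relators_def
  by (rule LinearCombinations.module.span_is_subset[OF path_module _ rel_space_submodule])
    (auto intro: relator_rel_space)

lemma tensor_PG0_R: "tensor_prod n (PG 0) R \<subseteq> rel_space n 2"
proof
  fix w assume "w \<in> tensor_prod n (PG 0) R"
  then show "w \<in> rel_space n 2"
  proof (rule tensor_prod_induct[OF _ PG_carrier relators_carrier rel_space_zero rel_space_add])
    fix x y assume x: "x \<in> PG 0" and "y \<in> R"
    then have y: "y \<in> rel_space n 2" using R_rel_space by auto
    then have "x \<otimes>\<^bsub>PA\<^esub> y \<in> PG 2" using grade_mult[OF x rel_spaceD(1)[OF y]] by (simp only: add_0)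
    then show "x \<otimes>\<^bsub>PA\<^esub> y \<in> rel_space n 2"
      using rel_spaceD(2)[OF y] by (intro rel_spaceI) (simp_all add: grade_mult_left[OF x] rel_at_smult)
  qed
qed

lemma tensor_PG1_R: "tensor_prod n (PG 1) R \<subseteq> rel_space' n 3"
proof
  fix w assume "w \<in> tensor_prod n (PG 1) R"
  then show "w \<in> rel_space' n 3"
  proof (rule tensor_prod_induct[OF _ PG_carrier relators_carrier rel_space'_zero rel_space'_add])
    fix x y assume x: "x \<in> PG 1" and "y \<in> R"
    then have y: "y \<in> rel_space n 2" using R_rel_space by auto
    have "x \<otimes>\<^bsub>PA\<^esub> y \<in> PG (1 + 2)" by (rule grade_mult[OF x rel_spaceD(1)[OF y]])
    then have "x \<otimes>\<^bsub>PA\<^esub> y \<in> PG 3" by (simp only: numeral_3_eq_3 numeral_2_eq_2 One_nat_def add_Suc add_0)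
    then show "x \<otimes>\<^bsub>PA\<^esub> y \<in> rel_space' n 3"
      using rel_spaceD(2)[OF y] by (intro rel_space'I) (simp_all add: grade_mult_left[OF x] rel_at_smult)
  qed
qed

text \<open>The conditions concern the two leftmost letters, which a factor on the right leaves
  alone.\<close>

lemma rel_space_mult:
  assumes "x \<in> rel_space n 2" "y \<in> PG q"
  shows "x \<otimes>\<^bsub>PA\<^esub> y \<in> rel_space n (2 + q)"
proof -
  note x = rel_spaceD(1,2)[OF assms(1)]
  have "rel_at n (\<lambda>xs. (x \<otimes>\<^bsub>PA\<^esub> y) (v, xs)) v zs" for v zs
    using x(2)[of v "[]"] unfolding rel_at_def
    by (auto simp: grade_mult_left[OF x(1)] numeral_2_eq_2)
  then show ?thesis using grade_mult[OF x(1) assms(2)] by (intro rel_spaceI)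
qed

lemma rel_space'_mult:
  assumes "x \<in> rel_space' n 3" "y \<in> PG q"
  shows "x \<otimes>\<^bsub>PA\<^esub> y \<in> rel_space' n (3 + q)"
proof -
  note x = rel_space'd_coord(1,2)[OF assms(1)]
  have "rel_at n (\<lambda>xs. (x \<otimes>\<^bsub>PA\<^esub> y) (v, a # xs)) (source a) zs" for v a zs
    using x(2)[of v a "[]"] unfolding rel_at_def
    by (auto simp: grade_mult_left[OF x(1)] numeral_3_eq_3)
  then show ?thesis using grade_mult[OF x(1) assms(2)] by (intro rel_space'I)
qed

lemma tensor_rel_space: "X \<subseteq> rel_space n 2 \<Longrightarrow> tensor_prod n X (PG q) \<subseteq> rel_space n (2 + q)"
proof
  fix w assume X: "X \<subseteq> rel_space n 2" and w: "w \<in> tensor_prod n X (PG q)"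
  have "X \<subseteq> carrier PA" using X rel_spaceD(3) by blast
  from w this show "w \<in> rel_space n (2 + q)"
    by (rule tensor_prod_induct[OF _ _ PG_carrier rel_space_zero rel_space_add])
      (assumption | rule rel_space_mult | use X in blast)+
qed

lemma tensor_rel_space': "X \<subseteq> rel_space' n 3 \<Longrightarrow> tensor_prod n X (PG q) \<subseteq> rel_space' n (3 + q)"
proof
  fix w assume X: "X \<subseteq> rel_space' n 3" and w: "w \<in> tensor_prod n X (PG q)"
  have "X \<subseteq> carrier PA" using X rel_space'd_coord(3) by blast
  from w this show "w \<in> rel_space' n (3 + q)"
    by (rule tensor_prod_induct[OF _ _ PG_carrier rel_space'_zero rel_space'_add])
      (assumption | rule rel_space'_mult | use X in blast)+
qed

text \<open>In a nonzero coefficient at a path \<open>x y z \<dots>\<close> both \<open>x y\<close> and \<open>y z\<close> are 2-cycles. Since \<open>n \<ge> 3\<close>,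
  one of the two is based at an interior vertex, and replacing it by the other 2-cycle there gives a
  path that is not of this form.\<close>

lemma rel_spaces_zero:
  assumes "w \<in> rel_space n p" "w \<in> rel_space' n p" "3 \<le> p"
  shows "w = \<zero>\<^bsub>PA\<^esub>"
proof (rule path_grade_eqI)
  show "w \<in> PG p" using assms by (simp add: rel_space_def)
  show "\<zero>\<^bsub>PA\<^esub> \<in> PG p" by (rule path_grade_zero_mem)
  fix v xs assume path: "is_path n (v, xs)" and len: "length xs = p"
  obtain x y z zs where xs: "xs = x # y # z # zs"
    using len assms(3) by (metis Suc_le_length_iff numeral_3_eq_3)
  have 1: "w (v, x # y # zs) \<noteq> 0 \<Longrightarrow> two_cycle x y"
    "0 < v \<Longrightarrow> v < n - 1 \<Longrightarrow> w (v, Arr (v - 1) # Star (v - 1) # zs) = - w (v, Star v # Arr v # zs)"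
    for v x y zs
    using assms(1) unfolding rel_space_def rel_at_def by blast+
  have 2: "w (v, x # y # z # zs) \<noteq> 0 \<Longrightarrow> two_cycle y z"
    "0 < source x \<Longrightarrow> source x < n - 1 \<Longrightarrow>
      w (v, x # Arr (source x - 1) # Star (source x - 1) # zs) = - w (v, x # Star (source x) # Arr (source x) # zs)"
    for v x y z zs
    using assms(2) unfolding rel_space'_def rel_at_def by blast+
  show "w (v, xs) = \<zero>\<^bsub>PA\<^esub> (v, xs)"
  proof (rule ccontr)
    assume "\<not> ?thesis"
    then have nz: "w (v, x # y # z # zs) \<noteq> 0" by (simp add: xs path_alg_sel)
    then have "two_cycle x y" "two_cycle y z" using 1(1) 2(1) by blast+
    then consider k where "x = Arr k" "y = Star k" "z = Arr k" | k where "x = Star k" "y = Arr k" "z = Star k"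
      by (auto simp: two_cycle_def)
    then show False
    proof cases
      case c: (1 k)
      then have k: "v = k + 1" "k + 2 \<le> n" using path xs by (auto simp: arrows_def)
      show False
      proof (cases "k = 0")
        case True
        then have "w (1, Star 1 # Arr 1 # Arr 0 # zs) \<noteq> 0"
          using 1(2)[of 1 "Arr 0 # zs"] nz c k n_ge by simp
        then show False using 2(1)[of 1 "Star 1"] by (auto simp: two_cycle_def)
      next
        case False
        then have "w (v, Arr k # Arr (k - 1) # Star (k - 1) # zs) \<noteq> 0"
          using 2(2)[of "Arr k" v zs] nz c k by simp
        then show False using 1(1)[of v "Arr k"] by (auto simp: two_cycle_def)
      qed
    next
      case c: (2 k)
      then have k: "v = k" "k + 2 \<le> n" using path xs by (auto simp: arrows_def)
      show False
      proof (cases "k + 2 = n")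
        case True
        then have "w (v, Arr (v - 1) # Star (v - 1) # Star k # zs) \<noteq> 0"
          using 1(2)[of v "Star k # zs"] nz c k n_ge by simp
        then have "two_cycle (Star (v - 1)) (Star k)" using 2(1)[of v "Arr (v - 1)"] by blast
        then show False by (auto simp: two_cycle_def)
      next
        case False
        then have "w (v, Star k # Star (k + 1) # Arr (k + 1) # zs) \<noteq> 0"
          using 2(2)[of "Star k" v zs] nz c k by simp
        then show False using 1(1)[of v "Star k"] by (auto simp: two_cycle_def)
      qed
    qed
  qed
qed

text \<open>The paths in \<open>basis_paths n p\<close> are the coordinates with respect to the basis \<open>basis_elt n p\<close>
  of \<open>W\<^sub>p\<close>. The cycle at 0 has the coefficient -1 in \<open>\<sigma>\<^sub>0\<close>, hence the sign.\<close>

definition cyc :: "nat \<Rightarrow> arrow list" where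
  "cyc v = (if v = 0 then [Star 0, Arr 0] else [Arr (v - 1), Star (v - 1)])"

definition basis_paths :: "nat \<Rightarrow> path set" where
  "basis_paths p = (if p = 0 then (\<lambda>v. (v, [])) ` {..<n}
     else if p = 1 then (\<lambda>x. (target x, [x])) ` arrows n
     else if p = 2 then (\<lambda>v. (v, cyc v)) ` {..<n} else {})"

definition basis_elt :: "nat \<Rightarrow> path \<Rightarrow> 'a path_fun" where
  "basis_elt p b = (if p = 2 then
     (if fst b = 0 then \<ominus>\<^bsub>PA\<^esub> (relator n 0) else relator n (fst b)) else path_elt b)"

lemma cyc_path:
  assumes "v < n"
  shows "is_path n (v, cyc v)" "path_source (v, cyc v) = v" "length (cyc v) = 2"
  using assms n_ge by (auto simp: cyc_def arrows_def)

lemma basis_paths_path: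
  assumes "b \<in> basis_paths p"
  shows "is_path n b" "length (snd b) = p" "fst b < n" "path_source b < n"
proof -
  show p: "is_path n b" and "length (snd b) = p"
    using assms by (auto simp: basis_paths_def cyc_path arrows_bounds split: if_splits)
  show "fst b < n" "path_source b < n"
    using p is_path_target[of n "fst b" "snd b"] is_path_source[of n "fst b" "snd b"] by auto
qed

lemma finite_basis_paths [simp]: "finite (basis_paths p)"
  by (simp add: basis_paths_def)

lemma basis_elt_2:
  assumes "v < n"
  shows "basis_elt 2 (v, ys) = (\<lambda>p. (if p = (v, cyc v) then 1 else 0) -
    (if 0 < v \<and> v < n - 1 \<and> p = (v, [Star v, Arr v]) then 1 else 0))"
proof (cases "v = 0")
  case True
  have "\<ominus>\<^bsub>PA\<^esub> (relator n 0) = (\<lambda>p. - relator n 0 p)"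
    using n_ge by (intro path_a_inv relator_carrier) simp
  then show ?thesis using n_ge True unfolding basis_elt_def
    by (auto simp: relator_eq[OF n_ge] cyc_def)
next
  case False
  then show ?thesis using assms unfolding basis_elt_def
    by (auto simp: relator_eq[OF n_ge] cyc_def)
qed

text \<open>The coefficient at a basis path is the dual coordinate. For \<open>p = 2\<close> an
  interior relator has a second term, the 2-cycle through \<open>v + 1\<close>, but that path is not
  a basis path.\<close>

lemma basis_elt_dual:
  assumes "b \<in> basis_paths p" "b' \<in> basis_paths p"
  shows "basis_elt p b b' = (if b = b' then 1 else 0)"
proof (cases "p = 2")
  case True
  then obtain v v' where b: "v < n" "v' < n" "b = (v, cyc v)" "b' = (v', cyc v')"
    using assms by (auto simp: basis_paths_def)
  then show ?thesis using True by (auto simp: basis_elt_2 cyc_def)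
qed (auto simp: basis_elt_def path_elt_def)

text \<open>A coefficient at a path of length 2 is one of the chosen coordinates, or the negative of
  one at the other 2-cycle of an interior vertex, or zero because the path is not a 2-cycle.\<close>

lemma rel_space_expand:
  assumes "w \<in> rel_space n 2"
  shows "w q = (\<Sum>b\<in>basis_paths 2. w b * basis_elt 2 b q)"
proof -
  obtain v xs where q: "q = (v, xs)" by (cases q)
  have "(\<Sum>b\<in>basis_paths 2. w b * basis_elt 2 b q) = (\<Sum>u<n. w (u, cyc u) * basis_elt 2 (u, cyc u) q)"
    unfolding basis_paths_def by (simp add: sum.reindex inj_on_def)
  also have "\<dots> = (\<Sum>u<n. if u = v then w (v, cyc v) * basis_elt 2 (v, cyc v) q else 0)"
    by (rule sum.cong) (auto simp: basis_elt_2 q)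
  also have "\<dots> = (if v < n then w (v, cyc v) * basis_elt 2 (v, cyc v) q else 0)" by simp
  also have "\<dots> = w q"
  proof (cases "is_path n (v, xs) \<and> length xs = 2")
    case False
    have "w \<in> path_grade n 2" using assms by (simp add: rel_space_def)
    then have "w q = 0"
      using False q carrierD[OF path_grade_carrier, of w n 2 q] path_grade_zero[of w n 2 xs v] by auto
    moreover have "basis_elt 2 (v, cyc v) q = 0" if "v < n"
    proof -
      have "is_path n (v, cyc v)" "length (cyc v) = 2" using cyc_path[OF that] by auto
      moreover have "is_path n (v, [Star v, Arr v])" if "v < n - 1" using that by (auto simp: arrows_def)
      ultimately show ?thesis using False q that by (auto simp: basis_elt_2)
    qed
    ultimately show ?thesis by simp
  next
    case True
    then obtain x y where xs: "xs = [x, y]"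
      by (metis (no_types, opaque_lifting) One_nat_def Suc_1 length_0_conv length_Suc_conv)
    have v: "v < n" using True is_path_target by blast
    have 1: "w (v, [x, y]) \<noteq> 0 \<Longrightarrow> two_cycle x y"
      "0 < v \<Longrightarrow> v < n - 1 \<Longrightarrow> w (v, [Arr (v - 1), Star (v - 1)]) = - w (v, [Star v, Arr v])" for x y
      using assms unfolding rel_space_def rel_at_def by blast+
    consider "xs = cyc v" | "0 < v" "v < n - 1" "xs = [Star v, Arr v]"
      | "xs \<noteq> cyc v" "\<not> (0 < v \<and> v < n - 1 \<and> xs = [Star v, Arr v])" by blast
    then show ?thesis
    proof cases
      case 1
      then show ?thesis using v q by (auto simp: basis_elt_2 cyc_def)
    next
      case 2
      then show ?thesis using v q 1(2) by (auto simp: basis_elt_2 cyc_def)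
    next
      case 3
      have "\<not> two_cycle x y"
      proof
        assume "two_cycle x y"
        then consider k where "x = Arr k" "y = Star k" | k where "x = Star k" "y = Arr k"
          by (auto simp: two_cycle_def)
        then show False
        proof cases
          case c: (1 k)
          then show False using 3 True xs by (auto simp: cyc_def)
        next
          case c: (2 k)
          then have "v = k" "k + 2 \<le> n" using True xs by (auto simp: arrows_def)
          then show False using 3 xs c by (cases "k = 0") (auto simp: cyc_def)
        qed
      qed
      then have "w q = 0" using 1(1) q xs by blast
      then show ?thesis using 3 q v by (auto simp: basis_elt_2)
    qed
  qed
  finally show ?thesis by simp
qed

text \<open>Each basis element is a relator up to sign, so the expansion of \<open>w\<close> is a
  linear combination of relators: the equations cut out no more than their span.\<close>

lemma R_eq_rel_space: "R = rel_space n 2"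
proof
  show "rel_space n 2 \<subseteq> R"
  proof
    fix w :: "'a path_fun" assume w: "w \<in> rel_space n 2"
    have sub: "submodule class_ring R PA" unfolding relators_def
      by (rule LinearCombinations.module.span_is_submodule[OF path_module]) (auto intro: relator_carrier)
    have b: "basis_elt 2 b \<in> R" if "b \<in> basis_paths 2" for b
    proof -
      from that have "fst b < n" using basis_paths_path by blast
      moreover have "\<ominus>\<^bsub>PA\<^esub> (relator n 0) \<in> R"
        using submodule.abelian_subgroup[OF sub] relator_in_relators[of 0] n_ge
        by (intro additive_subgroup.a_inv_closed abelian_subgroup.axioms(1)) auto
      ultimately show ?thesis using relator_in_relators by (simp add: basis_elt_def)
    qed
    have bc: "w b \<odot>\<^bsub>PA\<^esub> basis_elt 2 b \<in> R" if "b \<in> basis_paths 2" for b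
      using submodule.smult_closed[OF sub _ b[OF that]] by simp
    have "(\<Oplus>\<^bsub>PA\<^esub>b\<in>S. w b \<odot>\<^bsub>PA\<^esub> basis_elt 2 b) \<in> R" if "finite S" "S \<subseteq> basis_paths 2" for S
      using that
    proof (induction S)
      case empty
      then show ?case using submodule.zero_closed[OF sub] by simp
    next
      case (insert b S)
      have "(\<Oplus>\<^bsub>PA\<^esub>b\<in>insert b S. w b \<odot>\<^bsub>PA\<^esub> basis_elt 2 b) =
          w b \<odot>\<^bsub>PA\<^esub> basis_elt 2 b \<oplus>\<^bsub>PA\<^esub> (\<Oplus>\<^bsub>PA\<^esub>b\<in>S. w b \<odot>\<^bsub>PA\<^esub> basis_elt 2 b)"
        using insert subsetD[OF relators_carrier bc] by (intro P.finsum_insert) blast+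
      then show ?case using insert bc submodule.m_closed[OF sub] by simp
    qed
    then have "(\<Oplus>\<^bsub>PA\<^esub>b\<in>basis_paths 2. w b \<odot>\<^bsub>PA\<^esub> basis_elt 2 b) \<in> R" by simp
    moreover have "(\<Oplus>\<^bsub>PA\<^esub>b\<in>basis_paths 2. w b \<odot>\<^bsub>PA\<^esub> basis_elt 2 b) = w"
    proof
      fix q
      have "(\<Oplus>\<^bsub>PA\<^esub>b\<in>basis_paths 2. w b \<odot>\<^bsub>PA\<^esub> basis_elt 2 b) q =
          (\<Sum>b\<in>basis_paths 2. (w b \<odot>\<^bsub>PA\<^esub> basis_elt 2 b) q)"
        using bc relators_carrier by (intro path_finsum) blast
      then show "(\<Oplus>\<^bsub>PA\<^esub>b\<in>basis_paths 2. w b \<odot>\<^bsub>PA\<^esub> basis_elt 2 b) q = w q"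
        using rel_space_expand[OF w, of q] by (simp add: path_alg_sel(6))
    qed
    ultimately show "w \<in> R" by simp
  qed
qed (rule R_rel_space)

section \<open>Determination of the spaces W_p\<close>

abbreviation "W p \<equiv> koszul_W n p :: 'a path_fun set"

text \<open>For \<open>p \<ge> 3\<close> the terms \<open>i = 0\<close> and \<open>i = 1\<close> of
  the intersection lie in \<open>rel_space\<close> and \<open>rel_space'\<close>, which meet in 0.
  For \<open>p = 2\<close> the only term is R with a factor k on either side, and the unit absorbs
  these factors.\<close>

lemma W_eq: "W p = (if p \<le> 1 then PG p else if p = 2 then rel_space n 2 else {\<zero>\<^bsub>PA\<^esub>})"
proof -
  have 1: "W p \<subseteq> rel_space n p" if "2 \<le> p"
  proof -
    have "W p \<subseteq> tensor_prod n (tensor_prod n (PG 0) R) (PG (p - 2))"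
      using that by (auto simp: koszul_W_def)
    also have "\<dots> \<subseteq> rel_space n (2 + (p - 2))" by (rule tensor_rel_space) (rule tensor_PG0_R)
    finally show ?thesis using that by (simp only: le_add_diff_inverse)
  qed
  have 2: "W p \<subseteq> rel_space' n p" if "3 \<le> p"
  proof -
    have "W p \<subseteq> tensor_prod n (tensor_prod n (PG 1) R) (PG (p - 3))"
      using that by (auto simp: koszul_W_def)
    also have "\<dots> \<subseteq> rel_space' n (3 + (p - 3))" by (rule tensor_rel_space') (rule tensor_PG1_R)
    finally show ?thesis using that by (simp only: le_add_diff_inverse)
  qed
  consider "p \<le> 1" | "p = 2" | "3 \<le> p" by linarith
  then show ?thesis
  proof cases
    case 1
    then show ?thesis by (simp add: koszul_W_def)
  next
    case p: 2
    have "rel_space n 2 \<subseteq> W p"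
    proof
      fix w :: "'a path_fun" assume w: "w \<in> rel_space n 2"
      then have wc: "w \<in> carrier PA" by (rule rel_spaceD)
      have one: "\<one>\<^bsub>PA\<^esub> \<in> PG 0"
        using path_one_closed by (auto simp: path_grade_def path_alg_sel(3) split: if_splits)
      have "w \<in> R" using w R_eq_rel_space by simp
      with one have "\<one>\<^bsub>PA\<^esub> \<otimes>\<^bsub>PA\<^esub> w \<in> tensor_prod n (PG 0) R"
        by (intro tensor_prod_single PG_carrier relators_carrier)
      then have "w \<in> tensor_prod n (PG 0) R" using wc by simp
      then have "w \<otimes>\<^bsub>PA\<^esub> \<one>\<^bsub>PA\<^esub> \<in> tensor_prod n (tensor_prod n (PG 0) R) (PG 0)"
        using one by (intro tensor_prod_single PG_carrier tensor_prod_carrier relators_carrier)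
      then show "w \<in> W p" using wc p by (auto simp: koszul_W_def)
    qed
    then show ?thesis using 1 p by auto
  next
    case p: 3
    have "W p \<subseteq> {\<zero>\<^bsub>PA\<^esub>}" using rel_spaces_zero 1 2 p by auto
    moreover have "\<zero>\<^bsub>PA\<^esub> \<in> W p" using p tensor_prod_zero by (auto simp: koszul_W_def)
    ultimately show ?thesis using p by auto
  qed
qed

lemma W_grade: "W p \<subseteq> PG p"
  by (auto simp: W_eq rel_space_def path_grade_zero_mem)

lemma W_carrier: "W p \<subseteq> carrier PA"
  using W_grade PG_carrier by blast

lemma W_add: "x \<in> W p \<Longrightarrow> y \<in> W p \<Longrightarrow> x \<oplus>\<^bsub>PA\<^esub> y \<in> W p"
  by (auto simp: W_eq path_grade_add rel_space_add split: if_splits)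

lemma W_zero: "\<zero>\<^bsub>PA\<^esub> \<in> W p"
  by (auto simp: W_eq path_grade_zero_mem rel_space_zero)

lemma W_sandwich:
  assumes "u \<in> PG 0" "x \<in> W p" "v \<in> PG 0"
  shows "u \<otimes>\<^bsub>PA\<^esub> (x \<otimes>\<^bsub>PA\<^esub> v) \<in> W p"
proof -
  have x: "x \<in> PG p" using assms(2) W_grade by blast
  have g: "u \<otimes>\<^bsub>PA\<^esub> (x \<otimes>\<^bsub>PA\<^esub> v) \<in> PG p"
    using grade_mult[OF assms(1) grade_mult[OF x assms(3)]] by simp
  consider "p \<le> 1" | "p = 2" | "3 \<le> p" by linarith
  then show ?thesis
  proof cases
    case 2
    then have "rel_at n (\<lambda>xs. x (j, xs)) j zs" for j zs using assms(2) by (simp add: W_eq rel_spaceD(2))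
    then have "rel_at n (\<lambda>xs. (u \<otimes>\<^bsub>PA\<^esub> (x \<otimes>\<^bsub>PA\<^esub> v)) (j, xs)) j zs" for j zs
      unfolding grade0_sandwich[OF assms(1,3)] unfolding rel_at_def by auto
    then show ?thesis using 2 g by (simp add: W_eq rel_spaceI)
  next
    case 3
    then have "x = \<zero>\<^bsub>PA\<^esub>" using assms(2) by (simp add: W_eq)
    then have "u \<otimes>\<^bsub>PA\<^esub> (x \<otimes>\<^bsub>PA\<^esub> v) = \<zero>\<^bsub>PA\<^esub>"
      using assms(1,3) by (simp add: path_grade_carrier)
    then show ?thesis using W_zero by simp
  qed (use g in \<open>simp add: W_eq\<close>)
qed

lemma W_expand:
  assumes "w \<in> W p"
  shows "w q = (\<Sum>b\<in>basis_paths p. w b * basis_elt p b q)"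
proof -
  obtain v xs where q: "q = (v, xs)" by (cases q)
  have nz: "w q = 0" if "\<not> (is_path n q \<and> length (snd q) = p)"
    using that assms W_grade[of p] carrierD[OF path_grade_carrier, of w n p q] path_grade_zero[of w n p xs v]
    by (auto simp: q)
  consider "p = 0" | "p = 1" | "p = 2" | "3 \<le> p" by linarith
  then show ?thesis
  proof cases
    case 3
    then show ?thesis using assms rel_space_expand by (simp add: W_eq)
  next
    case 4
    then show ?thesis using assms by (simp add: W_eq basis_paths_def path_alg_sel)
  next
    case 1
    have "(\<Sum>b\<in>basis_paths p. w b * basis_elt p b q) = (if q \<in> basis_paths p then w q else 0)"
      using 1 by (simp add: basis_elt_def path_elt_def if_distrib[of "(*) _"] cong: if_cong)
    moreover have "q \<in> basis_paths p" if "is_path n q" "length (snd q) = p"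
      using that 1 q by (auto simp: basis_paths_def)
    ultimately show ?thesis using nz by auto
  next
    case 2
    have "(\<Sum>b\<in>basis_paths p. w b * basis_elt p b q) = (if q \<in> basis_paths p then w q else 0)"
      using 2 by (simp add: basis_elt_def path_elt_def if_distrib[of "(*) _"] cong: if_cong)
    moreover have "q \<in> basis_paths p" if "is_path n q" "length (snd q) = p"
      using that 2 q by (cases xs) (auto simp: basis_paths_def)
    ultimately show ?thesis using nz by auto
  qed
qed

lemma basis_elt_W:
  assumes "b \<in> basis_paths p"
  shows "basis_elt p b \<in> W p"
proof -
  consider "p \<le> 1" | "p = 2" | "3 \<le> p" by linarith
  then show ?thesis
  proof cases
    case 1
    then show ?thesis using path_elt_grade[OF basis_paths_path(1)[OF assms]] basis_paths_path(2)[OF assms]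
      by (simp add: W_eq basis_elt_def)
  next
    case 2
    then have "fst b < n" using basis_paths_path(3)[OF assms] by simp
    moreover have "\<ominus>\<^bsub>PA\<^esub> (relator n 0) \<in> rel_space n 2"
      using submodule.abelian_subgroup[OF rel_space_submodule] relator_rel_space[of 0] n_ge
      by (intro additive_subgroup.a_inv_closed abelian_subgroup.axioms(1)) auto
    ultimately show ?thesis using 2 relator_rel_space by (simp add: W_eq basis_elt_def)
  next
    case 3
    then show ?thesis using assms by (simp add: basis_paths_def)
  qed
qed

end

section \<open>Cochains in coordinates\<close>

lemma koszul_cochains_sel:
  "f \<in> carrier (koszul_cochains n p) \<longleftrightarrow> f \<in> koszul_W n p \<rightarrow>\<^sub>E carrier (preproj n) \<and>
       (\<forall>x\<in>koszul_W n p. \<forall>y\<in>koszul_W n p.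
          f (x \<oplus>\<^bsub>path_alg n\<^esub> y) = f x \<oplus>\<^bsub>preproj n\<^esub> f y) \<and>
       (\<forall>u\<in>path_grade n 0. \<forall>v\<in>path_grade n 0. \<forall>x\<in>koszul_W n p.
          f (u \<otimes>\<^bsub>path_alg n\<^esub> (x \<otimes>\<^bsub>path_alg n\<^esub> v)) =
          preproj_class n u \<otimes>\<^bsub>preproj n\<^esub> (f x \<otimes>\<^bsub>preproj n\<^esub> preproj_class n v))"
  "\<zero>\<^bsub>koszul_cochains n p\<^esub> = (\<lambda>x\<in>koszul_W n p. \<zero>\<^bsub>preproj n\<^esub>)"
  "f \<oplus>\<^bsub>koszul_cochains n p\<^esub> g = (\<lambda>x\<in>koszul_W n p. f x \<oplus>\<^bsub>preproj n\<^esub> g x)"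
  "c \<odot>\<^bsub>koszul_cochains n p\<^esub> f = (\<lambda>x\<in>koszul_W n p. c \<odot>\<^bsub>preproj n\<^esub> f x)"
  unfolding koszul_cochains_def by simp_all

context typeA
begin

abbreviation "C p \<equiv> koszul_cochains n p :: ('a, 'a cochain) module"

text \<open>\<open>rep p f F\<close> says that \<open>f\<close> is the bimodule map whose value at the basis element with path \<open>b\<close>
  has the coordinate \<open>F b r\<close> in degree \<open>r\<close>. Only the values \<open>F b r\<close> in degrees \<open>r\<close> that are
  admissible for the endpoints of \<open>b\<close> matter.\<close>

definition rep :: "nat \<Rightarrow> 'a cochain \<Rightarrow> (path \<Rightarrow> nat \<Rightarrow> 'a) \<Rightarrow> bool" where
  "rep p f F \<longleftrightarrow> (\<forall>w\<in>W p. f w \<in> carrier A \<and> (\<forall>j i r. coord n (f w) j i r =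
     (if adm n j i r then
        \<Sum>b\<in>basis_paths p. if fst b = j \<and> path_source b = i then w b * F b r else 0
      else 0)))"

definition admp :: "path \<Rightarrow> nat \<Rightarrow> bool" where
  "admp b r \<longleftrightarrow> adm n (fst b) (path_source b) r"

text \<open>Keeps only the values that \<open>rep\<close> determines, so that convolution sums may
  run over all degrees.\<close>

definition mask :: "(path \<Rightarrow> nat \<Rightarrow> 'a) \<Rightarrow> path \<Rightarrow> nat \<Rightarrow> 'a" where
  "mask F b r = (if admp b r then F b r else 0)"

lemma repD:
  assumes "rep p f F" "w \<in> W p"
  shows "f w \<in> carrier A"
    and "coord n (f w) j i r =
      (\<Sum>b\<in>basis_paths p. if fst b = j \<and> path_source b = i then w b * mask F b r else 0)"
proof -
  have "coord n (f w) j i r = (if adm n j i r then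
        \<Sum>b\<in>basis_paths p. if fst b = j \<and> path_source b = i then w b * F b r else 0
      else 0)" using assms by (simp add: rep_def)
  also have "\<dots> = (\<Sum>b\<in>basis_paths p. if fst b = j \<and> path_source b = i then w b * mask F b r else 0)"
  proof (cases "adm n j i r")
    case True
    then show ?thesis by (auto simp: mask_def admp_def intro!: sum.cong)
  next
    case False
    then show ?thesis by (auto simp: mask_def admp_def intro!: sum.neutral[symmetric])
  qed
  finally show "coord n (f w) j i r =
      (\<Sum>b\<in>basis_paths p. if fst b = j \<and> path_source b = i then w b * mask F b r else 0)" .
qed (use assms in \<open>simp add: rep_def\<close>)

lemma repI:
  assumes "\<And>w. w \<in> W p \<Longrightarrow> f w \<in> carrier A"
    "\<And>w j i r. w \<in> W p \<Longrightarrow> adm n j i r \<Longrightarrow> coord n (f w) j i r =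
      (\<Sum>b\<in>basis_paths p. if fst b = j \<and> path_source b = i then w b * F b r else 0)"
  shows "rep p f F"
  using assms by (simp add: rep_def coord_not_adm)

lemma rep_cong:
  assumes "rep p f F" "\<And>w. w \<in> W p \<Longrightarrow> g w = f w"
    "\<And>b r. b \<in> basis_paths p \<Longrightarrow> admp b r \<Longrightarrow> G b r = F b r"
  shows "rep p g G"
proof (rule repI)
  fix w j i r assume w: "w \<in> W p" and a: "adm n j i r"
  show "coord n (g w) j i r = (\<Sum>b\<in>basis_paths p. if fst b = j \<and> path_source b = i then w b * G b r else 0)"
    unfolding repD(2)[OF assms(1) w] assms(2)[OF w]
    by (rule sum.cong) (use a assms(3) in \<open>auto simp: mask_def admp_def\<close>)
next
  fix w assume w: "w \<in> W p"
  show "g w \<in> carrier A" using repD(1)[OF assms(1) w] assms(2)[OF w] by simp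
qed

lemma rep_at_basis:
  assumes "rep p f F" "b \<in> basis_paths p" "admp b r"
  shows "F b r = coord n (f (basis_elt p b)) (fst b) (path_source b) r"
proof -
  have "coord n (f (basis_elt p b)) (fst b) (path_source b) r =
      (\<Sum>c\<in>basis_paths p. if c = b then F b r else 0)"
    unfolding repD(2)[OF assms(1) basis_elt_W[OF assms(2)]]
    by (rule sum.cong) (use assms in \<open>auto simp: basis_elt_dual mask_def\<close>)
  then show ?thesis using assms(2) by simp
qed

text \<open>Evaluation at the dual basis recovers the coordinate function, and
  \<open>coord_inj\<close> gives the converse. All later equations between cochains are reduced to
  coordinates by this equivalence.\<close>

lemma rep_eq_iff:
  assumes "rep p f F" "rep p g G" "f \<in> extensional (W p)" "g \<in> extensional (W p)"
  shows "f = g \<longleftrightarrow> (\<forall>b\<in>basis_paths p. \<forall>r. admp b r \<longrightarrow> F b r = G b r)"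
proof
  assume "\<forall>b\<in>basis_paths p. \<forall>r. admp b r \<longrightarrow> F b r = G b r"
  then have *: "mask F b r = mask G b r" if "b \<in> basis_paths p" for b r
    using that by (simp add: mask_def)
  show "f = g"
  proof (rule extensionalityI[OF assms(3,4)])
    fix w assume w: "w \<in> W p"
    show "f w = g w"
      by (rule coord_inj[OF repD(1)[OF assms(1) w] repD(1)[OF assms(2) w]])
        (auto simp: repD(2)[OF assms(1) w] repD(2)[OF assms(2) w] * intro!: sum.cong)
  qed
qed (use rep_at_basis[OF assms(1)] rep_at_basis[OF assms(2)] in auto)

lemma coord_sandwich:
  assumes "u \<in> PG 0" "v \<in> PG 0" "a \<in> carrier A"
  shows "coord n (cl u \<otimes>\<^bsub>A\<^esub> (a \<otimes>\<^bsub>A\<^esub> cl v)) j i r = u (j, []) * (coord n a j i r * v (i, []))"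
proof -
  obtain g where g: "g \<in> carrier PA" "a = cl g" using assms(3) unfolding A_carrier by auto
  have uv: "u \<in> carrier PA" "v \<in> carrier PA" using assms path_grade_carrier by auto
  have "path_sum n (u \<otimes>\<^bsub>PA\<^esub> (g \<otimes>\<^bsub>PA\<^esub> v)) j i r = u (j, []) * (path_sum n g j i r * v (i, []))"
    unfolding path_sum_def grade0_sandwich[OF assms(1,2)] sum_distrib_left sum_distrib_right
    by (rule sum.cong) (auto simp: paths_def)
  then show ?thesis using g uv by (simp add: cl_mult coord_cl)
qed

lemma path_elt_PG0: "v < n \<Longrightarrow> path_elt (v, []) \<in> PG 0"
  using path_elt_grade[of n "(v, [])"] by simp

lemma PG0_one: "\<one>\<^bsub>PA\<^esub> \<in> PG 0"
  using path_one_closed by (auto simp: path_grade_def path_alg_sel(3) split: if_splits)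

text \<open>The two 2-cycles at a vertex have the same endpoints, so every basis element lies in one
  corner of the path algebra.\<close>

lemma basis_elt_support:
  assumes "b \<in> basis_paths p" "basis_elt p b (j, xs) \<noteq> 0"
  shows "j = fst b" "path_source (j, xs) = path_source b"
proof -
  have "j = fst b \<and> path_source (j, xs) = path_source b"
  proof (cases "p = 2")
    case True
    then obtain v where v: "v < n" "b = (v, cyc v)" using assms(1) by (auto simp: basis_paths_def)
    have "basis_elt 2 (v, cyc v) (j, xs) \<noteq> 0" using assms(2) True v by simp
    then have "(j, xs) = (v, cyc v) \<or> (j, xs) = (v, [Star v, Arr v])"
      unfolding basis_elt_2[OF v(1)] by (auto split: if_splits)
    then show ?thesis using cyc_path[OF v(1)] v(2) by auto
  next
    case False
    then show ?thesis using assms(2) by (auto simp: basis_elt_def path_elt_def split: if_splits)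
  qed
  then show "j = fst b" "path_source (j, xs) = path_source b" by auto
qed

lemma basis_elt_sandwich:
  assumes "b \<in> basis_paths p"
  shows "path_elt (fst b, []) \<otimes>\<^bsub>PA\<^esub> (basis_elt p b \<otimes>\<^bsub>PA\<^esub> path_elt (path_source b, [])) = basis_elt p b"
proof (rule ext, clarify)
  fix j xs
  show "(path_elt (fst b, []) \<otimes>\<^bsub>PA\<^esub> (basis_elt p b \<otimes>\<^bsub>PA\<^esub> path_elt (path_source b, []))) (j, xs) =
      basis_elt p b (j, xs)"
    unfolding grade0_sandwich[OF path_elt_PG0[OF basis_paths_path(3)[OF assms]]
        path_elt_PG0[OF basis_paths_path(4)[OF assms]]]
    using basis_elt_support[OF assms, of j xs] by (auto simp: path_elt_def)
qed

lemma cochainD: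
  assumes "f \<in> carrier (C p)"
  shows "f \<in> extensional (W p)" "w \<in> W p \<Longrightarrow> f w \<in> carrier A"
    "x \<in> W p \<Longrightarrow> y \<in> W p \<Longrightarrow> f (x \<oplus>\<^bsub>PA\<^esub> y) = f x \<oplus>\<^bsub>A\<^esub> f y"
    "u \<in> PG 0 \<Longrightarrow> v \<in> PG 0 \<Longrightarrow> x \<in> W p \<Longrightarrow> f (u \<otimes>\<^bsub>PA\<^esub> (x \<otimes>\<^bsub>PA\<^esub> v)) = cl u \<otimes>\<^bsub>A\<^esub> (f x \<otimes>\<^bsub>A\<^esub> cl v)"
  using assms unfolding koszul_cochains_sel by (auto simp: PiE_def Pi_iff)

lemma W_smult:
  assumes "x \<in> W p"
  shows "c \<odot>\<^bsub>PA\<^esub> x \<in> W p"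
proof -
  have "x \<in> carrier PA" using assms W_carrier by auto
  then have "(c \<odot>\<^bsub>PA\<^esub> \<one>\<^bsub>PA\<^esub>) \<otimes>\<^bsub>PA\<^esub> (x \<otimes>\<^bsub>PA\<^esub> \<one>\<^bsub>PA\<^esub>) = c \<odot>\<^bsub>PA\<^esub> x"
    by (simp add: path_smult_mult)
  then show ?thesis
    using W_sandwich[OF path_grade_smult[OF PG0_one, of c] assms PG0_one] by simp
qed

text \<open>Cochains are additive and compatible with k; linearity over the field follows because
  \<open>c\<close> acts as the element \<open>c\<close> times the unit, which lies in k.\<close>

lemma coord_cochain_smult:
  assumes "f \<in> carrier (C p)" "x \<in> W p"
  shows "coord n (f (c \<odot>\<^bsub>PA\<^esub> x)) j i r = c * coord n (f x) j i r"
proof (cases "adm n j i r")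
  case True
  then have "j < n" "i < n" using adm_bounds n_ge by auto
  have "x \<in> carrier PA" using assms(2) W_carrier by auto
  then have "c \<odot>\<^bsub>PA\<^esub> x = (c \<odot>\<^bsub>PA\<^esub> \<one>\<^bsub>PA\<^esub>) \<otimes>\<^bsub>PA\<^esub> (x \<otimes>\<^bsub>PA\<^esub> \<one>\<^bsub>PA\<^esub>)"
    by (simp add: path_smult_mult)
  then have "f (c \<odot>\<^bsub>PA\<^esub> x) = cl (c \<odot>\<^bsub>PA\<^esub> \<one>\<^bsub>PA\<^esub>) \<otimes>\<^bsub>A\<^esub> (f x \<otimes>\<^bsub>A\<^esub> cl \<one>\<^bsub>PA\<^esub>)"
    using cochainD(4)[OF assms(1) path_grade_smult[OF PG0_one] PG0_one assms(2)] by simp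
  then show ?thesis
    using coord_sandwich[OF path_grade_smult[OF PG0_one, of c] PG0_one cochainD(2)[OF assms], of j i r]
      \<open>j < n\<close> \<open>i < n\<close> by (simp add: path_alg_sel(3,6))
qed (simp add: coord_not_adm)

text \<open>Additivity and linearity reduce \<open>f\<close> to its values on the basis, and each
  value lies in a corner e_j A e_i, where one scalar per degree describes it.\<close>

lemma rep_cochain:
  assumes "f \<in> carrier (C p)"
  shows "rep p f (\<lambda>b r. coord n (f (basis_elt p b)) (fst b) (path_source b) r)"
proof (rule repI)
  show "f w \<in> carrier A" if "w \<in> W p" for w using cochainD(2)[OF assms that] .
  fix w j i r assume w: "w \<in> W p" and a: "adm n j i r"
  have bc: "w b \<odot>\<^bsub>PA\<^esub> basis_elt p b \<in> W p" if "b \<in> basis_paths p" for b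
    by (rule W_smult) (rule basis_elt_W[OF that])
  have f0: "coord n (f \<zero>\<^bsub>PA\<^esub>) j i r = 0"
    using cochainD(3)[OF assms W_zero W_zero] cochainD(2)[OF assms W_zero]
    by (simp add: coord_zero)
  have "(\<Oplus>\<^bsub>PA\<^esub>b\<in>S. w b \<odot>\<^bsub>PA\<^esub> basis_elt p b) \<in> W p \<and>
      coord n (f (\<Oplus>\<^bsub>PA\<^esub>b\<in>S. w b \<odot>\<^bsub>PA\<^esub> basis_elt p b)) j i r = (\<Sum>b\<in>S. w b * coord n (f (basis_elt p b)) j i r)"
    if "finite S" "S \<subseteq> basis_paths p" for S
    using that
  proof (induction S)
    case empty
    then show ?case using f0 by (simp add: W_zero)
  next
    case (insert b S)
    have "(\<Oplus>\<^bsub>PA\<^esub>b\<in>insert b S. w b \<odot>\<^bsub>PA\<^esub> basis_elt p b) =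
        w b \<odot>\<^bsub>PA\<^esub> basis_elt p b \<oplus>\<^bsub>PA\<^esub> (\<Oplus>\<^bsub>PA\<^esub>b\<in>S. w b \<odot>\<^bsub>PA\<^esub> basis_elt p b)"
      using insert subsetD[OF W_carrier bc] by (intro P.finsum_insert) blast+
    then show ?case
      using insert bc[of b] basis_elt_W[of b p] W_add
      by (simp add: cochainD(3)[OF assms] coord_add cochainD(2)[OF assms] coord_cochain_smult[OF assms])
  qed
  from this[of "basis_paths p"]
  have 1: "coord n (f (\<Oplus>\<^bsub>PA\<^esub>b\<in>basis_paths p. w b \<odot>\<^bsub>PA\<^esub> basis_elt p b)) j i r =
      (\<Sum>b\<in>basis_paths p. w b * coord n (f (basis_elt p b)) j i r)" by simp
  have 2: "(\<Oplus>\<^bsub>PA\<^esub>b\<in>basis_paths p. w b \<odot>\<^bsub>PA\<^esub> basis_elt p b) = w"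
  proof
    fix q
    have "(\<Oplus>\<^bsub>PA\<^esub>b\<in>basis_paths p. w b \<odot>\<^bsub>PA\<^esub> basis_elt p b) q =
        (\<Sum>b\<in>basis_paths p. (w b \<odot>\<^bsub>PA\<^esub> basis_elt p b) q)"
      using bc W_carrier by (intro path_finsum) blast
    then show "(\<Oplus>\<^bsub>PA\<^esub>b\<in>basis_paths p. w b \<odot>\<^bsub>PA\<^esub> basis_elt p b) q = w q"
      using W_expand[OF w, of q] by (simp add: path_alg_sel(6))
  qed
  \<comment> \<open>The basis element is fixed by the idempotents at its two ends, so
    \<open>f\<close> maps it into the corner they cut out.\<close>
  have 3: "coord n (f (basis_elt p b)) j i r = (if fst b = j \<and> path_source b = i then coord n (f (basis_elt p b)) j i r else 0)"
    if b: "b \<in> basis_paths p" for b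
  proof -
    note PG = path_elt_PG0[OF basis_paths_path(3)[OF b]] path_elt_PG0[OF basis_paths_path(4)[OF b]]
    have "f (basis_elt p b) = cl (path_elt (fst b, [])) \<otimes>\<^bsub>A\<^esub> (f (basis_elt p b) \<otimes>\<^bsub>A\<^esub> cl (path_elt (path_source b, [])))"
      using cochainD(4)[OF assms PG basis_elt_W[OF b]] basis_elt_sandwich[OF b] by simp
    then show ?thesis
      using coord_sandwich[OF PG cochainD(2)[OF assms basis_elt_W[OF b]], of j i r]
      by (auto simp: path_elt_def)
  qed
  show "coord n (f w) j i r = (\<Sum>b\<in>basis_paths p. if fst b = j \<and> path_source b = i
      then w b * coord n (f (basis_elt p b)) (fst b) (path_source b) r else 0)"
    using 1 unfolding 2
  proof (elim ssubst, intro sum.cong refl)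
    fix b assume b: "b \<in> basis_paths p"
    show "w b * coord n (f (basis_elt p b)) j i r = (if fst b = j \<and> path_source b = i
        then w b * coord n (f (basis_elt p b)) (fst b) (path_source b) r else 0)"
      by (subst 3[OF b]) auto
  qed
qed

lemma rep_exists:
  assumes "f \<in> carrier (C p)"
  obtains F where "rep p f F"
  using rep_cochain[OF assms] by blast

lemma rep_imp_cochain:
  assumes "rep p f F" "f \<in> extensional (W p)"
  shows "f \<in> carrier (C p)"
proof -
  note f = repD[OF assms(1)]
  have "f (x \<oplus>\<^bsub>PA\<^esub> y) = f x \<oplus>\<^bsub>A\<^esub> f y" if x: "x \<in> W p" and y: "y \<in> W p" for x y
  proof (rule coord_inj[OF f(1)[OF W_add[OF x y]] A.a_closed[OF f(1)[OF x] f(1)[OF y]]])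
    fix j i r
    show "coord n (f (x \<oplus>\<^bsub>PA\<^esub> y)) j i r = coord n (f x \<oplus>\<^bsub>A\<^esub> f y) j i r"
      unfolding coord_add[OF f(1)[OF x] f(1)[OF y]] f(2)[OF x] f(2)[OF y] f(2)[OF W_add[OF x y]] sum.distrib[symmetric]
      by (rule sum.cong) (auto simp: path_alg_sel(5) algebra_simps)
  qed
  moreover have "f (u \<otimes>\<^bsub>PA\<^esub> (x \<otimes>\<^bsub>PA\<^esub> v)) = cl u \<otimes>\<^bsub>A\<^esub> (f x \<otimes>\<^bsub>A\<^esub> cl v)"
    if u: "u \<in> PG 0" and v: "v \<in> PG 0" and x: "x \<in> W p" for u v x
  proof -
    have "cl u \<in> carrier A" "cl v \<in> carrier A"
      using path_grade_carrier[OF u] path_grade_carrier[OF v] by auto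
    then have c: "cl u \<otimes>\<^bsub>A\<^esub> (f x \<otimes>\<^bsub>A\<^esub> cl v) \<in> carrier A" using f(1)[OF x] by simp
    show ?thesis
    proof (rule coord_inj[OF f(1)[OF W_sandwich[OF u x v]] c])
      fix j i r
      show "coord n (f (u \<otimes>\<^bsub>PA\<^esub> (x \<otimes>\<^bsub>PA\<^esub> v))) j i r = coord n (cl u \<otimes>\<^bsub>A\<^esub> (f x \<otimes>\<^bsub>A\<^esub> cl v)) j i r"
        unfolding coord_sandwich[OF u v f(1)[OF x]] f(2)[OF x] f(2)[OF W_sandwich[OF u x v]]
          sum_distrib_left sum_distrib_right
      proof (rule sum.cong[OF refl])
        fix b :: path
        obtain k xs where b: "b = (k, xs)" by (cases b)
        show "(if fst b = j \<and> path_source b = i then (u \<otimes>\<^bsub>PA\<^esub> (x \<otimes>\<^bsub>PA\<^esub> v)) b * mask F b r else 0) =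
            u (j, []) * ((if fst b = j \<and> path_source b = i then x b * mask F b r else 0) * v (i, []))"
          unfolding b grade0_sandwich[OF u v] by auto
      qed
    qed
  qed
  ultimately show ?thesis
    unfolding koszul_cochains_sel using assms(2) f(1) by (auto simp: PiE_def)
qed

text \<open>The values are chosen independently for each \<open>w\<close> by
  \<open>coord_ex\<close>. They still form a bimodule map, because their coordinates depend linearly
  on \<open>w\<close> and determine the values.\<close>

lemma rep_ex:
  fixes F :: "path \<Rightarrow> nat \<Rightarrow> 'a"
  obtains f where "f \<in> carrier (C p)" "rep p f F"
proof -
  let ?G = "\<lambda>w j i r. \<Sum>b\<in>basis_paths p. if fst b = j \<and> path_source b = i then w b * F b r else 0"
  let ?Q = "\<lambda>w a. a \<in> carrier A \<and> (\<forall>j i r. coord n a j i r = (if adm n j i r then ?G w j i r else 0))"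
  have ex: "\<exists>a. ?Q w a" for w :: "'a path_fun"
  proof -
    obtain f where "f \<in> carrier PA" "\<forall>j i r. coord n (cl f) j i r = (if adm n j i r then ?G w j i r else 0)"
      using coord_ex[of "?G w"] by (elim bexE conjE)
    then show ?thesis by (intro exI[of _ "cl f"] conjI cl_closed)
  qed
  define g where "g w = (SOME a. ?Q w a)" for w :: "'a path_fun"
  have g: "?Q w (g w)" for w unfolding g_def by (rule someI_ex[OF ex])
  have "rep p (restrict g (W p)) F" unfolding rep_def
  proof
    fix w assume "w \<in> W p"
    from restrict_apply'[OF this] show "?Q w (restrict g (W p) w)" by (rule ssubst) (rule g)
  qed
  then show ?thesis by (intro that[OF rep_imp_cochain]) auto
qed

lemma rep_lincomb:
  assumes "rep p f F" "rep p g G"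
  shows "rep p (\<lambda>w\<in>W p. f w \<oplus>\<^bsub>A\<^esub> c \<odot>\<^bsub>A\<^esub> g w) (\<lambda>b r. F b r + c * G b r)"
proof (rule repI)
  fix w assume w: "w \<in> W p"
  have g: "c \<odot>\<^bsub>A\<^esub> g w \<in> carrier A"
    using Module.module.smult_closed[OF A_module] repD(1)[OF assms(2) w] by simp
  then show "(\<lambda>w\<in>W p. f w \<oplus>\<^bsub>A\<^esub> c \<odot>\<^bsub>A\<^esub> g w) w \<in> carrier A" using w repD(1)[OF assms(1) w] by simp
  fix j i r assume a: "adm n j i r"
  have "coord n (f w \<oplus>\<^bsub>A\<^esub> c \<odot>\<^bsub>A\<^esub> g w) j i r = coord n (f w) j i r + c * coord n (g w) j i r"
    using coord_add[OF repD(1)[OF assms(1) w] g] coord_smult[OF repD(1)[OF assms(2) w]] by simp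
  also have "\<dots> = (\<Sum>b\<in>basis_paths p. if fst b = j \<and> path_source b = i then w b * (F b r + c * G b r) else 0)"
    unfolding repD(2)[OF assms(1) w] repD(2)[OF assms(2) w] sum_distrib_left sum.distrib[symmetric]
    by (rule sum.cong) (use a in \<open>auto simp: mask_def admp_def algebra_simps\<close>)
  finally show "coord n ((\<lambda>w\<in>W p. f w \<oplus>\<^bsub>A\<^esub> c \<odot>\<^bsub>A\<^esub> g w) w) j i r =
      (\<Sum>b\<in>basis_paths p. if fst b = j \<and> path_source b = i then w b * (F b r + c * G b r) else 0)"
    using w by simp
qed

lemma rep_zero: "rep p \<zero>\<^bsub>C p\<^esub> (\<lambda>b r. 0)"
  by (rule repI) (auto simp: koszul_cochains_sel coord_zero)

lemma rep_add:
  assumes "rep p f F" "rep p g G"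
  shows "rep p (f \<oplus>\<^bsub>C p\<^esub> g) (\<lambda>b r. F b r + G b r)"
  by (rule rep_cong[OF rep_lincomb[OF assms, of 1]])
    (auto simp: koszul_cochains_sel Module.module.smult_one[OF A_module, simplified] repD(1)[OF assms(2)])

lemma rep_smult:
  assumes "rep p f F"
  shows "rep p (c \<odot>\<^bsub>C p\<^esub> f) (\<lambda>b r. c * F b r)"
  by (rule rep_cong[OF rep_lincomb[OF rep_zero assms, of c]])
    (use Module.module.smult_closed[OF A_module] repD(1)[OF assms] in \<open>auto simp: koszul_cochains_sel\<close>)

section \<open>The vector spaces of cochains\<close>

lemma C_ext: "f \<oplus>\<^bsub>C p\<^esub> g \<in> extensional (W p)" "c \<odot>\<^bsub>C p\<^esub> f \<in> extensional (W p)" "\<zero>\<^bsub>C p\<^esub> \<in> extensional (W p)"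
  by (simp_all add: koszul_cochains_sel)

lemma C_add_closed: "f \<in> carrier (C p) \<Longrightarrow> g \<in> carrier (C p) \<Longrightarrow> f \<oplus>\<^bsub>C p\<^esub> g \<in> carrier (C p)"
  by (rule rep_imp_cochain[OF rep_add[OF rep_cochain rep_cochain] C_ext(1)])

lemma C_smult_closed: "f \<in> carrier (C p) \<Longrightarrow> c \<odot>\<^bsub>C p\<^esub> f \<in> carrier (C p)"
  by (rule rep_imp_cochain[OF rep_smult[OF rep_cochain] C_ext(2)])

lemma C_zero_closed: "\<zero>\<^bsub>C p\<^esub> \<in> carrier (C p)"
  by (rule rep_imp_cochain[OF rep_zero C_ext(3)])

lemma C_eqI:
  assumes "f \<in> extensional (W p)" "g \<in> extensional (W p)" "\<And>w. w \<in> W p \<Longrightarrow> f w = g w"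
  shows "f = g"
  using assms by (rule extensionalityI)

lemma C_app:
  assumes "w \<in> W p"
  shows "(f \<oplus>\<^bsub>C p\<^esub> g) w = f w \<oplus>\<^bsub>A\<^esub> g w" "(c \<odot>\<^bsub>C p\<^esub> f) w = c \<odot>\<^bsub>A\<^esub> f w" "\<zero>\<^bsub>C p\<^esub> w = \<zero>\<^bsub>A\<^esub>"
  using assms by (simp_all add: koszul_cochains_sel)

lemma C_module: "Module.module class_ring (C p)"
proof (rule module_criteria)
  interpret M: Module.module class_ring A by (rule A_module)
  note d_coord = cochainD(2)[where p = p]
  note M = M.smult_assoc1[simplified] M.smult_one[simplified] M.smult_l_distr[simplified] M.smult_r_distr[simplified]
  show "cring (class_ring :: 'a ring)" by (rule class_cring.cring_axioms)
  show "\<zero>\<^bsub>C p\<^esub> \<in> carrier (C p)" by (rule C_zero_closed)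
  show "\<forall>v w. v \<in> carrier (C p) \<and> w \<in> carrier (C p) \<longrightarrow> v \<oplus>\<^bsub>C p\<^esub> w \<in> carrier (C p)"
    using C_add_closed by blast
  show "\<forall>c v. c \<in> carrier class_ring \<and> v \<in> carrier (C p) \<longrightarrow> c \<odot>\<^bsub>C p\<^esub> v \<in> carrier (C p)"
    using C_smult_closed by blast
  show "\<forall>v\<in>carrier (C p). \<exists>w\<in>carrier (C p). v \<oplus>\<^bsub>C p\<^esub> w = \<zero>\<^bsub>C p\<^esub>"
  proof
    fix v assume v: "v \<in> carrier (C p)"
    obtain F where F: "rep p v F" using v by (rule rep_exists)
    have "v \<oplus>\<^bsub>C p\<^esub> ((-1) \<odot>\<^bsub>C p\<^esub> v) = \<zero>\<^bsub>C p\<^esub>"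
      unfolding rep_eq_iff[OF rep_add[OF F rep_smult[OF F]] rep_zero C_ext(1) C_ext(3)] by simp
    then show "\<exists>w\<in>carrier (C p). v \<oplus>\<^bsub>C p\<^esub> w = \<zero>\<^bsub>C p\<^esub>" using C_smult_closed[OF v] by blast
  qed
  show "\<forall>v w. v \<in> carrier (C p) \<and> w \<in> carrier (C p) \<longrightarrow> v \<oplus>\<^bsub>C p\<^esub> w = w \<oplus>\<^bsub>C p\<^esub> v"
    by (intro allI impI ballI C_eqI[of _ p] C_ext, (elim conjE)?) (auto simp: C_app cochainD(1) d_coord A.a_comm intro: cochainD(1))
  show "\<forall>v w x. v \<in> carrier (C p) \<and> w \<in> carrier (C p) \<and> x \<in> carrier (C p) \<longrightarrow>
      v \<oplus>\<^bsub>C p\<^esub> w \<oplus>\<^bsub>C p\<^esub> x = v \<oplus>\<^bsub>C p\<^esub> (w \<oplus>\<^bsub>C p\<^esub> x)"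
    by (intro allI impI ballI C_eqI[of _ p] C_ext, (elim conjE)?) (auto simp: C_app cochainD(1) d_coord M A.a_assoc intro: cochainD(1))
  show "\<forall>v\<in>carrier (C p). v \<oplus>\<^bsub>C p\<^esub> \<zero>\<^bsub>C p\<^esub> = v"
    by (intro allI impI ballI C_eqI[of _ p] C_ext, (elim conjE)?) (auto simp: C_app cochainD(1) d_coord M A.a_assoc intro: cochainD(1))
  show "\<forall>a b v. a \<in> carrier class_ring \<and> b \<in> carrier class_ring \<and> v \<in> carrier (C p) \<longrightarrow>
      (a \<otimes>\<^bsub>class_ring\<^esub> b) \<odot>\<^bsub>C p\<^esub> v = a \<odot>\<^bsub>C p\<^esub> (b \<odot>\<^bsub>C p\<^esub> v)"
    by (intro allI impI ballI C_eqI[of _ p] C_ext, (elim conjE)?) (auto simp: C_app cochainD(1) d_coord M A.a_assoc intro: cochainD(1))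
  show "\<forall>v\<in>carrier (C p). \<one>\<^bsub>class_ring\<^esub> \<odot>\<^bsub>C p\<^esub> v = v"
    by (intro allI impI ballI C_eqI[of _ p] C_ext, (elim conjE)?) (auto simp: C_app cochainD(1) d_coord M A.a_assoc intro: cochainD(1))
  show "\<forall>a b v. a \<in> carrier class_ring \<and> b \<in> carrier class_ring \<and> v \<in> carrier (C p) \<longrightarrow>
      (a \<oplus>\<^bsub>class_ring\<^esub> b) \<odot>\<^bsub>C p\<^esub> v = a \<odot>\<^bsub>C p\<^esub> v \<oplus>\<^bsub>C p\<^esub> b \<odot>\<^bsub>C p\<^esub> v"
    by (intro allI impI ballI C_eqI[of _ p] C_ext, (elim conjE)?) (auto simp: C_app cochainD(1) d_coord M A.a_assoc intro: cochainD(1))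
  show "\<forall>a v w. a \<in> carrier class_ring \<and> v \<in> carrier (C p) \<and> w \<in> carrier (C p) \<longrightarrow>
      a \<odot>\<^bsub>C p\<^esub> (v \<oplus>\<^bsub>C p\<^esub> w) = a \<odot>\<^bsub>C p\<^esub> v \<oplus>\<^bsub>C p\<^esub> a \<odot>\<^bsub>C p\<^esub> w"
    by (intro allI impI ballI C_eqI[of _ p] C_ext, (elim conjE)?) (auto simp: C_app cochainD(1) d_coord M A.a_assoc intro: cochainD(1))
qed

text \<open>The basis paths of W_1 are exactly the paths of length 1, so the path sums of
  \<open>w\<close> are sums of its coefficients at basis paths.\<close>

lemma rep_class: "rep 1 cl (\<lambda>b r. if r = 1 then 1 else 0)"
proof (rule repI)
  fix w assume "w \<in> W 1"
  then have w: "w \<in> PG 1" by (simp add: W_eq)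
  then have wc: "w \<in> carrier PA" by (rule path_grade_carrier)
  then show "cl w \<in> carrier A" by simp
  fix j i r assume a: "adm n j i r"
  have "coord n (cl w) j i r = path_sum n w j i r" using wc a by (simp add: coord_cl)
  also have "\<dots> = (\<Sum>b\<in>basis_paths 1. if fst b = j \<and> path_source b = i then w b * (if r = 1 then 1 else 0) else 0)"
  proof (cases "r = 1")
    case True
    have "(\<Sum>b\<in>basis_paths 1. if fst b = j \<and> path_source b = i then w b * (if r = 1 then 1 else 0) else 0) =
        (\<Sum>b\<in>{b \<in> basis_paths 1. fst b = j \<and> path_source b = i}. w b)"
      using True by (simp add: sum.inter_filter cong: if_cong)
    also have "{b \<in> basis_paths 1. fst b = j \<and> path_source b = i} = Pair j ` paths n j i 1"
    proof (intro equalityI subsetI)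
      fix b assume "b \<in> {b \<in> basis_paths 1. fst b = j \<and> path_source b = i}"
      then show "b \<in> Pair j ` paths n j i 1"
        using basis_paths_path(1,2)[of b 1] by (cases b) (simp add: paths_def)
    next
      fix b assume "b \<in> Pair j ` paths n j i 1"
      then obtain xs where xs: "b = (j, xs)" "xs \<in> paths n j i 1" by blast
      then have "length xs = 1" "is_path n (j, xs)" "path_source (j, xs) = i" by (simp_all add: paths_def)
      moreover from this obtain x where "xs = [x]" by (cases xs) auto
      ultimately show "b \<in> {b \<in> basis_paths 1. fst b = j \<and> path_source b = i}"
        using xs(1) by (auto simp: basis_paths_def)
    qed
    also have "(\<Sum>b\<in>Pair j ` paths n j i 1. w b) = path_sum n w j i r"
      using True by (simp add: path_sum_def sum.reindex inj_on_def)
    finally show ?thesis by simp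
  next
    case False
    have "path_sum n w j i r = 0"
      unfolding path_sum_def
    proof (intro sum.neutral ballI)
      fix xs assume "xs \<in> paths n j i r"
      then have "length xs \<noteq> 1" using False by (simp add: paths_def)
      then show "w (j, xs) = 0" by (rule path_grade_zero[OF w])
    qed
    moreover have "(\<Sum>b\<in>basis_paths 1. if fst b = j \<and> path_source b = i then w b * (if r = 1 then 1 else 0) else 0) = 0"
      using False by (intro sum.neutral) simp
    ultimately show ?thesis by simp
  qed
  finally show "coord n (cl w) j i r =
      (\<Sum>b\<in>basis_paths 1. if fst b = j \<and> path_source b = i then w b * (if r = 1 then 1 else 0) else 0)" .
qed

end

section \<open>Splitting tensors and multiplying cochains\<close>

lemma sum_swap3:
  "(\<Sum>h\<in>H. \<Sum>b\<in>B. \<Sum>c\<in>C. X h b c) = (\<Sum>b\<in>B. \<Sum>c\<in>C. \<Sum>h\<in>H. X h b c)"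
proof -
  have "(\<Sum>h\<in>H. \<Sum>b\<in>B. \<Sum>c\<in>C. X h b c) = (\<Sum>b\<in>B. \<Sum>h\<in>H. \<Sum>c\<in>C. X h b c)" by (rule sum.swap)
  also have "\<dots> = (\<Sum>b\<in>B. \<Sum>c\<in>C. \<Sum>h\<in>H. X h b c)" by (intro sum.cong refl sum.swap)
  finally show ?thesis .
qed

context typeA
begin

declare One_nat_def [simp del]

text \<open>Group the terms of \<open>w\<close> by their leftmost arrow \<open>a\<close>; then
  \<open>y a\<close> collects what remains after \<open>a\<close> is removed.\<close>

lemma tensor_prod_arrows:
  assumes "w \<in> PG 2"
  shows "w \<in> tensor_prod n (PG 1) (PG 1)"
proof -
  \<comment> \<open>The summands in \<open>tensor_prod\<close> are indexed by an initial segment of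
    the natural numbers, hence an enumeration of the arrows.\<close>
  obtain h where h: "bij_betw h {..<card (arrows n)} (arrows n)"
    using ex_bij_betw_nat_finite[OF finite_arrows] by (auto simp: atLeast0LessThan)
  define x :: "arrow \<Rightarrow> 'a path_fun" where "x a = path_elt (target a, [a])" for a
  define y :: "arrow \<Rightarrow> 'a path_fun" where
    "y a = (\<lambda>(v, xs). if v = source a \<and> length xs = 1 then w (target a, a # xs) else 0)" for a
  have wc: "is_path n p" if "w p \<noteq> 0" for p
    using that assms path_grade_carrier carrierD by blast
  have x: "x a \<in> PG 1" if "a \<in> arrows n" for a
    using that path_elt_grade[of n "(target a, [a])"] by (simp add: x_def arrows_bounds One_nat_def)
  have yc: "is_path n p \<and> length (snd p) = 1" if "y a p \<noteq> 0" for a p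
    using that wc[of "(target a, a # snd p)"] by (cases p) (auto simp: y_def split: if_splits)
  have y: "y a \<in> PG 1" if "a \<in> arrows n" for a
  proof -
    have "{p. y a p \<noteq> 0} \<subseteq> (\<lambda>b. (target b, [b])) ` arrows n"
    proof
      fix p assume "p \<in> {p. y a p \<noteq> 0}"
      then have p: "is_path n p" "length (snd p) = 1" using yc by auto
      then obtain b where "snd p = [b]" by (cases "snd p") auto
      then show "p \<in> (\<lambda>b. (target b, [b])) ` arrows n" using p by (cases p) auto
    qed
    then have "y a \<in> carrier PA" by (rule path_carrierI) (use yc in auto)
    then show ?thesis using yc by (auto simp: path_grade_def)
  qed
  have ha: "h i \<in> arrows n" if "i < card (arrows n)" for i using h that by (auto simp: bij_betw_def)
  have "w = (\<Oplus>\<^bsub>PA\<^esub>i\<in>{..<card (arrows n)}. x (h i) \<otimes>\<^bsub>PA\<^esub> y (h i))"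
  proof (rule ext, clarify)
    fix v xs
    have "(\<Oplus>\<^bsub>PA\<^esub>i\<in>{..<card (arrows n)}. x (h i) \<otimes>\<^bsub>PA\<^esub> y (h i)) (v, xs) =
        (\<Sum>i<card (arrows n). (x (h i) \<otimes>\<^bsub>PA\<^esub> y (h i)) (v, xs))"
      using x y ha by (intro path_finsum path_mult_closed path_grade_carrier) auto
    also have "\<dots> = (\<Sum>a\<in>arrows n. (x a \<otimes>\<^bsub>PA\<^esub> y a) (v, xs))"
      by (rule sum.reindex_bij_betw[OF h])
    also have "\<dots> = w (v, xs)"
    proof (cases "is_path n (v, xs) \<and> length xs = 2")
      case True
      then obtain a b where xs: "xs = [a, b]"
        by (metis (no_types, opaque_lifting) One_nat_def Suc_1 length_0_conv length_Suc_conv)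
      then have a: "a \<in> arrows n" "v = target a" using True by auto
      have "(\<Sum>c\<in>arrows n. (x c \<otimes>\<^bsub>PA\<^esub> y c) (v, xs)) = (\<Sum>c\<in>arrows n. if c = a then w (v, xs) else 0)"
      proof (rule sum.cong[OF refl])
        fix c assume c: "c \<in> arrows n"
        have "(x c \<otimes>\<^bsub>PA\<^esub> y c) (v, xs) = x c (v, [a]) * y c (source a, [b])"
          unfolding grade_mult_left[OF x[OF c]] xs by (simp add: One_nat_def)
        then show "(x c \<otimes>\<^bsub>PA\<^esub> y c) (v, xs) = (if c = a then w (v, xs) else 0)"
          using a xs by (simp add: x_def y_def path_elt_def)
      qed
      then show ?thesis using a by simp
    next
      case False
      have "(x c \<otimes>\<^bsub>PA\<^esub> y c) (v, xs) = 0" if c: "c \<in> arrows n" for c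
        using grade_mult[OF x[OF c] y[OF c]] False path_grade_zero carrierD[OF path_grade_carrier]
        by (metis one_add_one)
      moreover have "w (v, xs) = 0" using False wc path_grade_zero[OF assms] by metis
      ultimately show ?thesis by simp
    qed
    finally show "w (v, xs) = (\<Oplus>\<^bsub>PA\<^esub>i\<in>{..<card (arrows n)}. x (h i) \<otimes>\<^bsub>PA\<^esub> y (h i)) (v, xs)" ..
  qed
  then show ?thesis unfolding tensor_prod_def using x y ha
    by (intro CollectI exI[of _ "card (arrows n)"] exI[of _ "x \<circ> h"] exI[of _ "y \<circ> h"]) auto
qed

text \<open>Supplies the decompositions that \<open>split_apply\<close> quantifies over. Only
  \<open>p = q = 1\<close> has content: a factor of degree 0 is supplied by the unit, and in total
  degree 3 and above the space is 0.\<close>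

lemma W_tensor:
  assumes "w \<in> W (p + q)"
  shows "w \<in> tensor_prod n (W p) (W q)"
proof -
  have wc: "w \<in> carrier PA" using assms W_carrier by auto
  consider "p = 0" | "q = 0" | "p = 1" "q = 1" | "3 \<le> p + q" by linarith
  then show ?thesis
  proof cases
    case 1
    then have "\<one>\<^bsub>PA\<^esub> \<otimes>\<^bsub>PA\<^esub> w \<in> tensor_prod n (W p) (W q)"
      using assms PG0_one by (intro tensor_prod_single W_carrier) (simp_all add: W_eq)
    then show ?thesis using wc by simp
  next
    case 2
    then have "w \<otimes>\<^bsub>PA\<^esub> \<one>\<^bsub>PA\<^esub> \<in> tensor_prod n (W p) (W q)"
      using assms PG0_one by (intro tensor_prod_single W_carrier) (simp_all add: W_eq)
    then show ?thesis using wc by simp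
  next
    case 3
    then have "w \<in> PG 2" using assms W_grade[of "p + q"] by (auto simp: numeral_2_eq_2)
    then show ?thesis using tensor_prod_arrows 3 by (simp add: W_eq)
  next
    case 4
    then have "w = \<zero>\<^bsub>PA\<^esub>" using assms by (simp add: W_eq)
    then show ?thesis using tensor_prod_zero by simp
  qed
qed

text \<open>Cauchy product in the path length of the coordinates at \<open>b\<close> and at
  \<open>c\<close>.\<close>

definition conv :: "(path \<Rightarrow> nat \<Rightarrow> 'a) \<Rightarrow> (path \<Rightarrow> nat \<Rightarrow> 'a) \<Rightarrow> path \<Rightarrow> path \<Rightarrow> nat \<Rightarrow> 'a" where
  "conv F G b c r = (\<Sum>s\<le>r. mask F b s * mask G c (r - s))"

lemma coord_rep_mult:
  assumes "rep p f F" "rep q g G" "x \<in> W p" "y \<in> W q" "adm n j i r"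
  shows "coord n (f x \<otimes>\<^bsub>A\<^esub> g y) j i r = (\<Sum>b\<in>basis_paths p. \<Sum>c\<in>basis_paths q.
    if fst b = j \<and> path_source b = fst c \<and> path_source c = i then x b * y c * conv F G b c r else 0)"
proof -
  let ?Q = "\<lambda>b c. fst b = j \<and> path_source b = fst c \<and> path_source c = i"
  let ?X = "\<lambda>h s b c. if fst b = j \<and> path_source b = h \<and> fst c = h \<and> path_source c = i
      then x b * mask F b s * (y c * mask G c (r - s)) else 0"
  have "coord n (f x \<otimes>\<^bsub>A\<^esub> g y) j i r = (\<Sum>h<n. \<Sum>s\<le>r. coord n (f x) j h s * coord n (g y) h i (r - s))"
    using coord_mult[OF repD(1)[OF assms(1,3)] repD(1)[OF assms(2,4)]] assms(5) by simp
  also have "\<dots> = (\<Sum>h<n. \<Sum>s\<le>r. \<Sum>b\<in>basis_paths p. \<Sum>c\<in>basis_paths q. ?X h s b c)"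
    unfolding repD(2)[OF assms(1,3)] repD(2)[OF assms(2,4)] sum_product
    by (intro sum.cong refl) auto
  also have "\<dots> = (\<Sum>h<n. \<Sum>b\<in>basis_paths p. \<Sum>c\<in>basis_paths q. \<Sum>s\<le>r. ?X h s b c)"
    by (intro sum.cong refl sum_swap3)
  also have "\<dots> = (\<Sum>b\<in>basis_paths p. \<Sum>c\<in>basis_paths q. \<Sum>h<n. \<Sum>s\<le>r. ?X h s b c)"
    by (rule sum_swap3)
  also have "\<dots> = (\<Sum>b\<in>basis_paths p. \<Sum>c\<in>basis_paths q. if ?Q b c then x b * y c * conv F G b c r else 0)"
  proof (intro sum.cong refl)
    fix b c assume b: "b \<in> basis_paths p"
    \<comment> \<open>The source of \<open>b\<close> is the only possible middle vertex.\<close>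
    have "(\<Sum>h<n. \<Sum>s\<le>r. ?X h s b c) =
        (\<Sum>h<n. if h = path_source b then if ?Q b c then x b * y c * conv F G b c r else 0 else 0)"
      unfolding conv_def sum_distrib_left by (intro sum.cong refl) (auto simp: ac_simps)
    then show "(\<Sum>h<n. \<Sum>s\<le>r. ?X h s b c) = (if ?Q b c then x b * y c * conv F G b c r else 0)"
      using basis_paths_path(4)[OF b] by simp
  qed
  finally show ?thesis .
qed

text \<open>The final formula contains \<open>w\<close> but neither \<open>x\<close> nor
  \<open>y\<close> nor \<open>N\<close>. This is the independence of the decomposition on which the
  definite description in \<open>split_apply\<close> relies.\<close>

lemma split_value:
  fixes N :: nat and f g :: "'a cochain"
  assumes "rep p f F" "rep q g G" "\<And>k. k < N \<Longrightarrow> x k \<in> W p \<and> y k \<in> W q"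
    "w = (\<Oplus>\<^bsub>PA\<^esub>k\<in>{..<N}. x k \<otimes>\<^bsub>PA\<^esub> y k)" "a = (\<Oplus>\<^bsub>A\<^esub>k\<in>{..<N}. f (x k) \<otimes>\<^bsub>A\<^esub> g (y k))"
  shows "a \<in> carrier A"
    and "adm n j i r \<Longrightarrow> coord n a j i r = (\<Sum>b\<in>basis_paths p. \<Sum>c\<in>basis_paths q.
      if fst b = j \<and> path_source b = fst c \<and> path_source c = i
      then w (fst b, snd b @ snd c) * conv F G b c r else 0)"
proof -
  have fg: "f (x k) \<otimes>\<^bsub>A\<^esub> g (y k) \<in> carrier A" if "k < N" for k
    using repD(1)[OF assms(1)] repD(1)[OF assms(2)] assms(3)[OF that] by simp
  then show "a \<in> carrier A" unfolding assms(5) by (intro A.finsum_closed) auto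
  assume adm: "adm n j i r"
  let ?Q = "\<lambda>b c. fst b = j \<and> path_source b = fst c \<and> path_source c = i"
  \<comment> \<open>All \<open>x k\<close> are homogeneous of degree \<open>p\<close>, so the
    coefficient of \<open>w\<close> at a concatenation comes from the cut after \<open>p\<close>
    letters alone.\<close>
  have w: "w (fst b, snd b @ snd c) = (\<Sum>k<N. x k b * y k c)"
    if b: "b \<in> basis_paths p" and e: "path_source b = fst c" for b c
  proof -
    have "w (fst b, snd b @ snd c) = (\<Sum>k<N. (x k \<otimes>\<^bsub>PA\<^esub> y k) (fst b, snd b @ snd c))"
      unfolding assms(4) using assms(3) W_carrier by (intro path_finsum path_mult_closed) auto
    also have "\<dots> = (\<Sum>k<N. x k b * y k c)"
    proof (intro sum.cong refl)
      fix k assume "k \<in> {..<N}"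
      then have "x k \<in> PG p" using assms(3) W_grade by auto
      then show "(x k \<otimes>\<^bsub>PA\<^esub> y k) (fst b, snd b @ snd c) = x k b * y k c"
        using basis_paths_path(2)[OF b] e by (simp add: grade_mult_left)
    qed
    finally show ?thesis .
  qed
  have "coord n a j i r = (\<Sum>k<N. coord n (f (x k) \<otimes>\<^bsub>A\<^esub> g (y k)) j i r)"
    unfolding assms(5) using fg by (intro coord_finsum) auto
  also have "\<dots> = (\<Sum>k<N. \<Sum>b\<in>basis_paths p. \<Sum>c\<in>basis_paths q.
      if ?Q b c then x k b * y k c * conv F G b c r else 0)"
    by (rule sum.cong[OF refl], rule coord_rep_mult[OF assms(1,2) _ _ adm]) (use assms(3) in auto)
  also have "\<dots> = (\<Sum>b\<in>basis_paths p. \<Sum>c\<in>basis_paths q. \<Sum>k<N.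
      if ?Q b c then x k b * y k c * conv F G b c r else 0)"
    by (rule sum_swap3)
  also have "\<dots> = (\<Sum>b\<in>basis_paths p. \<Sum>c\<in>basis_paths q.
      if ?Q b c then w (fst b, snd b @ snd c) * conv F G b c r else 0)"
  proof (intro sum.cong refl)
    fix b c assume b: "b \<in> basis_paths p"
    show "(\<Sum>k<N. if ?Q b c then x k b * y k c * conv F G b c r else 0) =
        (if ?Q b c then w (fst b, snd b @ snd c) * conv F G b c r else 0)"
    proof (cases "?Q b c")
      case True
      then have "w (fst b, snd b @ snd c) = (\<Sum>k<N. x k b * y k c)" using w[OF b] by blast
      then show ?thesis unfolding if_P[OF True] by (simp add: sum_distrib_right)
    next
      case False
      show ?thesis unfolding if_not_P[OF False] by simp
    qed
  qed
  finally show "coord n a j i r = (\<Sum>b\<in>basis_paths p. \<Sum>c\<in>basis_paths q.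
      if ?Q b c then w (fst b, snd b @ snd c) * conv F G b c r else 0)" .
qed

text \<open>A decomposition exists by \<open>W_tensor\<close>, and by \<open>split_value\<close> two
  decompositions give elements with equal coordinates.\<close>

lemma split_apply_value:
  assumes "rep p f F" "rep q g G" "w \<in> W (p + q)"
  shows "split_apply n p q f g w \<in> carrier A"
    and "adm n j i r \<Longrightarrow> coord n (split_apply n p q f g w) j i r =
      (\<Sum>b\<in>basis_paths p. \<Sum>c\<in>basis_paths q.
        if fst b = j \<and> path_source b = fst c \<and> path_source c = i
        then w (fst b, snd b @ snd c) * conv F G b c r else 0)"
proof -
  obtain N :: nat and x y where xy: "\<forall>k<N. x k \<in> W p \<and> y k \<in> W q"
    and w: "w = (\<Oplus>\<^bsub>PA\<^esub>k\<in>{..<N}. x k \<otimes>\<^bsub>PA\<^esub> y k)"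
    using W_tensor[OF assms(3)] unfolding tensor_prod_def by blast
  define a where "a = (\<Oplus>\<^bsub>A\<^esub>k\<in>{..<N}. f (x k) \<otimes>\<^bsub>A\<^esub> g (y k))"
  have "split_apply n p q f g w = a"
    unfolding split_apply_def
  proof (rule the_equality)
    show "\<exists>(N::nat) x y. (\<forall>i<N. x i \<in> W p \<and> y i \<in> W q) \<and>
        w = (\<Oplus>\<^bsub>PA\<^esub>i\<in>{..<N}. x i \<otimes>\<^bsub>PA\<^esub> y i) \<and> a = (\<Oplus>\<^bsub>A\<^esub>i\<in>{..<N}. f (x i) \<otimes>\<^bsub>A\<^esub> g (y i))"
      using xy w a_def by blast
    fix a' assume "\<exists>(N::nat) x y. (\<forall>i<N. x i \<in> W p \<and> y i \<in> W q) \<and>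
        w = (\<Oplus>\<^bsub>PA\<^esub>i\<in>{..<N}. x i \<otimes>\<^bsub>PA\<^esub> y i) \<and> a' = (\<Oplus>\<^bsub>A\<^esub>i\<in>{..<N}. f (x i) \<otimes>\<^bsub>A\<^esub> g (y i))"
    then obtain N' :: nat and x' y' where "\<And>k. k < N' \<Longrightarrow> x' k \<in> W p \<and> y' k \<in> W q"
      "w = (\<Oplus>\<^bsub>PA\<^esub>i\<in>{..<N'}. x' i \<otimes>\<^bsub>PA\<^esub> y' i)" "a' = (\<Oplus>\<^bsub>A\<^esub>i\<in>{..<N'}. f (x' i) \<otimes>\<^bsub>A\<^esub> g (y' i))"
      by blast
    note 1 = split_value[OF assms(1,2) this]
    note 2 = split_value[OF assms(1,2) xy[rule_format] w a_def]
    show "a' = a"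
      by (rule coord_inj[OF 1(1) 2(1)]) (simp_all add: 1(2) 2(2))
  qed
  then show "split_apply n p q f g w \<in> carrier A"
    "adm n j i r \<Longrightarrow> coord n (split_apply n p q f g w) j i r =
      (\<Sum>b\<in>basis_paths p. \<Sum>c\<in>basis_paths q.
        if fst b = j \<and> path_source b = fst c \<and> path_source c = i
        then w (fst b, snd b @ snd c) * conv F G b c r else 0)"
    using split_value[OF assms(1,2) xy[rule_format] w a_def] by simp_all
qed

text \<open>The value on the basis element \<open>e\<close>: split the paths occurring in
  \<open>e\<close> after \<open>p\<close> letters and multiply. The sign of the Koszul cup product
  is added in \<open>rep_cup\<close>.\<close>

definition cup_coord :: "nat \<Rightarrow> nat \<Rightarrow> (path \<Rightarrow> nat \<Rightarrow> 'a) \<Rightarrow> (path \<Rightarrow> nat \<Rightarrow> 'a) \<Rightarrow> path \<Rightarrow> nat \<Rightarrow> 'a" where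
  "cup_coord p q F G e r = (\<Sum>b\<in>basis_paths p. \<Sum>c\<in>basis_paths q.
     if path_source b = fst c then basis_elt (p + q) e (fst b, snd b @ snd c) * conv F G b c r else 0)"

lemma rep_split:
  assumes "rep p f F" "rep q g G"
  shows "rep (p + q) (split_apply n p q f g) (cup_coord p q F G)"
proof (rule repI)
  fix w assume w: "w \<in> W (p + q)"
  show "split_apply n p q f g w \<in> carrier A" by (rule split_apply_value[OF assms w])
next
  fix w j i r assume w: "w \<in> W (p + q)" and a: "adm n j i r"
  let ?E = "basis_paths (p + q)"
  let ?Q = "\<lambda>b c. fst b = j \<and> path_source b = fst c \<and> path_source c = i"
  let ?t = "\<lambda>e b c. w e * (basis_elt (p + q) e (fst b, snd b @ snd c) * conv F G b c r)"
  have "(\<Sum>e\<in>?E. if fst e = j \<and> path_source e = i then w e * cup_coord p q F G e r else 0) =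
      (\<Sum>e\<in>?E. \<Sum>b\<in>basis_paths p. \<Sum>c\<in>basis_paths q.
        if fst e = j \<and> path_source e = i \<and> path_source b = fst c then ?t e b c else 0)"
    unfolding cup_coord_def sum_distrib_left
    by (intro sum.cong refl) (auto simp: sum_distrib_left intro!: sum.cong)
  also have "\<dots> = (\<Sum>b\<in>basis_paths p. \<Sum>c\<in>basis_paths q. \<Sum>e\<in>?E.
        if fst e = j \<and> path_source e = i \<and> path_source b = fst c then ?t e b c else 0)"
    by (rule sum_swap3)
  also have "\<dots> = (\<Sum>b\<in>basis_paths p. \<Sum>c\<in>basis_paths q.
      if ?Q b c then w (fst b, snd b @ snd c) * conv F G b c r else 0)"
  proof (intro sum.cong refl)
    fix b c assume b: "b \<in> basis_paths p"
    have "(\<Sum>e\<in>?E. if fst e = j \<and> path_source e = i \<and> path_source b = fst c then ?t e b c else 0) =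
        (\<Sum>e\<in>?E. if ?Q b c then ?t e b c else 0)"
    proof (intro sum.cong refl)
      fix e assume e: "e \<in> ?E"
      show "(if fst e = j \<and> path_source e = i \<and> path_source b = fst c then ?t e b c else 0) =
          (if ?Q b c then ?t e b c else 0)"
      \<comment> \<open>A basis element with a nonzero coefficient at the concatenation shares its
        endpoints, so the conditions on \<open>e\<close> turn into conditions on \<open>b\<close>
        and \<open>c\<close>; \<open>W_expand\<close> then carries out the sum over
        \<open>e\<close>.\<close>
      proof (cases "basis_elt (p + q) e (fst b, snd b @ snd c) = 0 \<or> path_source b \<noteq> fst c")
        case False
        then have "fst b = fst e" "path_source (fst b, snd b @ snd c) = path_source e"
          using basis_elt_support[OF e, of "fst b" "snd b @ snd c"] by auto
        moreover have "path_source (fst b, snd b @ snd c) = path_source c" using False by simp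
        ultimately show ?thesis by auto
      qed auto
    qed
    also have "\<dots> = (if ?Q b c then w (fst b, snd b @ snd c) * conv F G b c r else 0)"
    proof (cases "?Q b c")
      case True
      show ?thesis
        unfolding if_P[OF True] W_expand[OF w, of "(fst b, snd b @ snd c)"] sum_distrib_right mult.assoc ..
    next
      case False
      show ?thesis unfolding if_not_P[OF False] by simp
    qed
    finally show "(\<Sum>e\<in>?E. if fst e = j \<and> path_source e = i \<and> path_source b = fst c then ?t e b c else 0) =
        (if ?Q b c then w (fst b, snd b @ snd c) * conv F G b c r else 0)" .
  qed
  also have "\<dots> = coord n (split_apply n p q f g w) j i r"
    using split_apply_value(2)[OF assms w a] by simp
  finally show "coord n (split_apply n p q f g w) j i r =
      (\<Sum>e\<in>?E. if fst e = j \<and> path_source e = i then w e * cup_coord p q F G e r else 0)" ..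
qed

text \<open>A path has only one decomposition into pieces of lengths \<open>p\<close> and
  \<open>q\<close>, so the double sum reduces to one term.\<close>

lemma sum_split:
  assumes "b0 \<in> basis_paths p" "c0 \<in> basis_paths q" "path_source b0 = fst c0"
    "e = (fst b0, snd b0 @ snd c0)"
  shows "(\<Sum>b\<in>basis_paths p. \<Sum>c\<in>basis_paths q.
      if path_source b = fst c then (if (fst b, snd b @ snd c) = e then 1 else 0) * X b c else 0) =
    (X b0 c0 :: 'a)"
proof -
  have "(\<Sum>b\<in>basis_paths p. \<Sum>c\<in>basis_paths q.
      if path_source b = fst c then (if (fst b, snd b @ snd c) = (fst b0, snd b0 @ snd c0) then 1 else 0) * X b c else 0) =
      (\<Sum>b\<in>basis_paths p. \<Sum>c\<in>basis_paths q. if c = c0 then if b = b0 then X b0 c0 else 0 else 0)"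
  proof (intro sum.cong refl)
    fix b c assume "b \<in> basis_paths p" "c \<in> basis_paths q"
    then have "length (snd b) = length (snd b0)" using basis_paths_path(2) assms(1) by metis
    moreover have "fst b = fst b0 \<and> snd b = snd b0 \<longleftrightarrow> b = b0" "fst c = fst c0 \<and> snd c = snd c0 \<longleftrightarrow> c = c0"
      by (simp_all add: prod_eq_iff)
    ultimately have "path_source b = fst c \<and> (fst b, snd b @ snd c) = (fst b0, snd b0 @ snd c0) \<longleftrightarrow> b = b0 \<and> c = c0"
      using assms(3) by (metis append_eq_append_conv prod.inject)
    then show "(if path_source b = fst c then (if (fst b, snd b @ snd c) = (fst b0, snd b0 @ snd c0) then 1 else 0) * X b c else 0) =
      (if c = c0 then if b = b0 then X b0 c0 else 0 else 0)" by auto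
  qed
  also have "\<dots> = X b0 c0" using assms by simp
  finally show ?thesis unfolding assms(4) .
qed

section \<open>Products in total degree at most 2\<close>

lemma basis_paths_0: "b \<in> basis_paths 0 \<longleftrightarrow> (\<exists>v<n. b = (v, []))"
  by (auto simp: basis_paths_def)

lemma basis_paths_1: "b \<in> basis_paths 1 \<longleftrightarrow> (\<exists>x\<in>arrows n. b = (target x, [x]))"
  by (auto simp: basis_paths_def)

lemma basis_paths_2: "b \<in> basis_paths 2 \<longleftrightarrow> (\<exists>v<n. b = (v, cyc v))"
  by (auto simp: basis_paths_def)

lemma basis_elt_1: "basis_elt 1 e q = (if q = e then 1 else 0)"
  by (simp add: basis_elt_def path_elt_def)

lemma cup_coord_01:
  assumes "e \<in> basis_paths 1"
  shows "cup_coord 0 1 F G e r = conv F G (fst e, []) e r"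
proof -
  have "(fst e, []) \<in> basis_paths 0" using basis_paths_path(3)[OF assms] by (simp add: basis_paths_0)
  from sum_split[OF this assms] show ?thesis
    unfolding cup_coord_def add_0 basis_elt_1 by simp
qed

lemma cup_coord_10:
  assumes "e \<in> basis_paths 1"
  shows "cup_coord 1 0 F G e r = conv F G e (path_source e, []) r"
proof -
  have "(path_source e, []) \<in> basis_paths 0" using basis_paths_path(4)[OF assms] by (simp add: basis_paths_0)
  from sum_split[OF assms this] show ?thesis
    unfolding cup_coord_def add_0_right basis_elt_1 by simp
qed

lemma arrow_basis:
  assumes "i + 2 \<le> n"
  shows "(Suc i, [Arr i]) \<in> basis_paths 1" "(i, [Star i]) \<in> basis_paths 1"
  using assms by (auto simp: basis_paths_1 arrows_def intro: bexI[of _ "Arr i"] bexI[of _ "Star i"])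

text \<open>The basis element at \<open>v\<close> is the path \<open>cyc v\<close> minus, at an
  interior vertex, the 2-cycle through \<open>v + 1\<close>. Each of these paths contributes the
  product at its two letters.\<close>

lemma cup_coord_11:
  assumes "v < n"
  shows "cup_coord 1 1 F G (v, cyc v) r =
    (if v = 0 then conv F G (0, [Star 0]) (Suc 0, [Arr 0]) r
     else conv F G (v, [Arr (v - 1)]) (v - 1, [Star (v - 1)]) r) -
    (if 0 < v \<and> v < n - 1 then conv F G (v, [Star v]) (Suc v, [Arr v]) r else 0)"
proof -
  have e: "basis_elt (1 + 1) (v, cyc v) q = (if q = (v, cyc v) then 1 else 0) -
      (if 0 < v \<and> v < n - 1 then if q = (v, [Star v, Arr v]) then 1 else 0 else 0)" for q
    using basis_elt_2[OF assms, of "cyc v"] by (simp add: numeral_2_eq_2)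
  have 1: "(\<Sum>b\<in>basis_paths 1. \<Sum>c\<in>basis_paths 1. if path_source b = fst c then
      (if (fst b, snd b @ snd c) = (v, cyc v) then 1 else 0) * conv F G b c r else 0) =
    (if v = 0 then conv F G (0, [Star 0]) (Suc 0, [Arr 0]) r
     else conv F G (v, [Arr (v - 1)]) (v - 1, [Star (v - 1)]) r)"
  proof (cases "v = 0")
    case True
    have "(Suc 0, [Arr 0]) \<in> basis_paths 1" "(0, [Star 0]) \<in> basis_paths 1"
      using arrow_basis[of 0] n_ge by auto
    from sum_split[OF this(2,1), of "(v, cyc v)" "\<lambda>b c. conv F G b c r"] show ?thesis
      using True by (simp add: cyc_def cong: if_cong)
  next
    case False
    then have "(v, [Arr (v - 1)]) \<in> basis_paths 1" "(v - 1, [Star (v - 1)]) \<in> basis_paths 1"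
      using arrow_basis[of "v - 1"] assms by auto
    from sum_split[OF this, of "(v, cyc v)" "\<lambda>b c. conv F G b c r"] show ?thesis
      using False by (simp add: cyc_def cong: if_cong)
  qed
  have 2: "(\<Sum>b\<in>basis_paths 1. \<Sum>c\<in>basis_paths 1. if path_source b = fst c then
      (if 0 < v \<and> v < n - 1 then if (fst b, snd b @ snd c) = (v, [Star v, Arr v]) then 1 else 0 else 0) * conv F G b c r else 0) =
    (if 0 < v \<and> v < n - 1 then conv F G (v, [Star v]) (Suc v, [Arr v]) r else 0)"
  proof (cases "0 < v \<and> v < n - 1")
    case True
    then have "(Suc v, [Arr v]) \<in> basis_paths 1" "(v, [Star v]) \<in> basis_paths 1"
      using arrow_basis[of v] by auto
    from sum_split[OF this(2,1), of "(v, [Star v, Arr v])" "\<lambda>b c. conv F G b c r"] show ?thesis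
      unfolding if_P[OF True] by simp
  next
    case False
    then show ?thesis by (simp only: if_False mult_zero_left if_cancel sum.neutral_const)
  qed
  have "cup_coord 1 1 F G (v, cyc v) r =
      (\<Sum>b\<in>basis_paths 1. \<Sum>c\<in>basis_paths 1. if path_source b = fst c then
        (if (fst b, snd b @ snd c) = (v, cyc v) then 1 else 0) * conv F G b c r else 0) -
      (\<Sum>b\<in>basis_paths 1. \<Sum>c\<in>basis_paths 1. if path_source b = fst c then
        (if 0 < v \<and> v < n - 1 then if (fst b, snd b @ snd c) = (v, [Star v, Arr v]) then 1 else 0 else 0) * conv F G b c r else 0)"
    unfolding cup_coord_def e sum_subtractf[symmetric]
    by (intro sum.cong refl) (simp add: left_diff_distrib)
  then show ?thesis using 1 2 by simp
qed

section \<open>The differential in coordinates\<close>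

abbreviation "euler_coord \<equiv> \<lambda>(b :: path) (r :: nat). if r = 1 then 1 else (0 :: 'a)"

text \<open>The ends of an arrow have different parity, so even degrees are excluded. The absence of
  degree 0 is what later annihilates products on HK^1.\<close>

lemma admp_arrow:
  assumes "b \<in> basis_paths 1"
  shows "admp b 1" "\<not> admp b 0"
  using assms n_ge by (auto simp: basis_paths_1 arrows_def admp_def adm_def)

text \<open>Removing the arrow lowers the bounds by no more than the length, so the loops at both
  ends are admissible; this removes the masks from the differential.\<close>

lemma admp_arrow_pred:
  assumes "b \<in> basis_paths 1" "admp b r" "r \<noteq> 0"
  shows "admp (fst b, []) (r - 1)" "admp (path_source b, []) (r - 1)"
proof -
  obtain k where "r = Suc k" using assms(3) by (cases r) auto
  then show "admp (fst b, []) (r - 1)" "admp (path_source b, []) (r - 1)"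
    using assms by (auto simp: basis_paths_1 arrows_def admp_def adm_def)
qed

lemma conv_unit_right:
  assumes "c \<in> basis_paths 1"
  shows "conv F euler_coord b c r = (if r = 0 then 0 else mask F b (r - 1))"
proof -
  have "conv F euler_coord b c r = (\<Sum>s\<le>r. if s = r - 1 then (if r = 0 then 0 else mask F b s) else 0)"
    unfolding conv_def by (rule sum.cong) (use admp_arrow(1)[OF assms] in \<open>auto simp: mask_def\<close>)
  then show ?thesis by simp
qed

lemma conv_unit_left:
  assumes "c \<in> basis_paths 1"
  shows "conv euler_coord F c b r = (if r = 0 then 0 else mask F b (r - 1))"
proof -
  have "conv euler_coord F c b r = (\<Sum>s\<le>r. if s = 1 then mask F b (r - 1) else 0)"
    unfolding conv_def by (rule sum.cong) (use admp_arrow(1)[OF assms] in \<open>auto simp: mask_def\<close>)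
  then show ?thesis by (cases r) auto
qed

definition pair_coord :: "(path \<Rightarrow> nat \<Rightarrow> 'a) \<Rightarrow> nat \<Rightarrow> nat \<Rightarrow> 'a" where
  "pair_coord F i r = F (Suc i, [Arr i]) r + F (i, [Star i]) r"

text \<open>For \<open>p = 1\<close> the differential is f(x) y + x f(y) with two plus signs, so
  each 2-cycle of the relator contributes the sum over its two arrows. At the end vertices only
  \<open>r = 0\<close> is admissible, and the differential has no part in degree 0.\<close>

definition d_coord :: "nat \<Rightarrow> (path \<Rightarrow> nat \<Rightarrow> 'a) \<Rightarrow> path \<Rightarrow> nat \<Rightarrow> 'a" where
  "d_coord p F b r =
    (if p = 0 then if r = 0 then 0 else F (fst b, []) (r - 1) - F (path_source b, []) (r - 1)
     else if p = 1 then if r = 0 \<or> fst b = 0 \<or> n - 1 \<le> fst b then 0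
       else pair_coord F (fst b - 1) (r - 1) - pair_coord F (fst b) (r - 1)
     else 0)"

lemma A_minus_smult:
  assumes "a \<in> carrier A" "b \<in> carrier A"
  shows "a \<ominus>\<^bsub>A\<^esub> c \<odot>\<^bsub>A\<^esub> b = a \<oplus>\<^bsub>A\<^esub> (- c) \<odot>\<^bsub>A\<^esub> b"
proof -
  have s: "c \<odot>\<^bsub>A\<^esub> b \<in> carrier A" for c
    using Module.module.smult_closed[OF A_module] assms(2) by simp
  show ?thesis
    by (rule coord_inj) (simp_all add: assms s coord_minus coord_add coord_smult)
qed

lemma rep_koszul_d:
  assumes "rep p f F"
  shows "rep (Suc p) (koszul_d n p f)
    (\<lambda>b r. cup_coord p 1 F euler_coord b r - (-1) ^ p * cup_coord 1 p euler_coord F b r)"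
proof -
  have 1: "rep (Suc p) (split_apply n p 1 f cl) (cup_coord p 1 F euler_coord)"
    using rep_split[OF assms rep_class] by (simp only: Suc_eq_plus1)
  have 2: "rep (Suc p) (split_apply n 1 p cl f) (cup_coord 1 p euler_coord F)"
    using rep_split[OF rep_class assms] by (simp only: Suc_eq_plus1_left)
  show ?thesis
  proof (rule rep_cong[OF rep_lincomb[OF 1 2, of "- ((-1) ^ p)"]])
    fix w assume w: "w \<in> W (Suc p)"
    show "koszul_d n p f w = (\<lambda>w\<in>W (Suc p). split_apply n p 1 f cl w \<oplus>\<^bsub>A\<^esub>
        (- ((-1) ^ p)) \<odot>\<^bsub>A\<^esub> split_apply n 1 p cl f w) w"
      unfolding koszul_d_def using w A_minus_smult[OF repD(1)[OF 1 w] repD(1)[OF 2 w]] by simp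
  qed simp
qed

lemma rep_d:
  assumes "rep p f F"
  shows "rep (Suc p) (koszul_d n p f) (d_coord p F)"
proof (rule rep_cong[OF rep_koszul_d[OF assms] refl])
  fix b r assume b: "b \<in> basis_paths (Suc p)" and a: "admp b r"
  consider "p = 0" | "p = 1" | "2 \<le> p" by linarith
  then show "d_coord p F b r = cup_coord p 1 F euler_coord b r - (-1) ^ p * cup_coord 1 p euler_coord F b r"
  proof cases
    case 1
    then have b1: "b \<in> basis_paths 1" using b by (simp add: One_nat_def)
    show ?thesis
      using admp_arrow_pred[OF b1 a]
      by (simp add: 1 cup_coord_01[OF b1] cup_coord_10[OF b1] conv_unit_right[OF b1] conv_unit_left[OF b1] d_coord_def mask_def)
  next
    case 2
    then obtain v where v: "v < n" "b = (v, cyc v)" using b by (auto simp: basis_paths_2 numeral_2_eq_2[symmetric])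
    have adm: "adm n v v r" using a cyc_path[OF v(1)] by (simp add: admp_def v)
    show ?thesis
    proof (cases "r = 0")
      case True
      have z: "conv F euler_coord c d 0 = 0" "conv euler_coord F c d 0 = 0" for F c d
        by (simp_all add: conv_def mask_def)
      show ?thesis unfolding 2 v(2) True cup_coord_11[OF v(1)] z by (simp add: d_coord_def)
    next
      case False
      \<comment> \<open>At an end vertex the only admissible degree is 0.\<close>
      have v': "0 < v" "v < n - 1" using adm False v n_ge by (auto simp: adm_def)
      obtain u k where u: "v = Suc u" "r = Suc k" using v' False by (metis gr0_implies_Suc not_gr0)
      have "adm n v u k" "adm n u v k" "adm n (Suc v) v k" "adm n v (Suc v) k"
        using adm unfolding u adm_def by presburger+
      then have m: "mask F (v, [Arr u]) k = F (v, [Arr u]) k" "mask F (u, [Star u]) k = F (u, [Star u]) k"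
        "mask F (Suc v, [Arr v]) k = F (Suc v, [Arr v]) k" "mask F (v, [Star v]) k = F (v, [Star v]) k"
        by (auto simp: mask_def admp_def u Suc_eq_plus1[symmetric])
      have ab: "(v, [Arr u]) \<in> basis_paths 1" "(u, [Star u]) \<in> basis_paths 1"
        "(Suc v, [Arr v]) \<in> basis_paths 1" "(v, [Star v]) \<in> basis_paths 1"
        using arrow_basis[of u] arrow_basis[of v] v' u by auto
      show ?thesis
        unfolding 2 v(2) cup_coord_11[OF v(1)] d_coord_def pair_coord_def
        using v' m ab by (simp add: u conv_unit_left conv_unit_right)
    qed
  next
    case 3
    then show ?thesis using b by (simp add: basis_paths_def)
  qed
qed

lemma rep_cup:
  assumes "rep p f F" "rep q g G"
  shows "rep (p + q) (koszul_cup n p q f g) (\<lambda>e r. (-1) ^ (p * q) * cup_coord p q F G e r)"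
proof (rule rep_cong[OF rep_lincomb[OF rep_zero rep_split[OF assms], of "(-1) ^ (p * q)"]])
  fix w assume w: "w \<in> W (p + q)"
  have "(-1) ^ (p * q) \<odot>\<^bsub>A\<^esub> split_apply n p q f g w \<in> carrier A"
    using Module.module.smult_closed[OF A_module] repD(1)[OF rep_split[OF assms] w] by simp
  then show "koszul_cup n p q f g w = (\<lambda>w\<in>W (p + q). \<zero>\<^bsub>C (p + q)\<^esub> w \<oplus>\<^bsub>A\<^esub>
      (-1) ^ (p * q) \<odot>\<^bsub>A\<^esub> split_apply n p q f g w) w"
    unfolding koszul_cup_def using w by (simp add: C_app)
qed simp

end

section \<open>Koszul cohomology\<close>

lemma adm_sym: "adm n j i r \<longleftrightarrow> adm n i j r"
  by (auto simp: adm_def add.commute)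

lemma adm_loop: "adm n v v k \<longleftrightarrow> even k \<and> k \<le> 2 * v \<and> 2 * v + k \<le> 2 * (n - 1)"
  unfolding adm_def by (auto simp: mult_2)

lemma adm_arr: "adm n (Suc i) i r \<longleftrightarrow> odd r \<and> r \<le> 2 * i + 1 \<and> 2 * i + 1 + r \<le> 2 * (n - 1)"
proof
  assume "odd r \<and> r \<le> 2 * i + 1 \<and> 2 * i + 1 + r \<le> 2 * (n - 1)"
  moreover from this have "1 \<le> r" by (cases r) auto
  ultimately show "adm n (Suc i) i r" unfolding adm_def by auto
qed (auto simp: adm_def)

lemma zero_submodule:
  assumes "Module.module R M"
  shows "submodule R {\<zero>\<^bsub>M\<^esub>} M"
proof -
  interpret Module.module R M by fact
  show ?thesis by (rule submodule.intro) (auto intro: assms)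
qed

lemma source_target_Suc: "source (Star i) = Suc i" "target (Arr i) = Suc i"
  by simp_all

context typeA
begin

declare source.simps(2) [simp del] target.simps(1) [simp del] source_target_Suc [simp]

abbreviation "Z p \<equiv> cocycles (koszul_cochains n :: nat \<Rightarrow> ('a, 'a cochain) module) (koszul_d n) p"
abbreviation "B p \<equiv> coboundaries (koszul_cochains n :: nat \<Rightarrow> ('a, 'a cochain) module) (koszul_d n) p"
abbreviation "H p \<equiv> HK n p :: ('a, 'a cochain set) module"
abbreviation "hk p \<equiv> HK_class n p :: 'a cochain \<Rightarrow> 'a cochain set"
abbreviation "T p \<equiv> fundamental_cup n p :: 'a cochain set \<Rightarrow> 'a cochain set"

section \<open>The cohomology spaces as quotients\<close>

lemma d_ext: "koszul_d n p f \<in> extensional (W (Suc p))"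
  by (simp add: koszul_d_def)

lemma d_closed: "f \<in> carrier (C p) \<Longrightarrow> koszul_d n p f \<in> carrier (C (Suc p))"
  by (rule rep_imp_cochain[OF rep_d[OF rep_cochain] d_ext])

lemma d_coord_add: "d_coord p (\<lambda>b r. F b r + G b r) b r = d_coord p F b r + d_coord p G b r"
  by (simp add: d_coord_def pair_coord_def)

lemma d_coord_smult: "d_coord p (\<lambda>b r. c * F b r) b r = c * d_coord p F b r"
  by (simp add: d_coord_def pair_coord_def algebra_simps)

text \<open>A differential of a 0-cochain has opposite values at \<open>Arr i\<close> and
  \<open>Star i\<close>, so its pair sums vanish; the differentials from degree 2 on are 0.\<close>

lemma d_coord_D: "d_coord (Suc p) (d_coord p F) b r = 0"
  by (cases p) (simp_all add: d_coord_def pair_coord_def One_nat_def)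

lemma d_hom: "koszul_d n p \<in> LinearCombinations.module_hom class_ring (C p) (C (Suc p))"
  unfolding LinearCombinations.module_hom_def
proof (intro CollectI conjI)
  show "koszul_d n p \<in> carrier (C p) \<rightarrow> carrier (C (Suc p))" using d_closed by blast
  show "\<forall>f g. f \<in> carrier (C p) \<and> g \<in> carrier (C p) \<longrightarrow>
      koszul_d n p (f \<oplus>\<^bsub>C p\<^esub> g) = koszul_d n p f \<oplus>\<^bsub>C (Suc p)\<^esub> koszul_d n p g"
  proof (intro allI impI)
    fix f g assume "f \<in> carrier (C p) \<and> g \<in> carrier (C p)"
    then obtain F G where r: "rep p f F" "rep p g G" using rep_exists by metis
    show "koszul_d n p (f \<oplus>\<^bsub>C p\<^esub> g) = koszul_d n p f \<oplus>\<^bsub>C (Suc p)\<^esub> koszul_d n p g"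
      unfolding rep_eq_iff[OF rep_d[OF rep_add[OF r]] rep_add[OF rep_d[OF r(1)] rep_d[OF r(2)]] d_ext C_ext(1)]
      by (simp add: d_coord_add)
  qed
  show "\<forall>c f. c \<in> carrier class_ring \<and> f \<in> carrier (C p) \<longrightarrow>
      koszul_d n p (c \<odot>\<^bsub>C p\<^esub> f) = c \<odot>\<^bsub>C (Suc p)\<^esub> koszul_d n p f"
  proof (intro allI impI)
    fix c :: 'a and f assume "c \<in> carrier class_ring \<and> f \<in> carrier (C p)"
    then obtain F where r: "rep p f F" using rep_exists by metis
    show "koszul_d n p (c \<odot>\<^bsub>C p\<^esub> f) = c \<odot>\<^bsub>C (Suc p)\<^esub> koszul_d n p f"
      unfolding rep_eq_iff[OF rep_d[OF rep_smult[OF r]] rep_smult[OF rep_d[OF r]] d_ext C_ext(2)]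
      by (simp add: d_coord_smult)
  qed
qed

lemma d_d: "f \<in> carrier (C p) \<Longrightarrow> koszul_d n (Suc p) (koszul_d n p f) = \<zero>\<^bsub>C (Suc (Suc p))\<^esub>"
  unfolding rep_eq_iff[OF rep_d[OF rep_d[OF rep_cochain]] rep_zero d_ext C_ext(3)]
  by (simp add: d_coord_D)

lemma d_mod_hom: "mod_hom class_ring (C p) (C (Suc p)) (koszul_d n p)"
  by (intro mod_hom.intro mod_hom_axioms.intro C_module d_hom)

lemma Z_submodule: "submodule class_ring (Z p) (C p)"
  using mod_hom.ker_is_submodule[OF d_mod_hom[of p]]
  unfolding mod_hom.ker_def[OF d_mod_hom[of p]] cocycles_def .

lemma B_submodule: "submodule class_ring (B p) (C p)"
proof (cases p)
  case 0
  then show ?thesis using zero_submodule[OF C_module[of 0]] by (simp add: coboundaries_def)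
next
  case (Suc q)
  then show ?thesis
    using mod_hom.im_is_submodule[OF d_mod_hom[of q]]
    unfolding mod_hom.im_def[OF d_mod_hom[of q]] by (simp add: coboundaries_def)
qed

lemma Z_carrier: "f \<in> Z p \<Longrightarrow> f \<in> carrier (C p)"
  by (simp add: cocycles_def)

lemma B_Z: "B p \<subseteq> Z p"
proof (cases p)
  case 0
  then show ?thesis using submodule.zero_closed[OF Z_submodule[of 0]] by (simp add: coboundaries_def)
next
  case (Suc q)
  then show ?thesis using d_closed d_d by (auto simp: coboundaries_def cocycles_def)
qed

lemma HK_quotient: "quotient_module class_ring (B p) (C p\<lparr>carrier := Z p\<rparr>)"
  by (intro quotient_module.intro submodule_restrict Z_submodule B_submodule B_Z)

lemma HK_eq: "H p = quot_module (C p\<lparr>carrier := Z p\<rparr>) (B p)"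
  by (simp add: HK_def cohomology_def)

lemma HK_module: "Module.module class_ring (H p)"
  unfolding HK_eq by (rule quotient_module.quot_module_is_module[OF HK_quotient])

lemma hk_eq: "hk p f = B p +>\<^bsub>C p\<^esub> f"
  by (simp add: HK_class_def coh_class_def)

lemma HK_carrier: "carrier (H p) = hk p ` Z p"
  unfolding HK_def HK_class_def by (rule cohomology_sel)

lemma HK_zero: "\<zero>\<^bsub>H p\<^esub> = B p"
  unfolding HK_def by (rule cohomology_sel)

lemma hk_smult: "f \<in> Z p \<Longrightarrow> c \<odot>\<^bsub>H p\<^esub> hk p f = hk p (c \<odot>\<^bsub>C p\<^esub> f)"
  using quotient_module.quot_smult[OF HK_quotient, of c f p] by (simp add: HK_eq hk_eq coset_restrict)

lemma hk_eq_iff: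
  assumes "f \<in> carrier (C p)" "g \<in> carrier (C p)"
  shows "hk p f = hk p g \<longleftrightarrow> g \<oplus>\<^bsub>C p\<^esub> ((-1) \<odot>\<^bsub>C p\<^esub> f) \<in> B p"
proof -
  obtain F G where r: "rep p f F" "rep p g G" using assms rep_exists by metis
  note fe = cochainD(1)[OF assms(1)] and ge = cochainD(1)[OF assms(2)]
  have "hk p f = hk p g \<longleftrightarrow> (\<exists>b\<in>B p. g = b \<oplus>\<^bsub>C p\<^esub> f)"
    unfolding hk_eq by (rule submodule.coset_eq_iff[OF B_submodule assms])
  also have "\<dots> \<longleftrightarrow> g \<oplus>\<^bsub>C p\<^esub> ((-1) \<odot>\<^bsub>C p\<^esub> f) \<in> B p"
  proof
    assume "\<exists>b\<in>B p. g = b \<oplus>\<^bsub>C p\<^esub> f"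
    then obtain b where b: "b \<in> B p" "g = b \<oplus>\<^bsub>C p\<^esub> f" by auto
    then have bc: "b \<in> carrier (C p)" using B_Z Z_carrier by blast
    then obtain K where K: "rep p b K" by (rule rep_exists)
    have "g \<oplus>\<^bsub>C p\<^esub> ((-1) \<odot>\<^bsub>C p\<^esub> f) = b" unfolding b(2)
      unfolding rep_eq_iff[OF rep_add[OF rep_add[OF K r(1)] rep_smult[OF r(1)]] K C_ext(1) cochainD(1)[OF bc]]
      by simp
    then show "g \<oplus>\<^bsub>C p\<^esub> ((-1) \<odot>\<^bsub>C p\<^esub> f) \<in> B p" using b by simp
  next
    assume *: "g \<oplus>\<^bsub>C p\<^esub> ((-1) \<odot>\<^bsub>C p\<^esub> f) \<in> B p"
    have "g = g \<oplus>\<^bsub>C p\<^esub> ((-1) \<odot>\<^bsub>C p\<^esub> f) \<oplus>\<^bsub>C p\<^esub> f"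
      unfolding rep_eq_iff[OF r(2) rep_add[OF rep_add[OF r(2) rep_smult[OF r(1)]] r(1)] ge C_ext(1)]
      by simp
    with * show "\<exists>b\<in>B p. g = b \<oplus>\<^bsub>C p\<^esub> f" by blast
  qed
  finally show ?thesis .
qed

lemma hk_zero_iff: "f \<in> carrier (C p) \<Longrightarrow> hk p f = B p \<longleftrightarrow> f \<in> B p"
  unfolding hk_eq by (rule submodule.coset_eq_self_iff[OF B_submodule])

text \<open>The only coboundary in degree 0 is zero, so a class has a single representative.\<close>

lemma hk_0: "f \<in> carrier (C 0) \<Longrightarrow> hk 0 f = {f}"
proof -
  assume f: "f \<in> carrier (C 0)"
  have "\<zero>\<^bsub>C 0\<^esub> \<oplus>\<^bsub>C 0\<^esub> f = f"
    by (rule C_eqI[OF C_ext(1) cochainD(1)[OF f]]) (simp add: C_app cochainD(2)[OF f])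
  then show ?thesis by (simp add: hk_eq a_r_coset_def' coboundaries_def)
qed

section \<open>Cocycles and coboundaries in coordinates\<close>

lemma basis_1_cases:
  assumes "b \<in> basis_paths 1"
  obtains i where "i + 2 \<le> n" "b = (Suc i, [Arr i])" | i where "i + 2 \<le> n" "b = (i, [Star i])"
  using assms by (auto simp: basis_paths_1 arrows_def)

text \<open>Commuting with \<open>Arr i\<close> and commuting with \<open>Star i\<close> give the
  same equation up to sign. The degree \<open>Suc k\<close> is that of the product with the
  arrow.\<close>

lemma Z0_iff:
  assumes "f \<in> carrier (C 0)" "rep 0 f F"
  shows "f \<in> Z 0 \<longleftrightarrow> (\<forall>i k. adm n (Suc i) i (Suc k) \<longrightarrow> F (i, []) k = F (Suc i, []) k)"
proof -
  have "f \<in> Z 0 \<longleftrightarrow> koszul_d n 0 f = \<zero>\<^bsub>C (Suc 0)\<^esub>" using assms(1) by (simp add: cocycles_def)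
  also have "\<dots> \<longleftrightarrow> (\<forall>b\<in>basis_paths 1. \<forall>r. admp b r \<longrightarrow> d_coord 0 F b r = 0)"
    unfolding rep_eq_iff[OF rep_d[OF assms(2)] rep_zero d_ext C_ext(3)] by (simp add: One_nat_def)
  also have "\<dots> \<longleftrightarrow> (\<forall>i k. adm n (Suc i) i (Suc k) \<longrightarrow> F (i, []) k = F (Suc i, []) k)"
  proof (intro iffI allI impI ballI)
    fix i k assume *: "\<forall>b\<in>basis_paths 1. \<forall>r. admp b r \<longrightarrow> d_coord 0 F b r = 0" and a: "adm n (Suc i) i (Suc k)"
    have "i + 2 \<le> n" using a by (auto simp: adm_arr)
    then have "d_coord 0 F (Suc i, [Arr i]) (Suc k) = 0"
      using * arrow_basis(1) a by (simp add: admp_def)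
    then show "F (i, []) k = F (Suc i, []) k" by (simp add: d_coord_def)
  next
    fix b r assume *: "\<forall>i k. adm n (Suc i) i (Suc k) \<longrightarrow> F (i, []) k = F (Suc i, []) k"
      and b: "b \<in> basis_paths 1" and a: "admp b r"
    show "d_coord 0 F b r = 0"
    proof (cases r)
      case (Suc k)
      from b show ?thesis
      proof (cases rule: basis_1_cases)
        case (1 i)
        then have "adm n (Suc i) i (Suc k)" using a Suc by (simp add: admp_def)
        then show ?thesis using * 1 Suc by (simp add: d_coord_def)
      next
        case (2 i)
        then have "adm n (Suc i) i (Suc k)" using a Suc by (simp add: admp_def adm_sym[of n i "Suc i"])
        then show ?thesis using * 2 Suc by (simp add: d_coord_def)
      qed
    qed (simp add: d_coord_def)
  qed
  finally show ?thesis .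
qed

text \<open>A positive admissible degree forces an interior vertex. There the relator is a
  difference of two 2-cycles, and each of them contributes its pair sum.\<close>

lemma Z1_iff:
  assumes "f \<in> carrier (C 1)" "rep 1 f F"
  shows "f \<in> Z 1 \<longleftrightarrow> (\<forall>i k. adm n (Suc i) (Suc i) (Suc k) \<longrightarrow> pair_coord F i k = pair_coord F (Suc i) k)"
proof -
  have "f \<in> Z 1 \<longleftrightarrow> koszul_d n 1 f = \<zero>\<^bsub>C (Suc 1)\<^esub>" using assms(1) by (simp add: cocycles_def)
  also have "\<dots> \<longleftrightarrow> (\<forall>b\<in>basis_paths (Suc 1). \<forall>r. admp b r \<longrightarrow> d_coord 1 F b r = 0)"
    unfolding rep_eq_iff[OF rep_d[OF assms(2)] rep_zero d_ext C_ext(3)] by simp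
  also have "Suc 1 = 2" by simp
  also have "(\<forall>b\<in>basis_paths 2. \<forall>r. admp b r \<longrightarrow> d_coord 1 F b r = 0) \<longleftrightarrow>
      (\<forall>i k. adm n (Suc i) (Suc i) (Suc k) \<longrightarrow> pair_coord F i k = pair_coord F (Suc i) k)"
  proof (intro iffI allI impI ballI)
    fix i k assume *: "\<forall>b\<in>basis_paths 2. \<forall>r. admp b r \<longrightarrow> d_coord 1 F b r = 0"
      and a: "adm n (Suc i) (Suc i) (Suc k)"
    have i: "Suc i < n - 1" using a by (auto simp: adm_loop)
    then have "(Suc i, cyc (Suc i)) \<in> basis_paths 2" by (auto simp: basis_paths_2)
    then have "d_coord 1 F (Suc i, cyc (Suc i)) (Suc k) = 0"
      using * a i cyc_path(2)[of "Suc i"] by (simp add: admp_def)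
    then show "pair_coord F i k = pair_coord F (Suc i) k" using i by (simp add: d_coord_def)
  next
    fix b r assume *: "\<forall>i k. adm n (Suc i) (Suc i) (Suc k) \<longrightarrow> pair_coord F i k = pair_coord F (Suc i) k"
      and b: "b \<in> basis_paths 2" and a: "admp b r"
    obtain v where v: "v < n" "b = (v, cyc v)" using b by (auto simp: basis_paths_2)
    then have av: "adm n v v r" using a cyc_path(2)[OF v(1)] by (simp add: admp_def)
    show "d_coord 1 F b r = 0"
    proof (cases "r = 0 \<or> v = 0")
      case True
      then show ?thesis using v by (auto simp: d_coord_def)
    next
      case False
      then obtain i k where "v = Suc i" "r = Suc k" by (metis not0_implies_Suc)
      then show ?thesis using * av v by (simp add: d_coord_def)
    qed
  qed
  finally show ?thesis .
qed

text \<open>If the pair sums vanish, the values at \<open>Star i\<close> are the negatives of those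
  at \<open>Arr i\<close>, and the latter can be realised as differences along the vertices because
  the underlying graph is a line.\<close>

lemma B1_iff:
  assumes "f \<in> carrier (C 1)" "rep 1 f F"
  shows "f \<in> B 1 \<longleftrightarrow> (\<forall>i r. adm n (Suc i) i r \<longrightarrow> pair_coord F i r = 0)"
proof
  assume "f \<in> B 1"
  then obtain g where g: "g \<in> carrier (C 0)" "f = koszul_d n 0 g"
    by (auto simp: coboundaries_def One_nat_def)
  obtain G where G: "rep 0 g G" using g(1) by (rule rep_exists)
  have "rep 1 f (d_coord 0 G)" unfolding g(2) using rep_d[OF G] by (simp add: One_nat_def)
  then have e: "\<forall>b\<in>basis_paths 1. \<forall>r. admp b r \<longrightarrow> F b r = d_coord 0 G b r"
    using rep_eq_iff[OF assms(2) _ cochainD(1)[OF assms(1)] cochainD(1)[OF assms(1)]] by blast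
  show "\<forall>i r. adm n (Suc i) i r \<longrightarrow> pair_coord F i r = 0"
  proof (intro allI impI)
    fix i r assume a: "adm n (Suc i) i r"
    then have i: "i + 2 \<le> n" by (auto simp: adm_arr intro: Nat.gr0I)
    have "F (Suc i, [Arr i]) r = d_coord 0 G (Suc i, [Arr i]) r" "F (i, [Star i]) r = d_coord 0 G (i, [Star i]) r"
      using e arrow_basis[OF i] a adm_sym[of n i "Suc i"] by (simp_all add: admp_def)
    then show "pair_coord F i r = 0" by (simp add: pair_coord_def d_coord_def)
  qed
next
  assume *: "\<forall>i r. adm n (Suc i) i r \<longrightarrow> pair_coord F i r = 0"
  \<comment> \<open>A discrete primitive: partial sums of the values at \<open>Arr i\<close>,
    starting at the vertex 0.\<close>
  define G :: "path \<Rightarrow> nat \<Rightarrow> 'a" where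
    "G b k = (\<Sum>i<fst b. if adm n (Suc i) i (Suc k) then F (Suc i, [Arr i]) (Suc k) else 0)" for b k
  obtain g where g: "g \<in> carrier (C 0)" "rep 0 g G" by (rule rep_ex)
  have "rep 1 (koszul_d n 0 g) (d_coord 0 G)" using rep_d[OF g(2)] by (simp add: One_nat_def)
  moreover have "F b r = d_coord 0 G b r" if b: "b \<in> basis_paths 1" and a: "admp b r" for b r
  proof -
    have "r \<noteq> 0" using a admp_arrow(2)[OF b] by (cases r) auto
    then obtain k where r: "r = Suc k" by (cases r) auto
    from b show ?thesis
    proof (cases rule: basis_1_cases)
      case (1 i)
      then have "adm n (Suc i) i (Suc k)" using a r by (simp add: admp_def)
      then show ?thesis using 1 r by (simp add: d_coord_def G_def)
    next
      case (2 i)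
      then have "adm n (Suc i) i (Suc k)" using a r by (simp add: admp_def adm_sym[of n i "Suc i"])
      then have "F (Suc i, [Arr i]) (Suc k) + F (i, [Star i]) (Suc k) = 0" using * by (auto simp: pair_coord_def)
      then show ?thesis using 2 r \<open>adm n (Suc i) i (Suc k)\<close>
        by (simp add: d_coord_def G_def add_eq_0_iff)
    qed
  qed
  ultimately have "f = koszul_d n 0 g"
    using rep_eq_iff[OF assms(2) _ cochainD(1)[OF assms(1)], of "koszul_d n 0 g" "d_coord 0 G"] d_ext[of 0 g]
    by (simp add: One_nat_def)
  then show "f \<in> B 1" using g(1) by (auto simp: coboundaries_def One_nat_def)
qed

text \<open>In positive degrees a coboundary is the difference of the pair sums of two neighbouring
  edges. Pair sums can be prescribed freely, so the only obstruction is in degree 0.\<close>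

lemma B2_I:
  assumes "f \<in> carrier (C 2)" "rep 2 f F" "\<And>v. v < n \<Longrightarrow> F (v, cyc v) 0 = 0"
  shows "f \<in> B 2"
proof -
  \<comment> \<open>The condition on \<open>b\<close> selects the arrows \<open>Arr i\<close>, so
    each pair sum is the value at one arrow. The minus sign reflects that \<open>d_coord\<close>
    subtracts the pair sum of the higher edge.\<close>
  define G :: "path \<Rightarrow> nat \<Rightarrow> 'a" where
    "G b k = (if b = (fst b, [Arr (fst b - 1)])
       then - (\<Sum>v<fst b. if adm n v v (Suc k) then F (v, cyc v) (Suc k) else 0) else 0)" for b k
  obtain g where g: "g \<in> carrier (C 1)" "rep 1 g G" by (rule rep_ex)
  have "rep 2 (koszul_d n 1 g) (d_coord 1 G)" using rep_d[OF g(2)] by simp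
  moreover have "F b r = d_coord 1 G b r" if b: "b \<in> basis_paths 2" and a: "admp b r" for b r
  proof -
    obtain v where v: "v < n" "b = (v, cyc v)" using b by (auto simp: basis_paths_2)
    then have av: "adm n v v r" using a cyc_path(2)[OF v(1)] by (simp add: admp_def)
    show ?thesis
    proof (cases r)
      case 0
      then show ?thesis using assms(3)[OF v(1)] v by (simp add: d_coord_def)
    next
      case (Suc k)
      then have "v \<noteq> 0" "v < n - 1" using av by (auto simp: adm_loop)
      then obtain i where i: "v = Suc i" by (cases v) auto
      have "pair_coord G i k = - (\<Sum>v<Suc i. if adm n v v (Suc k) then F (v, cyc v) (Suc k) else 0)" for i
        by (simp add: pair_coord_def G_def)
      then show ?thesis using Suc i v \<open>v < n - 1\<close> av by (simp add: d_coord_def)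
    qed
  qed
  ultimately have "f = koszul_d n 1 g"
    using rep_eq_iff[OF assms(2) _ cochainD(1)[OF assms(1)], of "koszul_d n 1 g" "d_coord 1 G"] d_ext[of 1 g]
    by simp
  then show "f \<in> B 2" using g(1) by (auto simp: coboundaries_def numeral_2_eq_2 One_nat_def)
qed

lemma C_trivial:
  assumes "3 \<le> p" "f \<in> carrier (C p)"
  shows "f = \<zero>\<^bsub>C p\<^esub>"
  unfolding rep_eq_iff[OF rep_cochain[OF assms(2)] rep_zero cochainD(1)[OF assms(2)] C_ext(3)]
  using assms(1) by (simp add: basis_paths_def)

lemma C_trivial_B: "3 \<le> p \<Longrightarrow> f \<in> carrier (C p) \<Longrightarrow> f \<in> B p"
  using C_trivial[of p f] submodule.zero_closed[OF B_submodule[of p]] by simp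

lemma HK_trivial:
  assumes "3 \<le> p"
  shows "carrier (H p) = {\<zero>\<^bsub>H p\<^esub>}"
proof -
  have "hk p f = B p" if "f \<in> Z p" for f
    using that C_trivial_B[OF assms] hk_zero_iff Z_carrier by blast
  moreover have "Z p \<noteq> {}" using submodule.zero_closed[OF Z_submodule] by blast
  ultimately show ?thesis unfolding HK_carrier HK_zero by auto
qed

section \<open>The cup product with the fundamental class\<close>

definition euler :: "'a cochain" where
  "euler = (\<lambda>x\<in>W 1. cl x)"

lemma rep_euler: "rep 1 euler euler_coord"
  by (rule rep_cong[OF rep_class]) (simp_all add: euler_def)

lemma euler_Z: "euler \<in> Z 1"
proof -
  have "euler \<in> carrier (C 1)" by (rule rep_imp_cochain[OF rep_euler]) (simp add: euler_def)
  from Z1_iff[OF this rep_euler] show ?thesis by (simp add: pair_coord_def)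
qed

lemma fundamental_class_eq: "fundamental_class n = hk 1 euler"
  by (simp add: fundamental_class_def euler_def)

text \<open>A coboundary has pair sums 0, so every representative has the pair sums of
  \<open>euler\<close>, namely 1 + 1 in degree 1.\<close>

lemma fundamental_classD:
  assumes "f \<in> fundamental_class n"
  shows "f \<in> Z 1" "rep 1 f F \<Longrightarrow> adm n (Suc i) i r \<Longrightarrow> pair_coord F i r = (if r = 1 then 2 else 0)"
proof -
  obtain b where b: "b \<in> B 1" "f = b \<oplus>\<^bsub>C 1\<^esub> euler"
    using assms by (auto simp: fundamental_class_eq hk_eq a_r_coset_def')
  then show f: "f \<in> Z 1" using submodule.m_closed[OF Z_submodule] B_Z euler_Z by blast
  assume F: "rep 1 f F" and a: "adm n (Suc i) i r"
  have bc: "b \<in> carrier (C 1)" using b(1) B_Z Z_carrier by blast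
  then obtain K where K: "rep 1 b K" by (rule rep_exists)
  have K0: "pair_coord K i r = 0" using B1_iff[OF bc K] b(1) a by blast
  have fe: "f \<in> extensional (W 1)" using cochainD(1)[OF Z_carrier[OF f]] .
  have e: "\<forall>b\<in>basis_paths 1. \<forall>r. admp b r \<longrightarrow> F b r = K b r + euler_coord b r"
    using rep_eq_iff[OF F _ fe fe] rep_add[OF K rep_euler] b(2) by blast
  have i: "i + 2 \<le> n" using a by (auto simp: adm_arr intro: Nat.gr0I)
  have "F (Suc i, [Arr i]) r = K (Suc i, [Arr i]) r + euler_coord (Suc i, [Arr i]) r"
    "F (i, [Star i]) r = K (i, [Star i]) r + euler_coord (i, [Star i]) r"
    using e arrow_basis[OF i] a adm_sym[of n i "Suc i"] by (simp_all add: admp_def)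
  then show "pair_coord F i r = (if r = 1 then 2 else 0)" using K0 by (auto simp: pair_coord_def algebra_simps)
qed

text \<open>\<open>HK_cup\<close> is the union of the classes obtained from all representatives; it
  is a class once all of these coincide.\<close>

lemma T_eqI:
  assumes "\<And>f g. f \<in> fundamental_class n \<Longrightarrow> g \<in> X \<Longrightarrow> hk (1 + p) (koszul_cup n 1 p f g) = Y" "X \<noteq> {}"
  shows "T p X = Y"
proof -
  have "euler \<in> fundamental_class n"
    unfolding fundamental_class_eq hk_eq
    by (rule abelian_subgroup.a_rcos_self[OF submodule.abelian_subgroup[OF B_submodule] Z_carrier[OF euler_Z]])
  then show ?thesis using assms unfolding fundamental_cup_def HK_cup_def by blast
qed

lemma hk_rep:
  assumes "X \<in> carrier (H p)"
  shows "X \<noteq> {}" "X \<subseteq> Z p"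
proof -
  obtain g where g: "g \<in> Z p" "X = hk p g" using assms HK_carrier by auto
  show "X \<noteq> {}"
    using abelian_subgroup.a_rcos_self[OF submodule.abelian_subgroup[OF B_submodule] Z_carrier[OF g(1)]]
    unfolding g(2) hk_eq by blast
  show "X \<subseteq> Z p"
    unfolding g(2) hk_eq a_r_coset_def' using submodule.m_closed[OF Z_submodule _ g(1)] B_Z by blast
qed

lemma cup_ext: "koszul_cup n p q f g \<in> extensional (W (p + q))"
  by (simp add: koszul_cup_def)

text \<open>For \<open>p = 1\<close> both factors have positive degree at every arrow, so the
  product has no coordinate in degree 0 and is a coboundary by \<open>B2_I\<close>. For
  \<open>p \<ge> 2\<close> the product lives on W_(p+1) = 0.\<close>

lemma T_zero:
  assumes "1 \<le> p" "X \<in> carrier (H p)"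
  shows "T p X = \<zero>\<^bsub>H (Suc p)\<^esub>"
  unfolding HK_zero
proof (rule T_eqI)
  fix f g :: "'a cochain" assume "f \<in> fundamental_class n" "g \<in> X"
  then have fg: "f \<in> carrier (C 1)" "g \<in> carrier (C p)"
    using fundamental_classD(1) hk_rep(2)[OF assms(2)] Z_carrier by blast+
  then obtain F G where FG: "rep 1 f F" "rep p g G" using rep_exists by metis
  have c: "koszul_cup n 1 p f g \<in> carrier (C (1 + p))"
    by (rule rep_imp_cochain[OF rep_cup[OF FG] cup_ext])
  have "koszul_cup n 1 p f g \<in> B (1 + p)"
  proof (cases "p = 1")
    case True
    have z: "conv F G b c 0 = 0" if "b \<in> basis_paths 1" for b c
      using admp_arrow(2)[OF that] by (simp add: conv_def mask_def)
    have "cup_coord 1 1 F G (v, cyc v) 0 = 0" if v: "v < n" for v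
      using arrow_basis[of v] arrow_basis[of "v - 1"] arrow_basis[of 0] v n_ge
      by (auto simp: cup_coord_11[OF v] z)
    then show ?thesis using B2_I[of "koszul_cup n 1 p f g"] c rep_cup[OF FG] True by simp
  next
    case False
    then show ?thesis using C_trivial_B[OF _ c] assms(1) by simp
  qed
  then show "hk (1 + p) (koszul_cup n 1 p f g) = B (Suc p)"
    unfolding hk_zero_iff[OF c, symmetric] by (simp only: Suc_eq_plus1_left)
qed (rule hk_rep(1)[OF assms(2)])

text \<open>The cocycle \<open>g\<close> takes equal values at the two ends of an edge, so it
  factors out of the sum over \<open>Arr i\<close> and \<open>Star i\<close>. What remains are the
  pair sums of \<open>f\<close>, and only the one in degree 1 survives.\<close>

lemma cup_0_pair_coord:
  assumes "rep 1 f F" "\<And>i r. adm n (Suc i) i r \<Longrightarrow> pair_coord F i r = (if r = 1 then 2 else 0)"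
    "g \<in> Z 0" "rep 0 g G" "rep 1 h K" "h = koszul_cup n 1 0 f g" "adm n (Suc i) i (Suc k)"
  shows "pair_coord K i (Suc k) = 2 * G (i, []) k"
proof -
  let ?r = "Suc k"
  have Z: "adm n (Suc i) i (Suc l) \<Longrightarrow> G (i, []) l = G (Suc i, []) l" for l
    using Z0_iff[OF Z_carrier[OF assms(3)] assms(4)] assms(3) by blast
  have i: "i + 2 \<le> n" using assms(7) by (auto simp: adm_arr)
  note ab = arrow_basis[OF i]
  have "rep 1 h (\<lambda>e r. cup_coord 1 0 F G e r)"
    using rep_cup[OF assms(1,4)] assms(6) by simp
  moreover have "h \<in> extensional (W 1)" using cup_ext[of 1 0 f g] assms(6) by simp
  ultimately have "\<forall>b\<in>basis_paths 1. \<forall>r. admp b r \<longrightarrow> K b r = cup_coord 1 0 F G b r"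
    using rep_eq_iff[OF assms(5)] by blast
  then have "pair_coord K i ?r = conv F G (Suc i, [Arr i]) (i, []) ?r + conv F G (i, [Star i]) (Suc i, []) ?r"
    unfolding pair_coord_def using ab assms(7) adm_sym[of n i "Suc i"] by (simp add: admp_def cup_coord_10)
  also have "\<dots> = (\<Sum>s\<le>?r. mask F (Suc i, [Arr i]) s * mask G (i, []) (?r - s) +
      mask F (i, [Star i]) s * mask G (Suc i, []) (?r - s))"
    unfolding conv_def by (rule sum.distrib[symmetric])
  also have "\<dots> = (\<Sum>s\<le>?r. if s = 1 then 2 * G (i, []) k else 0)"
  proof (rule sum.cong[OF refl])
    fix s assume s: "s \<in> {..?r}"
    show "mask F (Suc i, [Arr i]) s * mask G (i, []) (?r - s) +
        mask F (i, [Star i]) s * mask G (Suc i, []) (?r - s) = (if s = 1 then 2 * G (i, []) k else 0)"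
    proof (cases "adm n (Suc i) i s")
      case False
      then have "mask F (Suc i, [Arr i]) s = 0" "mask F (i, [Star i]) s = 0"
        using adm_sym[of n i "Suc i"] by (auto simp: mask_def admp_def)
      moreover have "adm n (Suc i) i 1" using assms(7) by (auto simp: adm_arr)
      then have "s \<noteq> 1" using False by metis
      ultimately show ?thesis by simp
    next
      case True
      then have "odd s" by (simp add: adm_arr)
      moreover from this have "1 \<le> s" by (cases s) auto
      \<comment> \<open>Since \<open>s\<close> is odd and at least 1, the complementary degree is
        even and at most \<open>k\<close>; the bounds for \<open>Suc k\<close> carry over, and the
        cocycle condition applies in that degree.\<close>
      ultimately have a: "adm n (Suc i) i (Suc (?r - s))" "adm n i i (?r - s)" "adm n (Suc i) (Suc i) (?r - s)"
        using s assms(7) unfolding adm_arr adm_loop by auto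
      then have "mask G (i, []) (?r - s) = G (i, []) (?r - s)" "mask G (Suc i, []) (?r - s) = G (i, []) (?r - s)"
        using Z[OF a(1)] by (simp_all add: mask_def admp_def)
      moreover have "mask F (Suc i, [Arr i]) s = F (Suc i, [Arr i]) s" "mask F (i, [Star i]) s = F (i, [Star i]) s"
        using True adm_sym[of n i "Suc i"] by (auto simp: mask_def admp_def)
      ultimately have "mask F (Suc i, [Arr i]) s * mask G (i, []) (?r - s) +
          mask F (i, [Star i]) s * mask G (Suc i, []) (?r - s) = pair_coord F i s * G (i, []) (?r - s)"
        by (simp add: pair_coord_def distrib_right)
      then show ?thesis using assms(2)[OF True] by auto
    qed
  qed
  also have "\<dots> = 2 * G (i, []) k" by simp
  finally show ?thesis .
qed

text \<open>The class is computed from the representative \<open>euler\<close>. Any other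
  representative yields the same pair sums, hence the same class by \<open>B1_iff\<close>.\<close>

lemma T_0:
  assumes "g \<in> Z 0" "rep 0 g G"
  obtains h K where "h \<in> Z 1" "rep 1 h K" "T 0 (hk 0 g) = hk 1 h"
    "\<And>i k. adm n (Suc i) i (Suc k) \<Longrightarrow> pair_coord K i (Suc k) = 2 * G (i, []) k"
proof -
  let ?h = "koszul_cup n 1 0 euler g"
  have gc: "g \<in> carrier (C 0)" using assms(1) by (rule Z_carrier)
  have cup: "koszul_cup n 1 0 f g \<in> carrier (C 1)" if "rep 1 f F" for f F
    using rep_imp_cochain[OF rep_cup[OF that assms(2)] cup_ext] by simp
  have hc: "?h \<in> carrier (C 1)" by (rule cup[OF rep_euler])
  obtain K where K: "rep 1 ?h K" using hc by (rule rep_exists)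
  have "euler \<in> fundamental_class n"
    unfolding fundamental_class_eq hk_eq
    by (rule abelian_subgroup.a_rcos_self[OF submodule.abelian_subgroup[OF B_submodule] Z_carrier[OF euler_Z]])
  note GK = cup_0_pair_coord[OF rep_euler fundamental_classD(2)[OF this rep_euler] assms K refl]
  have hZ: "?h \<in> Z 1"
    unfolding Z1_iff[OF hc K]
  proof (intro allI impI)
    fix i k assume a: "adm n (Suc i) (Suc i) (Suc k)"
    then have "odd k" by (simp add: adm_loop)
    then obtain l where k: "k = Suc l" by (cases k) auto
    \<comment> \<open>An admissible loop of length \<open>l + 2\<close> makes both adjacent edges
      admissible in degree \<open>l + 1\<close>, so both pair sums are twice a value of
      \<open>G\<close>, and these values agree because \<open>g\<close> is a cocycle.\<close>
    have a1: "adm n (Suc i) i (Suc l)" "adm n (Suc (Suc i)) (Suc i) (Suc l)"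
      using a k by (auto simp: adm_loop adm_arr)
    then show "pair_coord K i k = pair_coord K (Suc i) k"
      using GK Z0_iff[OF gc assms(2)] assms(1) k by metis
  qed
  have "T 0 (hk 0 g) = hk 1 ?h"
  proof (rule T_eqI)
    fix f g' :: "'a cochain" assume f: "f \<in> fundamental_class n" and "g' \<in> hk 0 g"
    then have g': "g' = g" using hk_0[OF gc] by simp
    have fZ: "f \<in> Z 1" by (rule fundamental_classD(1)[OF f])
    obtain F where F: "rep 1 f F" using Z_carrier[OF fZ] by (rule rep_exists)
    have c: "koszul_cup n 1 0 f g \<in> carrier (C 1)" by (rule cup[OF F])
    obtain L where L: "rep 1 (koszul_cup n 1 0 f g) L" using c by (rule rep_exists)
    note GL = cup_0_pair_coord[OF F fundamental_classD(2)[OF f F] assms L refl]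
    have "hk 1 (koszul_cup n 1 0 f g) = hk 1 ?h"
      unfolding hk_eq_iff[OF c hc]
        B1_iff[OF C_add_closed[OF hc C_smult_closed[OF c]] rep_add[OF K rep_smult[OF L]]]
    proof (intro allI impI)
      fix i r assume a: "adm n (Suc i) i r"
      then obtain k where "r = Suc k" by (cases r) (auto simp: adm_arr)
      then show "pair_coord (\<lambda>b r. K b r + - 1 * L b r) i r = 0"
        using GK[of i k] GL[of i k] a by (simp add: pair_coord_def algebra_simps)
    qed
    then show "hk (1 + 0) (koszul_cup n 1 0 f g') = hk 1 ?h" by (simp add: g')
  qed (simp add: hk_0[OF gc])
  then show thesis using that hZ K GK by blast
qed

lemma T_0_closed: "X \<in> carrier (H 0) \<Longrightarrow> T 0 X \<in> carrier (H 1)"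
proof -
  assume "X \<in> carrier (H 0)"
  then obtain g where g: "g \<in> Z 0" "X = hk 0 g" using HK_carrier by auto
  obtain G where "rep 0 g G" using Z_carrier[OF g(1)] by (rule rep_exists)
  from T_0[OF g(1) this] obtain h where "h \<in> Z 1" "T 0 (hk 0 g) = hk 1 h" by metis
  then show ?thesis using g HK_carrier by auto
qed

lemma T_0_zero_iff:
  assumes "g \<in> Z 0" "rep 0 g G"
  shows "T 0 (hk 0 g) = \<zero>\<^bsub>H (Suc 0)\<^esub> \<longleftrightarrow> (\<forall>i k. adm n (Suc i) i (Suc k) \<longrightarrow> 2 * G (i, []) k = 0)"
proof -
  obtain h K where h: "h \<in> Z 1" "rep 1 h K" "T 0 (hk 0 g) = hk 1 h"
    "\<And>i k. adm n (Suc i) i (Suc k) \<Longrightarrow> pair_coord K i (Suc k) = 2 * G (i, []) k"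
    using T_0[OF assms] by metis
  have "T 0 (hk 0 g) = \<zero>\<^bsub>H (Suc 0)\<^esub> \<longleftrightarrow> h \<in> B 1"
    unfolding HK_zero h(3) One_nat_def[symmetric] by (rule hk_zero_iff[OF Z_carrier[OF h(1)]])
  also have "\<dots> \<longleftrightarrow> (\<forall>i r. adm n (Suc i) i r \<longrightarrow> pair_coord K i r = 0)"
    by (rule B1_iff[OF Z_carrier[OF h(1)] h(2)])
  also have "\<dots> \<longleftrightarrow> (\<forall>i k. adm n (Suc i) i (Suc k) \<longrightarrow> 2 * G (i, []) k = 0)"
  proof (intro iffI allI impI)
    fix i r assume *: "\<forall>i k. adm n (Suc i) i (Suc k) \<longrightarrow> 2 * G (i, []) k = 0" and a: "adm n (Suc i) i r"
    then obtain k where "r = Suc k" by (cases r) (auto simp: adm_arr)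
    then show "pair_coord K i r = 0" using * a h(4) by metis
  qed (use h(4) in metis)
  finally show ?thesis .
qed

text \<open>A class in HK^1 is given by pair sums that agree on neighbouring edges; half of them is
  a function constant along the vertices, that is, an element of HK^0.\<close>

lemma T_0_surj:
  assumes "(2 :: 'a) \<noteq> 0" "Y \<in> carrier (H 1)"
  shows "\<exists>X\<in>carrier (H 0). T 0 X = Y"
proof -
  obtain f where f: "f \<in> Z 1" "Y = hk 1 f" using assms(2) HK_carrier by auto
  have fc: "f \<in> carrier (C 1)" using f(1) by (rule Z_carrier)
  obtain F where F: "rep 1 f F" using fc by (rule rep_exists)
  \<comment> \<open>The edge above \<open>v\<close> supplies the value if the degree is admissible
    there, otherwise the edge below. Where both are admissible they agree, since \<open>f\<close> is
    a cocycle.\<close>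
  define G :: "path \<Rightarrow> nat \<Rightarrow> 'a" where
    "G b k = (let v = fst b in if adm n (Suc v) v (Suc k) then pair_coord F v (Suc k) / 2
       else if v \<noteq> 0 then pair_coord F (v - 1) (Suc k) / 2 else 0)" for b k
  obtain g where g: "g \<in> carrier (C 0)" "rep 0 g G" by (rule rep_ex)
  have gZ: "g \<in> Z 0"
    unfolding Z0_iff[OF g]
  proof (intro allI impI)
    fix i k assume a: "adm n (Suc i) i (Suc k)"
    show "G (i, []) k = G (Suc i, []) k"
    proof (cases "adm n (Suc (Suc i)) (Suc i) (Suc k)")
      case True
      then have "adm n (Suc i) (Suc i) (Suc (Suc k))" using a by (auto simp: adm_loop adm_arr)
      then have "pair_coord F i (Suc k) = pair_coord F (Suc i) (Suc k)" using Z1_iff[OF fc F] f(1) by blast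
      then show ?thesis using a True by (simp add: G_def)
    qed (use a in \<open>simp add: G_def\<close>)
  qed
  obtain h K where h: "h \<in> Z 1" "rep 1 h K" "T 0 (hk 0 g) = hk 1 h"
    "\<And>i k. adm n (Suc i) i (Suc k) \<Longrightarrow> pair_coord K i (Suc k) = 2 * G (i, []) k"
    using T_0[OF gZ g(2)] by metis
  have hc: "h \<in> carrier (C 1)" using h(1) by (rule Z_carrier)
  have "hk 1 h = hk 1 f"
    unfolding hk_eq_iff[OF hc fc]
      B1_iff[OF C_add_closed[OF fc C_smult_closed[OF hc]] rep_add[OF F rep_smult[OF h(2)]]]
  proof (intro allI impI)
    fix i r assume a: "adm n (Suc i) i r"
    then obtain k where r: "r = Suc k" by (cases r) (auto simp: adm_arr)
    then have "pair_coord K i r = pair_coord F i r" using h(4)[of i k] a assms(1) by (simp add: G_def)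
    then show "pair_coord (\<lambda>b r. F b r + - 1 * K b r) i r = 0" by (simp add: pair_coord_def algebra_simps)
  qed
  then show ?thesis using h(3) f(2) gZ HK_carrier by auto
qed

end

section \<open>Higher Koszul cohomology\<close>

lemma carrier_submodule:
  assumes "Module.module R M"
  shows "submodule R (carrier M) M"
proof -
  interpret Module.module R M by fact
  show ?thesis by (rule submodule.intro) (auto intro: assms)
qed

lemma char_2_iff: "CHAR('a::field) = 2 \<longleftrightarrow> (2 :: 'a) = 0"
proof
  assume "CHAR('a) = 2"
  then show "(2 :: 'a) = 0" using of_nat_CHAR[where ?'a = 'a] by simp
next
  assume "(2 :: 'a) = 0"
  then have "of_nat 2 = (0 :: 'a)" by simp
  then have "CHAR('a) dvd 2" by (simp only: of_nat_eq_0_iff_char_dvd)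
  moreover have "CHAR('a) \<noteq> 1" using of_nat_CHAR[where ?'a = 'a] by (metis of_nat_1 one_neq_zero)
  ultimately show "CHAR('a) = 2" using prime_nat_iff two_is_prime_nat by blast
qed

lemma concat_replicate_snoc: "concat (replicate (Suc l) xs) = concat (replicate l xs) @ xs"
  by (induction l) auto

context typeA
begin

abbreviation "ZZ p \<equiv> cocycles (HK n :: nat \<Rightarrow> ('a, 'a cochain set) module) (fundamental_cup n) p"
abbreviation "BB p \<equiv> coboundaries (HK n :: nat \<Rightarrow> ('a, 'a cochain set) module) (fundamental_cup n) p"
abbreviation "V p \<equiv> HKhi n p :: ('a, 'a cochain set set) module"
abbreviation "hi p \<equiv> HKhi_class n p :: 'a cochain set \<Rightarrow> 'a cochain set set"

section \<open>From the product on HK to its cohomology\<close>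

lemma V_carrier: "carrier (V p) = hi p ` ZZ p"
  unfolding HKhi_def HKhi_class_def by (rule cohomology_sel)

lemma V_zero: "\<zero>\<^bsub>V p\<^esub> = BB p"
  unfolding HKhi_def by (rule cohomology_sel)

lemma H_zero_closed: "\<zero>\<^bsub>H p\<^esub> \<in> carrier (H p)"
proof -
  interpret Module.module class_ring "H p" by (rule HK_module)
  show ?thesis by simp
qed

lemma hi_zero_coboundaries:
  assumes "BB p = {\<zero>\<^bsub>H p\<^esub>}" "X \<in> carrier (H p)"
  shows "hi p X = {X}"
proof -
  interpret Module.module class_ring "H p" by (rule HK_module)
  show ?thesis using assms by (simp add: HKhi_class_def coh_class_def a_r_coset_def')
qed

lemma HKhi_equalsI:
  assumes "ZZ p = S" "BB p = {\<zero>\<^bsub>H p\<^esub>}"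
  shows "HKhi_equals n p S"
proof -
  have "S \<subseteq> carrier (H p)" using assms(1) by (auto simp: cocycles_def)
  then have h: "hi p X = {X}" if "X \<in> S" for X using hi_zero_coboundaries[OF assms(2)] that by blast
  have "inj_on (hi p) S"
  proof (rule inj_onI)
    fix X Y assume "X \<in> S" "Y \<in> S" "hi p X = hi p Y"
    then show "X = Y" using h[of X] h[of Y] by simp
  qed
  then show ?thesis
    using assms(1) unfolding HKhi_equals_def V_carrier by (simp add: bij_betw_def)
qed

text \<open>The second hypothesis exhibits \<open>BB p\<close> as a submodule, so that each of its
  elements represents the zero coset.\<close>

lemma HKhi_trivialI:
  assumes "ZZ p = BB p" "BB p = {\<zero>\<^bsub>H p\<^esub>} \<or> BB p = carrier (H p)"
  shows "carrier (V p) = {\<zero>\<^bsub>V p\<^esub>}"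
proof -
  have sub: "submodule class_ring (BB p) (H p)"
    using assms(2) zero_submodule[OF HK_module] carrier_submodule[OF HK_module] by metis
  have "hi p X = BB p" if "X \<in> BB p" for X
    unfolding HKhi_class_def coh_class_def
    using submodule.coset_eq_self_iff[OF sub] that submodule.subset[OF sub] by blast
  moreover have "BB p \<noteq> {}" using submodule.zero_closed[OF sub] by blast
  ultimately show ?thesis unfolding V_carrier V_zero assms(1) by auto
qed

lemma BB_0: "BB 0 = {\<zero>\<^bsub>H 0\<^esub>}"
  by (simp add: coboundaries_def)

lemma BB_Suc: "BB (Suc p) = T p ` carrier (H p)"
  by (simp add: coboundaries_def)

lemma BB_zero:
  assumes "\<And>X. X \<in> carrier (H p) \<Longrightarrow> T p X = \<zero>\<^bsub>H (Suc p)\<^esub>"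
  shows "BB (Suc p) = {\<zero>\<^bsub>H (Suc p)\<^esub>}" "ZZ p = carrier (H p)"
  using assms H_zero_closed[of p] unfolding BB_Suc cocycles_def by auto

lemma BB_ge_2: "2 \<le> p \<Longrightarrow> BB p = {\<zero>\<^bsub>H p\<^esub>}"
  using BB_zero(1)[OF T_zero, of "p - 1"] by simp

lemma ZZ_ge_1: "1 \<le> p \<Longrightarrow> ZZ p = carrier (H p)"
  using BB_zero(2)[OF T_zero] by simp

text \<open>The product into HK^2 and the product out of it both vanish by
  \<open>T_zero\<close>.\<close>

lemma HKhi_2: "HKhi_equals n 2 (carrier (H 2))"
  by (rule HKhi_equalsI) (simp_all add: ZZ_ge_1 BB_ge_2)

lemma HKhi_ge_3:
  assumes "3 \<le> p"
  shows "carrier (V p) = {\<zero>\<^bsub>V p\<^esub>}"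
proof (rule HKhi_trivialI)
  show "ZZ p = BB p" using assms ZZ_ge_1[of p] BB_ge_2[of p] HK_trivial[OF assms] by simp
  show "BB p = {\<zero>\<^bsub>H p\<^esub>} \<or> BB p = carrier (H p)" using assms BB_ge_2[of p] by simp
qed

lemma T_0_char_2:
  assumes "(2 :: 'a) = 0" "X \<in> carrier (H 0)"
  shows "T 0 X = \<zero>\<^bsub>H (Suc 0)\<^esub>"
proof -
  obtain g where g: "g \<in> Z 0" "X = hk 0 g" using assms(2) HK_carrier by auto
  obtain G where "rep 0 g G" using Z_carrier[OF g(1)] by (rule rep_exists)
  from T_0_zero_iff[OF g(1) this] show ?thesis using assms(1) g(2) by simp
qed

lemma HKhi_char_2:
  assumes "(2 :: 'a) = 0"
  shows "HKhi_equals n p (carrier (H p))"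
proof (rule HKhi_equalsI)
  have T: "T p X = \<zero>\<^bsub>H (Suc p)\<^esub>" if "X \<in> carrier (H p)" for p X
    using T_0_char_2[OF assms] T_zero that by (cases p) auto
  show "ZZ p = carrier (H p)" by (rule BB_zero(2)[OF T])
  show "BB p = {\<zero>\<^bsub>H p\<^esub>}" using BB_0 BB_zero(1)[OF T] by (cases p) auto
qed

text \<open>The product with the fundamental class vanishes on HK^1, but its image from HK^0 is all
  of HK^1 once 2 is invertible.\<close>

lemma HKhi_1:
  assumes "(2 :: 'a) \<noteq> 0"
  shows "carrier (V 1) = {\<zero>\<^bsub>V 1\<^esub>}"
proof (rule HKhi_trivialI)
  have "BB (Suc 0) = carrier (H (Suc 0))"
    using T_0_closed T_0_surj[OF assms] unfolding BB_Suc by (auto simp: One_nat_def)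
  then have "BB 1 = carrier (H 1)" by (simp only: One_nat_def)
  then show "ZZ 1 = BB 1" "BB 1 = {\<zero>\<^bsub>H 1\<^esub>} \<or> BB 1 = carrier (H 1)"
    using ZZ_ge_1[of 1] by auto
qed

text \<open>The summand \<open>F x\<^sub>v\<^sup>l\<close> of \<open>e\<^sub>v A e\<^sub>v\<close>, where \<open>k = 2 l\<close>, survives in one of the neighbouring
  \<open>e\<^sub>v\<^sub>+\<^sub>1 A e\<^sub>v\<close> and \<open>e\<^sub>v A e\<^sub>v\<^sub>-\<^sub>1\<close> unless it is the socle of \<open>e\<^sub>v A\<close> for the middle vertex \<open>v\<close>.\<close>

lemma T_0_zero_support:
  assumes "(2 :: 'a) \<noteq> 0" "g \<in> Z 0" "rep 0 g G"
  shows "T 0 (hk 0 g) = \<zero>\<^bsub>H (Suc 0)\<^esub> \<longleftrightarrow>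
    (\<forall>v k. adm n v v k \<longrightarrow> \<not> (k = 2 * v \<and> n - 1 = 2 * v) \<longrightarrow> G (v, []) k = 0)"
  unfolding T_0_zero_iff[OF assms(2,3)]
proof (intro iffI allI impI)
  fix v k assume *: "\<forall>i k. adm n (Suc i) i (Suc k) \<longrightarrow> 2 * G (i, []) k = 0"
    and a: "adm n v v k" and ne: "\<not> (k = 2 * v \<and> n - 1 = 2 * v)"
  have k: "even k" "k \<le> 2 * v" "2 * v + k \<le> 2 * (n - 1)" using a by (simp_all add: adm_loop)
  show "G (v, []) k = 0"
  proof (cases "2 * v + k = 2 * (n - 1)")
    case False
    obtain l where l: "k = 2 * l" using k(1) by (rule evenE)
    \<comment> \<open>Both sides of the bound are even, so strict inequality leaves room for 2, as
      the longer path to the next vertex requires.\<close>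
    then have "v + l < n - 1" using False k(3) by linarith
    then have "2 * v + k + 2 \<le> 2 * (n - 1)" using l by linarith
    then have "adm n (Suc v) v (Suc k)" using k by (simp add: adm_arr)
    then show ?thesis using * assms(1) by (metis mult_eq_0_iff)
  next
    case True
    then have "k \<noteq> 2 * v" using ne by auto
    then have k2: "k + 2 \<le> 2 * v" using k(1,2) by presburger
    then obtain i where v: "v = Suc i" by (cases v) auto
    have ai: "adm n (Suc i) i (Suc k)" using k k2 v by (simp add: adm_arr)
    then have "G (i, []) k = 0" using * assms(1) by (metis mult_eq_0_iff)
    moreover have "G (i, []) k = G (Suc i, []) k"
      using Z0_iff[OF Z_carrier[OF assms(2)] assms(3)] assms(2) ai by blast
    ultimately show ?thesis by (simp add: v)
  qed
next
  fix i k assume *: "\<forall>v k. adm n v v k \<longrightarrow> \<not> (k = 2 * v \<and> n - 1 = 2 * v) \<longrightarrow> G (v, []) k = 0"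
    and a: "adm n (Suc i) i (Suc k)"
  then have "adm n i i k" "\<not> (k = 2 * i \<and> n - 1 = 2 * i)" by (auto simp: adm_arr adm_loop)
  then show "2 * G (i, []) k = 0" using * by simp
qed

lemma rep_0_zero_iff:
  assumes "g \<in> carrier (C 0)" "rep 0 g G"
  shows "g \<in> B 0 \<longleftrightarrow> (\<forall>v k. adm n v v k \<longrightarrow> G (v, []) k = 0)"
proof -
  have "g \<in> B 0 \<longleftrightarrow> g = \<zero>\<^bsub>C 0\<^esub>" by (simp add: coboundaries_def)
  also have "\<dots> \<longleftrightarrow> (\<forall>b\<in>basis_paths 0. \<forall>r. admp b r \<longrightarrow> G b r = 0)"
    by (rule rep_eq_iff[OF assms(2) rep_zero cochainD(1)[OF assms(1)] C_ext(3)])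
  also have "\<dots> \<longleftrightarrow> (\<forall>v k. adm n v v k \<longrightarrow> G (v, []) k = 0)"
  proof (intro iffI allI impI ballI)
    fix v k assume *: "\<forall>b\<in>basis_paths 0. \<forall>r. admp b r \<longrightarrow> G b r = 0" and a: "adm n v v k"
    have "v < n" using adm_bounds[OF a] n_ge by simp
    then show "G (v, []) k = 0" using * a by (auto simp: basis_paths_0 admp_def)
  qed (auto simp: basis_paths_0 admp_def)
  finally show ?thesis .
qed

text \<open>The exceptional coordinate in \<open>T_0_zero_support\<close> needs a vertex with
  \<open>n - 1 = 2 * v\<close>, which parity excludes.\<close>

lemma HKhi_0_even:
  assumes "(2 :: 'a) \<noteq> 0" "even n"
  shows "carrier (V 0) = {\<zero>\<^bsub>V 0\<^esub>}"
proof (rule HKhi_trivialI)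
  have "X = \<zero>\<^bsub>H 0\<^esub>" if "X \<in> ZZ 0" for X
  proof -
    have X: "X \<in> carrier (H 0)" "T 0 X = \<zero>\<^bsub>H (Suc 0)\<^esub>" using that by (auto simp: cocycles_def)
    obtain g where g: "g \<in> Z 0" "X = hk 0 g" using X(1) HK_carrier by auto
    obtain G where G: "rep 0 g G" using Z_carrier[OF g(1)] by (rule rep_exists)
    have "odd (n - 1)" using assms(2) n_ge by simp
    then have "n - 1 \<noteq> 2 * v" for v by (metis dvd_triv_left)
    then have "g \<in> B 0"
      using T_0_zero_support[OF assms(1) g(1) G] X(2) g(2) rep_0_zero_iff[OF Z_carrier[OF g(1)] G] by blast
    then show ?thesis using hk_zero_iff[OF Z_carrier[OF g(1)]] g(2) HK_zero by simp
  qed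
  moreover have "\<zero>\<^bsub>H 0\<^esub> \<in> ZZ 0"
  proof -
    have z: "\<zero>\<^bsub>C 0\<^esub> \<in> Z 0" by (rule submodule.zero_closed[OF Z_submodule])
    have "hk 0 \<zero>\<^bsub>C 0\<^esub> = \<zero>\<^bsub>H 0\<^esub>"
      unfolding HK_zero hk_zero_iff[OF C_zero_closed] by (rule submodule.zero_closed[OF B_submodule])
    then show ?thesis using T_0_zero_iff[OF z rep_zero] H_zero_closed by (simp add: cocycles_def)
  qed
  ultimately show "ZZ 0 = BB 0" unfolding BB_0 by blast
  show "BB 0 = {\<zero>\<^bsub>H 0\<^esub>} \<or> BB 0 = carrier (H 0)" by (simp add: BB_0)
qed


section \<open>The middle of the centre\<close>

lemma class_arrow:
  assumes "i + 2 \<le> n"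
  shows "cl (arrow_elt (Star i)) \<otimes>\<^bsub>A\<^esub> cl (arrow_elt (Arr i)) = pc i [Star i, Arr i]"
proof -
  have p: "is_path n (i, [Star i, Arr i])" using assms by (auto simp: arrows_def)
  have c: "cl (arrow_elt (Star i)) = pc i [Star i]" "cl (arrow_elt (Arr i)) = pc (Suc i) [Arr i]"
    by (simp_all add: arrow_elt_eq)
  show ?thesis using pc_Cons[OF p] unfolding c by simp
qed

text \<open>The exponent is positive because the zeroth power is the unit of A and not the
  idempotent at \<open>i\<close>.\<close>

lemma class_loop_power:
  assumes "i + 2 \<le> n"
  shows "pc i [Star i, Arr i] [^]\<^bsub>A\<^esub> Suc l = pc i (concat (replicate (Suc l) [Star i, Arr i])) \<and>
    is_path n (i, concat (replicate (Suc l) [Star i, Arr i])) \<and>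
    path_source (i, concat (replicate (Suc l) [Star i, Arr i])) = i"
proof (induction l)
  case 0
  have "is_path n (i, [Star i, Arr i])" using assms by (auto simp: arrows_def)
  then show ?case by simp
next
  case (Suc l)
  let ?xs = "concat (replicate (Suc l) [Star i, Arr i])"
  have e: "concat (replicate (Suc (Suc l)) [Star i, Arr i]) = ?xs @ [Star i, Arr i]"
    by (rule concat_replicate_snoc)
  have p: "is_path n (i, ?xs @ [Star i, Arr i])"
    using Suc assms unfolding is_path_append by (auto simp: arrows_def)
  have "pc i [Star i, Arr i] [^]\<^bsub>A\<^esub> Suc (Suc l) = pc i ?xs \<otimes>\<^bsub>A\<^esub> pc i [Star i, Arr i]"
    using Suc by (simp only: A.nat_pow_Suc)
  also have "\<dots> = pc i (?xs @ [Star i, Arr i])"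
    using pc_mult[OF p] Suc by simp
  finally show ?case unfolding e using p Suc by (simp only: path_source_append) simp
qed

text \<open>A loop of length \<open>2 * m = n - 1\<close> at \<open>v\<close> is admissible only if
  \<open>m \<le> v\<close> and \<open>v \<le> m\<close>. So every summand of z except the one at the
  middle vertex is zero.\<close>

lemma z_elt_co:
  assumes "n = 2 * m + 1" 
  shows "z_elt n m \<in> carrier A" and "coord n (z_elt n m :: 'a path_fun set) j i r = (if j = m \<and> i = m \<and> r = 2 * m then 1 else 0)"
proof -
  obtain l where l: "m = Suc l" using assms n_ge by (cases m) auto
  let ?xs = "\<lambda>v. concat (replicate (Suc l) [Star v, Arr v])"
  have len: "length (?xs v) = 2 * m" for v
    by (simp add: length_concat sum_list_replicate l)
  have t: "(cl (arrow_elt (Star v)) \<otimes>\<^bsub>A\<^esub> cl (arrow_elt (Arr v))) [^]\<^bsub>A\<^esub> m = pc v (?xs v)"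
    "is_path n (v, ?xs v)" "path_source (v, ?xs v) = v" if "v \<in> {1..n - 2}" for v
  proof -
    have v: "v + 2 \<le> n" using that n_ge by auto
    show "(cl (arrow_elt (Star v)) \<otimes>\<^bsub>A\<^esub> cl (arrow_elt (Arr v))) [^]\<^bsub>A\<^esub> m = pc v (?xs v)"
      "is_path n (v, ?xs v)" "path_source (v, ?xs v) = v"
      unfolding class_arrow[OF v] l using class_loop_power[OF v, of l] by blast+
  qed
  have tc: "(cl (arrow_elt (Star v)) \<otimes>\<^bsub>A\<^esub> cl (arrow_elt (Arr v))) [^]\<^bsub>A\<^esub> m \<in> carrier A"
    if "v \<in> {1..n - 2}" for v
    unfolding t(1)[OF that] by (rule cl_closed[OF path_elt_closed[OF t(2)[OF that]]])
  show "z_elt n m \<in> carrier A" unfolding z_elt_def using tc by (intro A.finsum_closed) blast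
  have "coord n (z_elt n m) j i r =
      (\<Sum>v\<in>{1..n - 2}. coord n ((cl (arrow_elt (Star v)) \<otimes>\<^bsub>A\<^esub> cl (arrow_elt (Arr v))) [^]\<^bsub>A\<^esub> m) j i r)"
    unfolding z_elt_def by (rule coord_finsum[OF tc])
  also have "\<dots> = (\<Sum>v\<in>{1..n - 2}. if v = m then if j = m \<and> i = m \<and> r = 2 * m then 1 else 0 else 0)"
  proof (rule sum.cong[OF refl])
    fix v assume v: "v \<in> {1..n - 2}"
    have "adm n v v (2 * m) \<longleftrightarrow> v = m" using assms by (auto simp: adm_loop)
    then show "coord n ((cl (arrow_elt (Star v)) \<otimes>\<^bsub>A\<^esub> cl (arrow_elt (Arr v))) [^]\<^bsub>A\<^esub> m) j i r =
        (if v = m then if j = m \<and> i = m \<and> r = 2 * m then 1 else 0 else 0)"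
      unfolding t(1)[OF v] coord_path_elt[OF t(2)[OF v]] t(3)[OF v] len by auto
  qed
  also have "\<dots> = (if j = m \<and> i = m \<and> r = 2 * m then 1 else 0)"
  proof -
    have "m \<in> {1..n - 2}" using assms l by simp
    then show ?thesis by simp
  qed
  finally show "coord n (z_elt n m :: 'a path_fun set) j i r = (if j = m \<and> i = m \<and> r = 2 * m then 1 else 0)" .
qed

definition z_cochain :: "nat \<Rightarrow> 'a cochain" where
  "z_cochain m = (\<lambda>x\<in>W 0. cl x \<otimes>\<^bsub>A\<^esub> z_elt n m)"

lemma rep_z_cochain:
  assumes "n = 2 * m + 1"
  shows "rep 0 (z_cochain m) (\<lambda>b r. if b = (m, []) \<and> r = 2 * m then 1 else 0)"
proof (rule repI)
  fix w assume w: "w \<in> W 0"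
  note z = z_elt_co[OF assms]
  have wp: "w \<in> PG 0" using w by (simp add: W_eq)
  then have wc: "cl w \<in> carrier A" by (intro cl_closed path_grade_carrier)
  then show "z_cochain m w \<in> carrier A" using w z(1) by (simp add: z_cochain_def)
  fix j i r assume a: "adm n j i r"
  then have "i < n" using adm_bounds n_ge by auto
  \<comment> \<open>A unit is inserted on the right so that \<open>coord_sandwich\<close>
    applies.\<close>
  have "z_cochain m w = cl w \<otimes>\<^bsub>A\<^esub> (z_elt n m \<otimes>\<^bsub>A\<^esub> cl \<one>\<^bsub>PA\<^esub>)"
    using w z(1) by (simp add: z_cochain_def cl_one[symmetric])
  then have "coord n (z_cochain m w) j i r = w (j, []) * (coord n (z_elt n m) j i r * \<one>\<^bsub>PA\<^esub> (i, []))"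
    using coord_sandwich[OF wp PG0_one z(1)] by simp
  also have "\<dots> = (if j = m \<and> i = m \<and> r = 2 * m then w (m, []) else 0)"
    using \<open>i < n\<close> by (simp add: z(2) path_alg_sel(3))
  also have "\<dots> = (\<Sum>b\<in>basis_paths 0. if b = (m, []) then if j = m \<and> i = m \<and> r = 2 * m then w (m, []) else 0 else 0)"
  proof -
    have "m < n" using assms by simp
    then have "(m, []) \<in> basis_paths 0" by (simp add: basis_paths_0)
    then show ?thesis by simp
  qed
  also have "\<dots> = (\<Sum>b\<in>basis_paths 0. if fst b = j \<and> path_source b = i
      then w b * (if b = (m, []) \<and> r = 2 * m then 1 else 0) else 0)"
    by (rule sum.cong) (auto simp: basis_paths_0)
  finally show "coord n (z_cochain m w) j i r = (\<Sum>b\<in>basis_paths 0. if fst b = j \<and> path_source b = i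
      then w b * (if b = (m, []) \<and> r = 2 * m then 1 else 0) else 0)" .
qed

text \<open>Degree \<open>2 * m + 1\<close> is too long for either edge at \<open>m\<close>, so the
  coordinate at \<open>m\<close> in degree \<open>2 * m\<close> enters no cocycle equation.\<close>

lemma z_cochain_Z:
  assumes "n = 2 * m + 1"
  shows "z_cochain m \<in> Z 0"
proof -
  have "z_cochain m \<in> carrier (C 0)"
    by (rule rep_imp_cochain[OF rep_z_cochain[OF assms]]) (simp add: z_cochain_def)
  from Z0_iff[OF this rep_z_cochain[OF assms]] show ?thesis
    using assms by (auto simp: adm_arr)
qed

text \<open>By \<open>T_0_zero_support\<close> one coordinate remains free, the one at which
  \<open>z_cochain m\<close> is 1; its value is therefore the scalar.\<close>

lemma T_0_zero_iff_middle:
  assumes "(2 :: 'a) \<noteq> 0" "n = 2 * m + 1" "g \<in> Z 0" "rep 0 g G"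
  shows "T 0 (hk 0 g) = \<zero>\<^bsub>H (Suc 0)\<^esub> \<longleftrightarrow> g = G (m, []) (2 * m) \<odot>\<^bsub>C 0\<^esub> z_cochain m"
proof -
  have n1: "n - 1 = 2 * m" using assms(2) by simp
  have "T 0 (hk 0 g) = \<zero>\<^bsub>H (Suc 0)\<^esub> \<longleftrightarrow>
      (\<forall>v k. adm n v v k \<longrightarrow> \<not> (k = 2 * v \<and> n - 1 = 2 * v) \<longrightarrow> G (v, []) k = 0)"
    by (rule T_0_zero_support[OF assms(1,3,4)])
  also have "\<dots> \<longleftrightarrow> (\<forall>b\<in>basis_paths 0. \<forall>r. admp b r \<longrightarrow>
      G b r = G (m, []) (2 * m) * (if b = (m, []) \<and> r = 2 * m then 1 else 0))"
  proof (intro iffI allI impI ballI)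
    fix v k assume *: "\<forall>b\<in>basis_paths 0. \<forall>r. admp b r \<longrightarrow>
        G b r = G (m, []) (2 * m) * (if b = (m, []) \<and> r = 2 * m then 1 else 0)"
      and a: "adm n v v k" and ne: "\<not> (k = 2 * v \<and> n - 1 = 2 * v)"
    have "v < n" using adm_bounds[OF a] n_ge by simp
    then have "(v, []) \<in> basis_paths 0" "admp (v, []) k" using a by (auto simp: basis_paths_0 admp_def)
    then have "G (v, []) k = G (m, []) (2 * m) * (if (v, []) = (m, [] :: arrow list) \<and> k = 2 * m then 1 else 0)"
      using * by blast
    moreover have "\<not> (v = m \<and> k = 2 * m)" using ne n1 by auto
    ultimately show "G (v, []) k = 0" by auto
  next
    fix b r assume *: "\<forall>v k. adm n v v k \<longrightarrow> \<not> (k = 2 * v \<and> n - 1 = 2 * v) \<longrightarrow> G (v, []) k = 0"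
      and b: "b \<in> basis_paths 0" and a: "admp b r"
    obtain v where v: "b = (v, [])" using b by (auto simp: basis_paths_0)
    then have av: "adm n v v r" using a by (simp add: admp_def)
    show "G b r = G (m, []) (2 * m) * (if b = (m, []) \<and> r = 2 * m then 1 else 0)"
    proof (cases "v = m \<and> r = 2 * m")
      case False
      then have "\<not> (r = 2 * v \<and> n - 1 = 2 * v)" using n1 by auto
      then show ?thesis using * av v False by auto
    qed (use v in simp)
  qed
  also have "\<dots> \<longleftrightarrow> g = G (m, []) (2 * m) \<odot>\<^bsub>C 0\<^esub> z_cochain m"
    by (rule rep_eq_iff[OF assms(4) rep_smult[OF rep_z_cochain[OF assms(2)]]
          cochainD(1)[OF Z_carrier[OF assms(3)]] C_ext(2), symmetric])
  finally show ?thesis .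
qed

lemma ZZ_0_odd:
  assumes "(2 :: 'a) \<noteq> 0" "n = 2 * m + 1"
  shows "ZZ 0 = (\<lambda>c. c \<odot>\<^bsub>H 0\<^esub> hk 0 (z_cochain m)) ` UNIV"
proof (intro equalityI subsetI)
  note zZ = z_cochain_Z[OF assms(2)]
  fix X assume "X \<in> ZZ 0"
  then have X: "X \<in> carrier (H 0)" "T 0 X = \<zero>\<^bsub>H (Suc 0)\<^esub>" by (auto simp: cocycles_def)
  obtain g where g: "g \<in> Z 0" "X = hk 0 g" using X(1) HK_carrier by auto
  obtain G where G: "rep 0 g G" using Z_carrier[OF g(1)] by (rule rep_exists)
  have "X = G (m, []) (2 * m) \<odot>\<^bsub>H 0\<^esub> hk 0 (z_cochain m)"
    using T_0_zero_iff_middle[OF assms g(1) G] X(2) g(2) hk_smult[OF zZ] by simp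
  then show "X \<in> (\<lambda>c. c \<odot>\<^bsub>H 0\<^esub> hk 0 (z_cochain m)) ` UNIV" by blast
next
  note zZ = z_cochain_Z[OF assms(2)]
  fix X assume "X \<in> (\<lambda>c. c \<odot>\<^bsub>H 0\<^esub> hk 0 (z_cochain m)) ` UNIV"
  then obtain c where c: "X = hk 0 (c \<odot>\<^bsub>C 0\<^esub> z_cochain m)" using hk_smult[OF zZ] by auto
  have cZ: "c \<odot>\<^bsub>C 0\<^esub> z_cochain m \<in> Z 0"
    using submodule.smult_closed[OF Z_submodule _ zZ] by simp
  have "T 0 X = \<zero>\<^bsub>H (Suc 0)\<^esub>"
    unfolding c T_0_zero_iff_middle[OF assms cZ rep_smult[OF rep_z_cochain[OF assms(2)]]] by simp
  moreover have "X \<in> carrier (H 0)" unfolding c HK_carrier using cZ by blast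
  ultimately show "X \<in> ZZ 0" by (simp add: cocycles_def)
qed

text \<open>The vertex \<open>m\<close> is the only one with admissible loops of degree
  \<open>2 * m\<close>, so being concentrated in that degree and being supported at the free
  coordinate are the same condition.\<close>

lemma HK_grade_middle:
  assumes "(2 :: 'a) \<noteq> 0" "n = 2 * m + 1"
  shows "ZZ 0 = HK_grade n 0 (2 * m)"
proof (intro equalityI subsetI)
  note zZ = z_cochain_Z[OF assms(2)]
  fix X assume "X \<in> ZZ 0"
  then obtain c where "X = c \<odot>\<^bsub>H 0\<^esub> hk 0 (z_cochain m)" using ZZ_0_odd[OF assms] by blast
  then have X: "X = hk 0 (c \<odot>\<^bsub>C 0\<^esub> z_cochain m)" using hk_smult[OF zZ] by simp
  have cZ: "c \<odot>\<^bsub>C 0\<^esub> z_cochain m \<in> Z 0"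
    using submodule.smult_closed[OF Z_submodule _ zZ] by simp
  have "(c \<odot>\<^bsub>C 0\<^esub> z_cochain m) ` W 0 \<subseteq> preproj_grade n (2 * m)"
  proof clarify
    fix w assume w: "w \<in> W 0"
    note r = repD[OF rep_smult[OF rep_z_cochain[OF assms(2)]] w]
    show "(c \<odot>\<^bsub>C 0\<^esub> z_cochain m) w \<in> preproj_grade n (2 * m)"
      unfolding preproj_grade_iff r(2) using r(1) by (auto simp: mask_def intro!: sum.neutral)
  qed
  then show "X \<in> HK_grade n 0 (2 * m)" unfolding HK_grade_def using X cZ by blast
next
  fix X :: "'a cochain set" assume "X \<in> HK_grade n 0 (2 * m)"
  then obtain g where g: "g \<in> Z 0" "X = hk 0 g" "g ` W 0 \<subseteq> preproj_grade n (2 * m)"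
    unfolding HK_grade_def by blast
  obtain G where G: "rep 0 g G" using Z_carrier[OF g(1)] by (rule rep_exists)
  have "T 0 (hk 0 g) = \<zero>\<^bsub>H (Suc 0)\<^esub>"
    unfolding T_0_zero_support[OF assms(1) g(1) G]
  proof (intro allI impI)
    fix v k assume a: "adm n v v k" and ne: "\<not> (k = 2 * v \<and> n - 1 = 2 * v)"
    have "k \<noteq> 2 * m" using a ne assms(2) by (auto simp: adm_loop)
    have "v < n" using adm_bounds[OF a] n_ge by simp
    then have b: "(v, []) \<in> basis_paths 0" by (simp add: basis_paths_0)
    have "G (v, []) k = coord n (g (basis_elt 0 (v, []))) v v k"
      using rep_at_basis[OF G b, of k] a by (simp add: admp_def)
    also have "\<dots> = 0"
      using g(3) basis_elt_W[OF b] \<open>k \<noteq> 2 * m\<close> preproj_grade_iff by blast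
    finally show "G (v, []) k = 0" .
  qed
  then show "X \<in> ZZ 0" using g HK_carrier by (auto simp: cocycles_def)
qed

text \<open>The cocycles are the multiples of a single class, which exhibits them as a submodule and
  hence the higher cohomology as a quotient module.\<close>

lemma HKhi_0_module:
  assumes "(2 :: 'a) \<noteq> 0" "n = 2 * m + 1"
  shows "quotient_module class_ring (BB 0) (H 0\<lparr>carrier := ZZ 0\<rparr>)"
proof -
  interpret M: Module.module class_ring "H 0" by (rule HK_module)
  let ?x = "hk 0 (z_cochain m)"
  have x: "?x \<in> carrier (H 0)" unfolding HK_carrier using z_cochain_Z[OF assms(2)] by blast
  have "submodule class_ring (ZZ 0) (H 0)"
    unfolding ZZ_0_odd[OF assms]
  proof (rule submodule.intro)
    show "(\<lambda>c. c \<odot>\<^bsub>H 0\<^esub> ?x) ` UNIV \<subseteq> carrier (H 0)" using M.smult_closed[of _ ?x] x by auto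
    fix X Y assume "X \<in> (\<lambda>c. c \<odot>\<^bsub>H 0\<^esub> ?x) ` UNIV" "Y \<in> (\<lambda>c. c \<odot>\<^bsub>H 0\<^esub> ?x) ` UNIV"
    then obtain c d where "X = c \<odot>\<^bsub>H 0\<^esub> ?x" "Y = d \<odot>\<^bsub>H 0\<^esub> ?x" by blast
    then have "X \<oplus>\<^bsub>H 0\<^esub> Y = (c + d) \<odot>\<^bsub>H 0\<^esub> ?x" using M.smult_l_distr[of c d ?x] x by simp
    then show "X \<oplus>\<^bsub>H 0\<^esub> Y \<in> (\<lambda>c. c \<odot>\<^bsub>H 0\<^esub> ?x) ` UNIV" by blast
  next
    have "\<zero>\<^bsub>H 0\<^esub> = 0 \<odot>\<^bsub>H 0\<^esub> ?x" using M.smult_l_null[of ?x] x by simp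
    then show "\<zero>\<^bsub>H 0\<^esub> \<in> (\<lambda>c. c \<odot>\<^bsub>H 0\<^esub> ?x) ` UNIV" by blast
  next
    fix c X assume "X \<in> (\<lambda>c. c \<odot>\<^bsub>H 0\<^esub> ?x) ` UNIV"
    then obtain d where "X = d \<odot>\<^bsub>H 0\<^esub> ?x" by blast
    then have "c \<odot>\<^bsub>H 0\<^esub> X = (c * d) \<odot>\<^bsub>H 0\<^esub> ?x" using M.smult_assoc1[of c d ?x] x by simp
    then show "c \<odot>\<^bsub>H 0\<^esub> X \<in> (\<lambda>c. c \<odot>\<^bsub>H 0\<^esub> ?x) ` UNIV" by blast
  qed (rule HK_module)
  moreover have "BB 0 \<subseteq> ZZ 0"
    unfolding BB_0 using submodule.zero_closed[OF calculation] by blast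
  ultimately show ?thesis
    unfolding BB_0 by (intro quotient_module.intro submodule_restrict zero_submodule HK_module)
qed

text \<open>No coboundaries arise in degree 0, so the class of z spans, and it is independent
  because z has the coordinate 1 at the middle vertex.\<close>

lemma HKhi_0_odd:
  assumes "(2 :: 'a) \<noteq> 0" "n = 2 * m + 1"
  defines "x \<equiv> hi 0 (hk 0 (z_cochain m))"
  shows "vectorspace.dim class_ring (V 0) = 1"
    and "carrier (V 0) = LinearCombinations.module.span class_ring (V 0) {x}"
proof -
  note Q = HKhi_0_module[OF assms(1,2)]
  have Veq: "V 0 = quot_module (H 0\<lparr>carrier := ZZ 0\<rparr>) (BB 0)"
    by (simp add: HKhi_def cohomology_def)
  have VM: "Module.module class_ring (V 0)"
    unfolding Veq by (rule quotient_module.quot_module_is_module[OF Q])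
  interpret V: vectorspace class_ring "V 0"
    by (intro vectorspace.intro VM class_field)
  let ?y = "hk 0 (z_cochain m)"
  interpret M: Module.module class_ring "H 0" by (rule HK_module)
  have y: "?y \<in> carrier (H 0)" unfolding HK_carrier using z_cochain_Z[OF assms(2)] by blast
  have "1 \<odot>\<^bsub>H 0\<^esub> ?y = ?y" using M.smult_one[of ?y] y by simp
  then have yZ: "?y \<in> ZZ 0" unfolding ZZ_0_odd[OF assms(1,2)] by (metis rangeI)
  have sm: "c \<odot>\<^bsub>V 0\<^esub> x = hi 0 (c \<odot>\<^bsub>H 0\<^esub> ?y)" for c
    using quotient_module.quot_smult[OF Q, of c ?y] yZ
    by (simp add: x_def Veq HKhi_class_def coh_class_def coset_restrict)
  have xV: "x \<in> carrier (V 0)" unfolding x_def V_carrier using yZ by blast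
  have lc: "V.lincomb a {x} = a x \<odot>\<^bsub>V 0\<^esub> x" for a
    using V.lincomb_insert[of "{}" a x] xV V.smult_closed[of "a x" x] by (simp add: V.lincomb_def)
  have "carrier (V 0) = {a x \<odot>\<^bsub>V 0\<^esub> x | a. True}"
  proof -
    have "carrier (V 0) = range (\<lambda>c. c \<odot>\<^bsub>V 0\<^esub> x)"
      unfolding V_carrier ZZ_0_odd[OF assms(1,2)] sm by (simp add: image_image)
    also have "\<dots> = {a x \<odot>\<^bsub>V 0\<^esub> x | a. True}"
    proof (intro equalityI subsetI)
      fix u assume "u \<in> range (\<lambda>c. c \<odot>\<^bsub>V 0\<^esub> x)"
      then obtain c where "u = c \<odot>\<^bsub>V 0\<^esub> x" by blast
      then show "u \<in> {a x \<odot>\<^bsub>V 0\<^esub> x | a. True}" by (intro CollectI exI[of _ "\<lambda>_. c"]) simp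
    qed blast
    finally show ?thesis .
  qed
  moreover have "V.span {x} = {a x \<odot>\<^bsub>V 0\<^esub> x | a. True}"
    using V.finite_span[of "{x}"] xV by (simp add: lc)
  ultimately show span: "carrier (V 0) = V.span {x}" by simp
  have "V.lin_indpt {x}"
  proof (rule V.finite_lin_indpt2)
    fix a assume "V.lincomb a {x} = \<zero>\<^bsub>V 0\<^esub>"
    then have "hi 0 (a x \<odot>\<^bsub>H 0\<^esub> ?y) = BB 0" by (simp only: lc sm V_zero)
    moreover have "a x \<odot>\<^bsub>H 0\<^esub> ?y \<in> carrier (H 0)" using M.smult_closed[of "a x" ?y] y by simp
    ultimately have "a x \<odot>\<^bsub>H 0\<^esub> ?y = \<zero>\<^bsub>H 0\<^esub>"
      using hi_zero_coboundaries[OF BB_0] BB_0 by auto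
    then have "hk 0 (a x \<odot>\<^bsub>C 0\<^esub> z_cochain m) = B 0"
      using hk_smult[OF z_cochain_Z[OF assms(2)]] HK_zero by simp
    then have "a x \<odot>\<^bsub>C 0\<^esub> z_cochain m \<in> B 0"
      using hk_zero_iff C_smult_closed Z_carrier[OF z_cochain_Z[OF assms(2)]] by blast
    \<comment> \<open>Admissibility is what allows this coordinate to detect the scalar
      \<open>a x\<close>.\<close>
    moreover have "adm n m m (2 * m)" using assms(2) by (simp add: adm_loop)
    ultimately have "a x * (if (m, []) = (m, [] :: arrow list) \<and> 2 * m = 2 * m then 1 else 0) = 0"
      using rep_0_zero_iff[OF C_smult_closed[OF Z_carrier[OF z_cochain_Z[OF assms(2)]]]
          rep_smult[OF rep_z_cochain[OF assms(2)]]] by blast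
    then show "\<forall>v\<in>{x}. a v = \<zero>\<^bsub>class_ring\<^esub>" by simp
  qed (use xV in auto)
  then have "V.basis {x}" unfolding V.basis_def using span xV by auto
  then show "V.dim = 1" using V.dim_basis[of "{x}"] by simp
qed

end

theorem proposition6p6:
  fixes n m :: nat
  assumes "n \<ge> 3" and "m = (n - 1) div 2"
  shows
    "(CHAR('a::field) = 2 \<longrightarrow>
        (\<forall>p. HKhi_equals n p (carrier (HK n p :: ('a, 'a cochain set) module)))) \<and>
     (CHAR('a) \<noteq> 2 \<and> even n \<longrightarrow>
        HKhi_equals n 2 (carrier (HK n 2 :: ('a, 'a cochain set) module)) \<and>
        (\<forall>p. p \<noteq> 2 \<longrightarrow>
           carrier (HKhi n p :: ('a, 'a cochain set set) module) = {\<zero>\<^bsub>HKhi n p\<^esub>})) \<and>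
     (CHAR('a) \<noteq> 2 \<and> odd n \<longrightarrow>
        HKhi_equals n 0 (HK_grade n 0 (2 * m) :: 'a cochain set set) \<and>
        vectorspace.dim class_ring (HKhi n 0 :: ('a, 'a cochain set set) module) = 1 \<and>
        carrier (HKhi n 0 :: ('a, 'a cochain set set) module) =
          LinearCombinations.module.span class_ring (HKhi n 0)
            {HKhi_class n 0 (centre_class n (z_elt n m))} \<and>
        HKhi_equals n 2 (carrier (HK n 2 :: ('a, 'a cochain set) module)) \<and>
        (\<forall>p. p \<noteq> 0 \<and> p \<noteq> 2 \<longrightarrow>
           carrier (HKhi n p :: ('a, 'a cochain set set) module) = {\<zero>\<^bsub>HKhi n p\<^esub>}))"
proof -
  interpret typeA n "TYPE('a)" by (rule typeA.intro) (rule assms(1))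
  have ge_1: "carrier (V p) = {\<zero>\<^bsub>V p\<^esub>}" if "(2 :: 'a) \<noteq> 0" "p \<noteq> 0" "p \<noteq> 2" for p
  proof (cases "p = 1")
    case False
    then show ?thesis using that by (intro HKhi_ge_3) simp
  qed (use HKhi_1[OF that(1)] in simp)
  have even: "carrier (V p) = {\<zero>\<^bsub>V p\<^esub>}" if "(2 :: 'a) \<noteq> 0" "even n" "p \<noteq> 2" for p
    using ge_1[of p] HKhi_0_even that by (cases "p = 0") simp_all
  have odd: "HKhi_equals n 0 (HK_grade n 0 (2 * m) :: 'a cochain set set)"
    "vectorspace.dim class_ring (V 0) = 1"
    "carrier (V 0) = LinearCombinations.module.span class_ring (V 0) {hi 0 (centre_class n (z_elt n m))}"
    if "(2 :: 'a) \<noteq> 0" "odd n"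
  proof -
    have nm: "n = 2 * m + 1" using assms(2) that(2) by presburger
    have c: "centre_class n (z_elt n m) = hk 0 (z_cochain m)"
      by (simp add: centre_class_def z_cochain_def)
    show "HKhi_equals n 0 (HK_grade n 0 (2 * m) :: 'a cochain set set)"
      by (rule HKhi_equalsI[OF HK_grade_middle[OF that(1) nm] BB_0])
    show "vectorspace.dim class_ring (V 0) = 1"
      "carrier (V 0) = LinearCombinations.module.span class_ring (V 0) {hi 0 (centre_class n (z_elt n m))}"
      unfolding c by (rule HKhi_0_odd[OF that(1) nm])+
  qed
  show ?thesis
    unfolding char_2_iff
    by (intro conjI impI allI; (elim conjE)?)
      (rule HKhi_char_2 HKhi_2 even ge_1 odd, assumption+ | rule HKhi_2)+
qed

end
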